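(* Let $n \geqslant 1$, let $\lambda$ be an integer partition with $\lambda_1+\ell(\lambda)-1=n$, and let $c \in \mathfrak{S}_{n+1}$ be a Coxeter element. Then the map $\mathcal{RSK}_{\lambda,c}$ is a bijection from the set of fillings of shape $\lambda$ (functions $\mathrm{Fer}(\lambda)\to\mathbb{N}$) onto the set $\mathrm{RPP}(\lambda)$ of reverse plane partitions of shape $\lambda$.
   Context: Integer partitions $\lambda=(\lambda_1\geqslant\dots\geqslant\lambda_p>0)$, $\ell(\lambda)=p$; Ferrers diagram $\mathrm{Fer}(\lambda)=\{(i,j)\in(\mathbb{N}^* )^2: j\leqslant\lambda_i\}$ (matrix coordinates). A filling of shape $\lambda$ is a map $f:\mathrm{Fer}(\lambda)\to\mathbb{N}$; it is a reverse plane partition if it is weakly increasing for the componentwise order on $\mathrm{Fer}(\lambda)$. Diagonals: for $k\in\{1,\dots,n\}$, $D_k(\lambda)=\{(i,j)\in\mathrm{Fer}(\lambda):\lambda_1+i-j=k\}$ and $\delta_k=\max\{\min(i,j):(i,j)\in D_k(\lambda)\}$ ($=\#D_k(\lambda)$). The $\lambda$-diagonal coordinates of $(i,j)\in D_k(\lambda)$ are $\langle k,\delta\rangle_\lambda$ with $\delta=\delta_k-\min(i,j)+1\in\{1,\dots,\delta_k\}$. Row/column labels: label the unit segments of the south-east boundary of $\mathrm{Fer}(\lambda)$ by $1,\dots,n+1$ going from top-right to bottom-left; each row and each column gets the label of its boundary segment. Let $\mathbf L=\{\ell_1<\dots<\ell_p\}$ be the set of row labels (row $i$ labelled $\ell_i$)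 and $\mathbf R=\{r_1<\dots<r_q\}$ the set of column labels (column $j$ labelled $r_{q-j+1}$); then $1\in \mathbf L$, $n+1\in\mathbf R$, $\mathbf L\sqcup\mathbf R=\{1,\dots,n+1\}$, and $(i,j)\in\mathrm{Fer}(\lambda)$ iff $\ell_i<r_{q-j+1}$. Write $[\ell,r]$ for the box in row labelled $\ell$ and column labelled $r$. Coxeter elements: $s_i=(i,i+1)$; $c\in\mathfrak{S}_{n+1}$ is a Coxeter element if it is a product of $s_1,\dots,s_n$ in some order, each appearing exactly once. Auslander–Reiten quiver $\mathrm{AR}(c)$: directed graph with vertices the transpositions $(i,j)$, $1\le i<j\le n+1$, and arrows $(i,j)\to(i,c(j))$ whenever $i<c(j)$, and $(i,j)\to(c(i),j)$ whenever $c(i)<j$; it is acyclic. For $k\in\{1,\dots,n\}$, $\mathrm{AR}^{[k]}(c)$ is its full subgraph on vertices $(\ell,r)$ with $\ell\leqslant k<r$. Greene–Kleitman invariant: for an acyclic directed graph $G$ and $g:G_0\to\mathbb{N}$, a path is a sequence of vertices $(v_0,\dots,v_m)$, $m\ge0$, with consecutive vertices joined by arrows; for $t\ge1$ let $M_t$ be the maximum over $t$-tuples of paths of $\sum_{v}g(v)$, the sum over the union of the vertex sets of the paths, and $M_0=0$; $\mathrm{GK}_G(g)=(M_t-M_{t-1})_{t\geqslant1}$, an integer partition. Definition of $\mathcal{RSK}_{\lambda,c}$: for a filling $f$ of $\lambda$, let $\mathrm{rep}_{\lambda,c}(f)$ be the filling of $\mathrm{AR}(c)$ with $\mathrm{rep}_{\lambda,c}(f)(\ell,r)=f([\ell,r])$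 if $\ell\in\mathbf L$, $r\in\mathbf R$, $\ell<r$, and $0$ otherwise. Then $\mathcal{RSK}_{\lambda,c}(f)$ is the filling of $\lambda$ with $\mathcal{RSK}_{\lambda,c}(f)(\langle k,\delta\rangle_\lambda)$ equal to the $\delta$-th part of $\mathrm{GK}_{\mathrm{AR}^{[k]}(c)}$ applied to the restriction of $\mathrm{rep}_{\lambda,c}(f)$ to $\mathrm{AR}^{[k]}(c)$. *)

theory Defs
  imports Main "HOL-Library.FuncSet"
begin

definition is_partition :: "nat list \<Rightarrow> bool" where
  "is_partition lam \<longleftrightarrow> sorted_wrt (\<ge>) lam \<and> 0 \<notin> set lam"

definition part1 :: "nat list \<Rightarrow> nat" where
  "part1 lam = (case lam of [] \<Rightarrow> 0 | x # _ \<Rightarrow> x)"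

definition part :: "nat list \<Rightarrow> nat \<Rightarrow> nat" where
  "part lam i = lam ! (i - 1)"

definition Fer :: "nat list \<Rightarrow> (nat \<times> nat) set" where
  "Fer lam = {(i, j). 1 \<le> i \<and> i \<le> length lam \<and> 1 \<le> j \<and> j \<le> part lam i}"

definition fillings :: "nat list \<Rightarrow> ((nat \<times> nat) \<Rightarrow> nat) set" where
  "fillings lam = Fer lam \<rightarrow>\<^sub>E (UNIV :: nat set)"

definition RPP :: "nat list \<Rightarrow> ((nat \<times> nat) \<Rightarrow> nat) set" where
  "RPP lam = {f \<in> fillings lam. \<forall>i j i' j'. (i, j) \<in> Fer lam \<and> (i', j') \<in> Fer lam
      \<and> i \<le> i' \<and> j \<le> j' \<longrightarrow> f (i, j) \<le> f (i', j')}"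

definition diag :: "nat list \<Rightarrow> nat \<Rightarrow> (nat \<times> nat) set" where
  "diag lam k = {(i, j) \<in> Fer lam. int (part1 lam) + int i - int j = int k}"

definition delta :: "nat list \<Rightarrow> nat \<Rightarrow> nat" where
  "delta lam k = Max ((\<lambda>(i, j). min i j) ` diag lam k)"

definition conj_part :: "nat list \<Rightarrow> nat \<Rightarrow> nat" where
  "conj_part lam j = card {i. 1 \<le> i \<and> i \<le> length lam \<and> j \<le> part lam i}"

text \<open>Label of the boundary segment of row i (vertical segment) and of column j
  (horizontal segment), numbering the south-east boundary segments 1..n+1 from
  top-right to bottom-left: before the vertical segment of row i come i-1 vertical
  segments and lambda_1 - lambda_i horizontal ones; before the horizontal segment of
  column j come lambda'_j vertical segments and lambda_1 - j horizontal ones.\<close>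

definition row_label :: "nat list \<Rightarrow> nat \<Rightarrow> nat" where
  "row_label lam i = i + (part1 lam - part lam i)"

definition col_label :: "nat list \<Rightarrow> nat \<Rightarrow> nat" where
  "col_label lam j = conj_part lam j + (part1 lam - j) + 1"

definition row_labels :: "nat list \<Rightarrow> nat set" where
  "row_labels lam = row_label lam ` {1..length lam}"

definition col_labels :: "nat list \<Rightarrow> nat set" where
  "col_labels lam = col_label lam ` {1..part1 lam}"

definition box :: "nat list \<Rightarrow> nat \<Rightarrow> nat \<Rightarrow> nat \<times> nat" where
  "box lam l r = (THE (i, j). i \<in> {1..length lam} \<and> j \<in> {1..part1 lam}
       \<and> row_label lam i = l \<and> col_label lam j = r)"

definition simple_transp :: "nat \<Rightarrow> nat \<Rightarrow> nat" where
  "simple_transp i = (\<lambda>x. if x = i then Suc i else if x = Suc i then i else x)"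

definition coxeter_element :: "nat \<Rightarrow> (nat \<Rightarrow> nat) \<Rightarrow> bool" where
  "coxeter_element n c \<longleftrightarrow> (\<exists>as. distinct as \<and> set as = {1..n}
      \<and> c = foldr (\<lambda>a g. simple_transp a \<circ> g) as id)"

definition AR_vertices :: "nat \<Rightarrow> (nat \<times> nat) set" where
  "AR_vertices n = {(i, j). 1 \<le> i \<and> i < j \<and> j \<le> n + 1}"

definition AR_edge :: "(nat \<Rightarrow> nat) \<Rightarrow> nat \<times> nat \<Rightarrow> nat \<times> nat \<Rightarrow> bool" where
  "AR_edge c v w \<longleftrightarrow> (case v of (i, j) \<Rightarrow>
      (i < c j \<and> w = (i, c j)) \<or> (c i < j \<and> w = (c i, j)))"

text \<open>Full subgraph AR^[k](c): vertices (l, r) with l \<le> k < r (edges: those of AR(c)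
  between such vertices, enforced through the vertex set in paths).\<close>

definition AR_k_vertices :: "nat \<Rightarrow> nat \<Rightarrow> (nat \<times> nat) set" where
  "AR_k_vertices n k = {(l, r) \<in> AR_vertices n. l \<le> k \<and> k < r}"

definition is_path :: "'v set \<Rightarrow> ('v \<Rightarrow> 'v \<Rightarrow> bool) \<Rightarrow> 'v list \<Rightarrow> bool" where
  "is_path V E p \<longleftrightarrow> p \<noteq> [] \<and> set p \<subseteq> V \<and> (\<forall>i. Suc i < length p \<longrightarrow> E (p ! i) (p ! Suc i))"

definition GK_M :: "'v set \<Rightarrow> ('v \<Rightarrow> 'v \<Rightarrow> bool) \<Rightarrow> ('v \<Rightarrow> nat) \<Rightarrow> nat \<Rightarrow> nat" where
  "GK_M V E g t = (if t = 0 then 0 else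
     Max {sum g (\<Union>p \<in> set ps. set p) | ps. length ps = t \<and> (\<forall>p \<in> set ps. is_path V E p)})"

definition GK_part :: "'v set \<Rightarrow> ('v \<Rightarrow> 'v \<Rightarrow> bool) \<Rightarrow> ('v \<Rightarrow> nat) \<Rightarrow> nat \<Rightarrow> nat" where
  "GK_part V E g t = GK_M V E g t - GK_M V E g (t - 1)"

definition rep :: "nat list \<Rightarrow> ((nat \<times> nat) \<Rightarrow> nat) \<Rightarrow> nat \<times> nat \<Rightarrow> nat" where
  "rep lam f = (\<lambda>(l, r). if l \<in> row_labels lam \<and> r \<in> col_labels lam \<and> l < r
                          then f (box lam l r) else 0)"

definition RSK :: "nat list \<Rightarrow> (nat \<Rightarrow> nat) \<Rightarrow> ((nat \<times> nat) \<Rightarrow> nat) \<Rightarrow> (nat \<times> nat) \<Rightarrow> nat" where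
  "RSK lam c f = restrict (\<lambda>(i, j).
      let n = part1 lam + length lam - 1;
          k = part1 lam + i - j;
          d = delta lam k - min i j + 1
      in GK_part (AR_k_vertices n k) (AR_edge c) (rep lam f) d) (Fer lam)"

end

(*
Reading the rows 1..k and the columns k+1..n+1 of AR^[k](c) in the order in which c runs through them,
AR^[k](c) is a grid, and passing from k to k+1 adds a row at one end or deletes a column at one end.
Each label is of type "row" or "column" (given by the boundary of lambda) and has a sign "up" or "down"
(whether c raises or lowers it); so the shapes GK^[k] form a sequence interlacing along the boundary of
lambda, and such sequences are the reverse plane partitions, read along diagonals.

For adjacent labels j, j+1 of opposite sign, exchanging the two labels changes only the shape at j.
If both are rows, the old and the new shape at j are related by a toggle. If j is a row and j+1 is a column,
the exchange deletes the corner box [j, j+1] and the old shape is given by the local rule of RSK.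
Both rules are three-term (tropical Pluecker) relations between maximal weights of unions of t chains.
The second one follows from the first by adding a point of huge weight. In the first one, "at most" is an
alternating path argument for two families of chains, and "at least" comes from encoding families of
chains as height functions on the grid, on which the weight is linear and min and max can be taken.

Signs in the initial run of rows can be changed by toggles, since the sign of the first row is irrelevant.
Hence some corner box can always be made removable, and one inducts on the number of boxes.
*)
theory Submission
  imports Defs "HOL-Combinatorics.Transposition"
begin

section \<open>Unions of chains and height functions\<close>

text \<open>The bijection is proved for every sign predicate \<open>u\<close> and every type
  predicate \<open>L\<close> on the labels. A Coxeter element forces \<open>u 1\<close> and
  \<open>\<not> u (n + 1)\<close>, and exchanging labels or changing signs may destroy this, so the
  induction needs all of them. Everything is phrased through comparability alone: reversing all
  signs reverses the order and keeps the chains, which halves the cases. The signs matter because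
  the coordinate of a row label is plus or minus the label. Hence the largest label is always an
  extreme row, and if the two largest labels have opposite signs, they occupy the two ends of the
  grid. This is the configuration of the toggle relation, with inner rows \<open>K\<close>, top row
  \<open>X\<close> and bottom row \<open>Y\<close>. The difficulty there is to control these two
  rows. In one direction the exchange must move all of \<open>Y\<close> and nothing of
  \<open>X\<close>; therefore \<open>Y\<close> is first gathered on one chain. In the other
  direction two height functions are replaced by their minimum and maximum, and this respects the
  two rows only if one function dominates near each of them. Saturated height functions achieve
  this, and the shift by 1 in the second term of the relation has the same purpose.\<close>

definition chain_cov :: "('a \<Rightarrow> 'a \<Rightarrow> bool) \<Rightarrow> nat \<Rightarrow> 'a set \<Rightarrow> bool" where
  "chain_cov le t U \<longleftrightarrow>
    (\<exists>f :: 'a \<Rightarrow> nat. \<forall>x\<in>U. f x < t \<and> (\<forall>y\<in>U. f x = f y \<longrightarrow> le x y \<or> le y x))"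

text \<open>The sum of the first \<open>t\<close> Greene--Kleitman parts, with chains in place of
  paths. Chains are colour classes, so they are disjoint and may be empty, and fewer than
  \<open>t\<close> chains need no separate treatment.\<close>

definition gk :: "('a \<Rightarrow> 'a \<Rightarrow> bool) \<Rightarrow> 'a set \<Rightarrow> ('a \<Rightarrow> nat) \<Rightarrow> nat \<Rightarrow> nat" where
  "gk le V w t = Max (sum w ` {U. U \<subseteq> V \<and> chain_cov le t U})"

lemma chain_cov_subset: "chain_cov le t U \<Longrightarrow> U' \<subseteq> U \<Longrightarrow> chain_cov le t U'"
  unfolding chain_cov_def by (meson subsetD)

lemma chain_cov_mono: "chain_cov le t U \<Longrightarrow> t \<le> t' \<Longrightarrow> chain_cov le t' U"
  unfolding chain_cov_def by (meson order_less_le_trans)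

lemma chain_cov_empty [simp]: "chain_cov le t {}"
  unfolding chain_cov_def by auto

lemma chain_cov_0 [simp]: "chain_cov le 0 U \<longleftrightarrow> U = {}"
  unfolding chain_cov_def by auto

lemma chain_cov_transport:
  assumes "inj_on g U"
    and "\<And>x y. x \<in> U \<Longrightarrow> y \<in> U \<Longrightarrow> le' (g x) (g y) \<or> le' (g y) (g x) \<longleftrightarrow> le x y \<or> le y x"
  shows "chain_cov le' t (g ` U) \<longleftrightarrow> chain_cov le t U"
proof
  assume "chain_cov le' t (g ` U)"
  then obtain f :: "_ \<Rightarrow> nat" where
    "\<forall>x\<in>g ` U. f x < t \<and> (\<forall>y\<in>g ` U. f x = f y \<longrightarrow> le' x y \<or> le' y x)"
    unfolding chain_cov_def by blast
  then show "chain_cov le t U"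
    unfolding chain_cov_def using assms(2) by (intro exI[of _ "\<lambda>x. f (g x)"]) auto
next
  assume "chain_cov le t U"
  then obtain f :: "_ \<Rightarrow> nat" where
    f: "\<forall>x\<in>U. f x < t \<and> (\<forall>y\<in>U. f x = f y \<longrightarrow> le x y \<or> le y x)"
    unfolding chain_cov_def by blast
  show "chain_cov le' t (g ` U)"
    unfolding chain_cov_def
    using f assms(2) by (intro exI[of _ "\<lambda>x. f (inv_into U g x)"]) (auto simp: inv_into_f_f[OF assms(1)])
qed

lemma gk_ge: "finite V \<Longrightarrow> U \<subseteq> V \<Longrightarrow> chain_cov le t U \<Longrightarrow> sum w U \<le> gk le V w t"
  unfolding gk_def by (intro Max_ge) auto

lemma gk_obtain:
  assumes "finite V"
  obtains U where "U \<subseteq> V" "chain_cov le t U" "gk le V w t = sum w U"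
proof -
  have "gk le V w t \<in> sum w ` {U. U \<subseteq> V \<and> chain_cov le t U}"
    unfolding gk_def using assms by (intro Max_in) (auto intro!: exI[of _ "{}"])
  then show ?thesis using that by auto
qed

lemma gk_0 [simp]: "gk le V w 0 = 0"
proof -
  have "{U. U \<subseteq> V \<and> U = {}} = {{}}" by auto
  then show ?thesis by (simp add: gk_def)
qed

lemma gk_mono:
  assumes "finite V'" "V \<subseteq> V'" "t \<le> t'"
  shows "gk le V w t \<le> gk le V' w t'"
proof -
  have "finite V" using assms finite_subset by blast
  then obtain U where "U \<subseteq> V" "chain_cov le t U" "gk le V w t = sum w U"
    by (rule gk_obtain)
  moreover have "chain_cov le t' U" using calculation assms(3) chain_cov_mono by blast
  ultimately show ?thesis using gk_ge[of V' U le t' w] assms by simp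
qed

lemma gk_le_sum:
  assumes "finite V"
  shows "gk le V w t \<le> sum w V"
  by (metis assms gk_obtain sum_mono2 zero_le)

lemma gk_total:
  assumes "finite V" "chain_cov le t V"
  shows "gk le V w t = sum w V"
  using gk_ge[OF assms(1) order_refl assms(2)] gk_le_sum[OF assms(1)] by (meson le_antisym)

lemma gk_transport:
  assumes inj: "inj_on g V"
    and cmp: "\<And>x y. x \<in> V \<Longrightarrow> y \<in> V \<Longrightarrow> le' (g x) (g y) \<or> le' (g y) (g x) \<longleftrightarrow> le x y \<or> le y x"
    and w: "\<And>x. x \<in> V \<Longrightarrow> w' (g x) = w x"
  shows "gk le' (g ` V) w' t = gk le V w t"
proof -
  have cov: "chain_cov le' t (g ` U) \<longleftrightarrow> chain_cov le t U" if "U \<subseteq> V" for U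
    by (rule chain_cov_transport) (use that cmp inj_on_subset[OF inj that] in blast)+
  have "{U. U \<subseteq> g ` V \<and> chain_cov le' t U} = (`) g ` {U. U \<subseteq> V \<and> chain_cov le t U}"
  proof (intro set_eqI iffI)
    fix U' assume U': "U' \<in> {U. U \<subseteq> g ` V \<and> chain_cov le' t U}"
    then have "U' \<subseteq> g ` V" by simp
    then obtain U where U: "U \<subseteq> V" "U' = g ` U" unfolding subset_image_iff by blast
    have "chain_cov le t U" using U' cov[OF U(1)] U(2) by simp
    then show "U' \<in> (`) g ` {U. U \<subseteq> V \<and> chain_cov le t U}" using U by auto
  next
    fix U' assume "U' \<in> (`) g ` {U. U \<subseteq> V \<and> chain_cov le t U}"
    then obtain U where U: "U \<subseteq> V" "chain_cov le t U" "U' = g ` U" by auto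
    have "chain_cov le' t (g ` U)" using cov[OF U(1)] U(2) by simp
    then show "U' \<in> {U. U \<subseteq> g ` V \<and> chain_cov le' t U}" using U by auto
  qed
  moreover have "sum w' (g ` U) = sum w U" if "U \<subseteq> V" for U
    using that inj w by (subst sum.reindex) (auto intro: inj_on_subset intro!: sum.cong)
  ultimately show ?thesis
    unfolding gk_def by (auto simp: image_image intro!: arg_cong[of _ _ Max] image_cong)
qed

lemma gk_cong_le:
  assumes "\<And>x y. x \<in> V \<Longrightarrow> y \<in> V \<Longrightarrow> le' x y \<or> le' y x \<longleftrightarrow> le x y \<or> le y x"
    and "\<And>x. x \<in> V \<Longrightarrow> w' x = w x"
  shows "gk le' V w' t = gk le V w t"
  using gk_transport[of id V le' le w' w t] assms by simp

lemma gk_support: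
  assumes "finite V" "V' \<subseteq> V" "\<And>x. x \<in> V - V' \<Longrightarrow> w x = 0"
  shows "gk le V w t = gk le V' w t"
proof (rule antisym)
  obtain U where U: "U \<subseteq> V" "chain_cov le t U" "gk le V w t = sum w U"
    using gk_obtain[OF assms(1)] .
  have "sum w U = sum w (U \<inter> V')"
    using U assms(3) finite_subset[OF U(1) assms(1)] by (intro sum.mono_neutral_right) blast+
  also have "\<dots> \<le> gk le V' w t"
    using U assms by (intro gk_ge) (auto intro: finite_subset chain_cov_subset)
  finally show "gk le V w t \<le> gk le V' w t" using U by simp
qed (use assms gk_mono in blast)

lemma chain_cov_rows:
  assumes "\<And>x y. x \<in> U \<Longrightarrow> y \<in> U \<Longrightarrow> rk x = rk y \<Longrightarrow> le x y \<or> le y x"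
    and "\<And>x. x \<in> U \<Longrightarrow> rk x < t"
  shows "chain_cov le t U"
  unfolding chain_cov_def using assms by blast

section \<open>Families of chains in the integer grid as height functions; rows grow to the south,
  columns to the east\<close>

definition le2 :: "int \<times> int \<Rightarrow> int \<times> int \<Rightarrow> bool" where
  "le2 x y \<longleftrightarrow> fst x \<le> fst y \<and> snd x \<le> snd y"

text \<open>\<open>H (r, c)\<close> stands for the number of chains passing weakly south-west of \<open>(r, c)\<close>; the
  points \<open>x\<close> with \<open>dH H x = 1\<close> are those covered by the chains.\<close>

definition hvalid :: "nat \<Rightarrow> (int \<times> int \<Rightarrow> int) \<Rightarrow> bool" where
  "hvalid t H \<longleftrightarrow> (\<forall>r c. 0 \<le> H (r, c) \<and> H (r, c) \<le> int t \<and> H (r, c) \<le> H (r, c + 1)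
     \<and> H (r + 1, c) \<le> H (r, c) \<and> H (r, c) \<le> H (r + 1, c - 1) + 1)"

definition dH :: "(int \<times> int \<Rightarrow> int) \<Rightarrow> int \<times> int \<Rightarrow> int" where
  "dH H x = H x - H (fst x + 1, snd x - 1)"

lemma hvalid_mono:
  assumes "hvalid t H" "r' \<le> r" "c \<le> c'"
  shows "H (r, c) \<le> H (r', c')"
proof -
  have a: "H (r, c) \<le> H (r, c + int i)" for i
  proof (induction i)
    case (Suc i)
    have "H (r, c + int i) \<le> H (r, c + int i + 1)" using assms(1) unfolding hvalid_def by blast
    then show ?case using Suc by (simp add: add.commute add.left_commute)
  qed simp
  have b: "H (r, c') \<le> H (r - int i, c')" for i
  proof (induction i)
    case (Suc i)
    have "H (r - int i - 1 + 1, c') \<le> H (r - int i - 1, c')" using assms(1) unfolding hvalid_def by blast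
    then show ?case using Suc by (simp add: algebra_simps)
  qed simp
  show ?thesis using a[of "nat (c' - c)"] b[of "nat (r - r')"] assms by simp
qed

lemma hvalid_dH:
  assumes "hvalid t H"
  shows "dH H x = 0 \<or> dH H x = 1"
proof -
  obtain r c where x: "x = (r, c)" by (cases x)
  have "H (r, c) \<le> H (r + 1, c - 1) + 1" using assms unfolding hvalid_def by blast
  moreover have "H (r + 1, c - 1) \<le> H (r, c)" using hvalid_mono[OF assms] by simp
  ultimately show ?thesis unfolding dH_def x by auto
qed

text \<open>Each level of \<open>H\<close> is one chain: if \<open>y\<close> is strictly south-west
  of \<open>x\<close> and \<open>dH H x = 1\<close>, monotonicity gives
  \<open>H y \<le> H x - 1\<close>, so covered points of equal height are comparable. Covered points
  have height at least 1, which leaves \<open>t\<close> levels.\<close>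

lemma hvalid_cov:
  assumes H: "hvalid t H"
  shows "chain_cov le2 t {x \<in> V. dH H x = 1}"
proof -
  have pos: "0 \<le> H x" "H x \<le> int t" for x
    using H unfolding hvalid_def by (metis prod.collapse)+
  have aux: False if "dH H x = 1" "H x = H y" "fst x < fst y" "snd y < snd x" for x y
    using hvalid_mono[OF H, of "fst x + 1" "fst y" "snd y" "snd x - 1"] that unfolding dH_def by simp
  show ?thesis
  proof (rule chain_cov_rows[where rk = "\<lambda>x. nat (H x - 1)"])
    fix x y assume *: "x \<in> {x \<in> V. dH H x = 1}" "y \<in> {x \<in> V. dH H x = 1}"
      "nat (H x - 1) = nat (H y - 1)"
    have "H x \<ge> 1" "H y \<ge> 1" using * pos(1)[of "(fst x + 1, snd x - 1)"]
        pos(1)[of "(fst y + 1, snd y - 1)"] unfolding dH_def by auto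
    then have "H x = H y" using * by linarith
    then show "le2 x y \<or> le2 y x" using aux[of x y] aux[of y x] * unfolding le2_def by fastforce
  next
    fix x assume "x \<in> {x \<in> V. dH H x = 1}"
    then have "H x \<ge> 1" using pos(1)[of "(fst x + 1, snd x - 1)"] unfolding dH_def by auto
    then show "nat (H x - 1) < t" using pos(2)[of x] by linarith
  qed
qed

lemma hvalid_weight:
  assumes "finite V" "hvalid t H"
  shows "(\<Sum>x\<in>V. int (w x) * dH H x) \<le> int (gk le2 V w t)"
proof -
  have "(\<Sum>x\<in>V. int (w x) * dH H x) = (\<Sum>x\<in>{x \<in> V. dH H x = 1}. int (w x))"
  proof -
    have "int (w x) * dH H x = (if dH H x = 1 then int (w x) else 0)" for x
      using hvalid_dH[OF assms(2), of x] by auto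
    then show ?thesis using assms(1) by (simp add: sum.If_cases Int_def)
  qed
  also have "\<dots> = int (sum w {x \<in> V. dH H x = 1})" by simp
  also have "\<dots> \<le> int (gk le2 V w t)"
    using gk_ge[OF assms(1) _ hvalid_cov[OF assms(2)], of V w] by (intro of_nat_mono) auto
  finally show ?thesis .
qed

text \<open>For distinct points this is incomparability in \<open>le2\<close>; the strict form shows
  that an antichain meets each row at most once.\<close>

definition anti :: "(int \<times> int) set \<Rightarrow> bool" where
  "anti A \<longleftrightarrow> (\<forall>x\<in>A. \<forall>y\<in>A. x \<noteq> y \<longrightarrow>
     fst x < fst y \<and> snd y < snd x \<or> fst y < fst x \<and> snd x < snd y)"

text \<open>By Dilworth duality the largest antichain south-west of \<open>x\<close> measures how
  many chains pass there. This is a canonical choice of height function for \<open>U\<close>,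
  independent of any chosen chains.\<close>

definition height :: "(int \<times> int) set \<Rightarrow> int \<times> int \<Rightarrow> int" where
  "height U x = int (Max (card ` {A. A \<subseteq> U \<and> anti A \<and> (\<forall>y\<in>A. fst x \<le> fst y \<and> snd y \<le> snd x)}))"

lemma height_ge:
  assumes "finite U" "A \<subseteq> U" "anti A" "\<And>y. y \<in> A \<Longrightarrow> fst x \<le> fst y \<and> snd y \<le> snd x"
  shows "int (card A) \<le> height U x"
  unfolding height_def using assms by (intro of_nat_mono Max_ge) auto

lemma height_obtain:
  assumes "finite U"
  obtains A where "A \<subseteq> U" "anti A" "\<And>y. y \<in> A \<Longrightarrow> fst x \<le> fst y \<and> snd y \<le> snd x"
    "height U x = int (card A)"
proof -
  have "Max (card ` {A. A \<subseteq> U \<and> anti A \<and> (\<forall>y\<in>A. fst x \<le> fst y \<and> snd y \<le> snd x)})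
     \<in> card ` {A. A \<subseteq> U \<and> anti A \<and> (\<forall>y\<in>A. fst x \<le> fst y \<and> snd y \<le> snd x)}"
    using assms by (intro Max_in) (auto intro!: exI[of _ "{}"] simp: anti_def)
  then show ?thesis using that unfolding height_def by auto
qed

lemma anti_subset: "anti A \<Longrightarrow> B \<subseteq> A \<Longrightarrow> anti B"
  unfolding anti_def by blast

lemma anti_inj_fst: "anti A \<Longrightarrow> inj_on fst A"
  unfolding anti_def inj_on_def by fastforce

lemma height_quadrant_mono:
  assumes "finite U" "r' \<le> r" "c \<le> c'"
  shows "height U (r, c) \<le> height U (r', c')"
proof -
  obtain A where "A \<subseteq> U" "anti A" "\<And>y. y \<in> A \<Longrightarrow> fst (r, c) \<le> fst y \<and> snd y \<le> snd (r, c)"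
    "height U (r, c) = int (card A)"
      by (rule height_obtain[where x = "(r, c)", OF assms(1)]) (rule that; assumption | blast)
  then show ?thesis using height_ge[OF assms(1), of A "(r', c')"] assms(2,3) by fastforce
qed

lemma height_valid:
  assumes fin: "finite U" and bd: "\<And>A. A \<subseteq> U \<Longrightarrow> anti A \<Longrightarrow> card A \<le> t"
  shows "hvalid t (height U)"
  unfolding hvalid_def
proof (intro allI conjI)
  fix r c
  show "0 \<le> height U (r, c)" unfolding height_def by simp
  show "height U (r, c) \<le> height U (r, c + 1)" "height U (r + 1, c) \<le> height U (r, c)"
    by (rule height_quadrant_mono[OF fin]; simp)+
  obtain A where A: "A \<subseteq> U" "anti A" "\<And>y. y \<in> A \<Longrightarrow> fst (r, c) \<le> fst y \<and> snd y \<le> snd (r, c)"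
    "height U (r, c) = int (card A)"
      by (rule height_obtain[where x = "(r, c)", OF fin]) (rule that; assumption | blast)
  show "height U (r, c) \<le> int t" using A bd[of A] by simp
  show "height U (r, c) \<le> height U (r + 1, c - 1) + 1"
  proof (cases "A = {}")
    case True
    then show ?thesis using A(4) unfolding height_def by simp
  next
    case False
    have finA: "finite A" using A(1) fin finite_subset by blast
    \<comment> \<open>Without its northernmost point, the antichain fits into the quadrant shifted
      by \<open>(1, -1)\<close>, so the height drops by at most 1 along the shift.\<close>
    obtain z where z: "z \<in> A" "\<And>y. y \<in> A \<Longrightarrow> fst z \<le> fst y"
      using finite_has_minimal[of "fst ` A"] finA False
      by (smt (verit, best) arg_min_if_finite(1) arg_min_least)
    have "int (card (A - {z})) \<le> height U (r + 1, c - 1)"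
    proof (rule height_ge[OF fin])
      show "A - {z} \<subseteq> U" "anti (A - {z})" using A(1,2) anti_subset by blast+
      fix y assume y: "y \<in> A - {z}"
      then have "fst z < fst y \<and> snd y < snd z"
        using A(2) z unfolding anti_def by (metis DiffD1 DiffD2 insertI1 leD)
      then show "fst (r + 1, c - 1) \<le> fst y \<and> snd y \<le> snd (r + 1, c - 1)"
        using A(3)[of z] z(1) by auto
    qed
    moreover have "card A = Suc (card (A - {z}))" using z(1) finA by (metis card.remove)
    ultimately show ?thesis using A(4) by simp
  qed
qed

text \<open>An antichain in the quadrant shifted by \<open>(1, -1)\<close> lies strictly south-west
  of \<open>x\<close>, so the point \<open>x\<close> itself can be added to it.\<close>

lemma height_dH_ge:
  assumes fin: "finite U" and x: "x \<in> U"
  shows "dH (height U) x \<ge> 1"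
proof -
  obtain A where A: "A \<subseteq> U" "anti A"
    "\<And>y. y \<in> A \<Longrightarrow> fst (fst x + 1, snd x - 1) \<le> fst y \<and> snd y \<le> snd (fst x + 1, snd x - 1)"
    "height U (fst x + 1, snd x - 1) = int (card A)"
      by (rule height_obtain[where x = "(fst x + 1, snd x - 1)", OF fin]) (rule that; assumption | blast)
  have less: "fst x < fst y \<and> snd y < snd x" if "y \<in> A" for y using A(3)[OF that] by auto
  have "int (card (insert x A)) \<le> height U x"
    using A less x unfolding anti_def by (intro height_ge[OF fin]) (auto simp: anti_def less_imp_le)
  moreover have "card (insert x A) = Suc (card A)"
    using less[of x] finite_subset[OF A(1) fin] by (intro card_insert_disjoint) blast+
  ultimately show ?thesis unfolding dH_def using A(4) by simp
qed

lemma chain_cov_anti: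
  assumes "chain_cov le2 t U" "A \<subseteq> U" "anti A"
  shows "card A \<le> t"
proof -
  obtain f :: "_ \<Rightarrow> nat" where
    f: "\<forall>x\<in>U. f x < t \<and> (\<forall>y\<in>U. f x = f y \<longrightarrow> le2 x y \<or> le2 y x)"
    using assms(1) unfolding chain_cov_def by blast
  have "inj_on f A"
  proof (rule inj_onI, rule ccontr)
    fix x y assume *: "x \<in> A" "y \<in> A" "f x = f y" "x \<noteq> y"
    then have "le2 x y \<or> le2 y x" using f assms(2) by blast
    then show False using assms(3) * unfolding anti_def le2_def by fastforce
  qed
  moreover have "f ` A \<subseteq> {..<t}" using f assms(2) by blast
  ultimately show ?thesis by (metis card_image card_lessThan card_mono finite_lessThan)
qed

text \<open>The antidiagonal added to the left of \<open>U\<close> forces the height function to be saturated along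
  the top rows without affecting the chain condition.\<close>

lemma height_exists:
  assumes fin: "finite U" and cov: "chain_cov le2 t U"
    and rows: "\<And>x. x \<in> U \<Longrightarrow> r0 < fst x \<and> fst x \<le> r1" and cols: "\<And>x. x \<in> U \<Longrightarrow> c0 < snd x"
    and t: "r0 + int t \<le> r1"
  obtains H where "hvalid t H" "\<And>x. x \<in> U \<Longrightarrow> dH H x = 1"
    "\<And>c. c0 \<le> c \<Longrightarrow> H (r0 + 1, c) = int t"
    "\<And>c. c0 \<le> c \<Longrightarrow> H (r0 + 2, c) \<ge> int t - 1"
    "\<And>c. H (r1, c) \<le> 1" "\<And>r c. r1 < r \<Longrightarrow> H (r, c) = 0"
proof -
  define D where "D s = (\<lambda>i. (r0 + 1 + int i, c0 - int i)) ` {s..<t}" for s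
  define U' where "U' = U \<union> D 0"
  have fin': "finite U'" unfolding U'_def D_def using fin by auto
  have D_anti: "anti (D s)" for s unfolding anti_def D_def by force
  have D_card: "card (D s) = t - s" for s unfolding D_def by (subst card_image) (auto simp: inj_on_def)
  have bd: "card A \<le> t" if A: "A \<subseteq> U'" "anti A" for A
  proof (cases "A \<subseteq> U")
    case True
    then show ?thesis using chain_cov_anti[OF cov] A by blast
  next
    case False
    then obtain x where "x \<in> A" "x \<notin> U" by blast
    then obtain i where i: "i < t" "(r0 + 1 + int i, c0 - int i) \<in> A"
      using A(1) unfolding U'_def D_def by auto
    \<comment> \<open>The added antidiagonal is to the left of \<open>U\<close>, so the points of
      \<open>A\<close> in \<open>U\<close> lie strictly above the chosen antidiagonal point. All
      rows of \<open>A\<close> are thus among the \<open>t\<close> rows of the antidiagonal, and an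
      antichain has distinct rows.\<close>
    have "fst ` A \<subseteq> {r0 + 1..r0 + int t}"
    proof
      fix r assume "r \<in> fst ` A"
      then obtain x where x: "x \<in> A" "r = fst x" by auto
      show "r \<in> {r0 + 1..r0 + int t}"
      proof (cases "x \<in> U")
        case True
        then have "x \<noteq> (r0 + 1 + int i, c0 - int i)" using cols[of x] by auto
        then have "fst x < r0 + 1 + int i"
          using A(2) i(2) x(1) cols[OF True] unfolding anti_def by fastforce
        then show ?thesis using rows[OF True] x i(1) by auto
      next
        case False
        then show ?thesis using x A(1) unfolding U'_def D_def by auto
      qed
    qed
    then have "card (fst ` A) \<le> card {r0 + 1..r0 + int t}" by (intro card_mono) auto
    then show ?thesis using card_image[OF anti_inj_fst[OF A(2)]] by simp
  qed
  have V: "hvalid t (height U')" using height_valid[OF fin' bd] .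
  \<comment> \<open>The bound \<open>r0 + int t \<le> r1\<close> keeps the last row of the
    antidiagonal from passing \<open>r1\<close>.\<close>
  have rows': "fst x \<le> r1" if "x \<in> U'" for x
    using that rows t unfolding U'_def D_def by fastforce
  show ?thesis
  proof (rule that[OF V])
    show "dH (height U') x = 1" if "x \<in> U" for x
      using height_dH_ge[OF fin', of x] hvalid_dH[OF V, of x] that unfolding U'_def by auto
    show "height U' (r0 + 1, c) = int t" if "c0 \<le> c" for c
    proof -
      have "int (card (D 0)) \<le> height U' (r0 + 1, c)"
        by (rule height_ge[OF fin' _ D_anti]) (use that in \<open>auto simp: U'_def D_def\<close>)
      moreover have "height U' (r0 + 1, c) \<le> int t" using V unfolding hvalid_def by blast
      ultimately show ?thesis using D_card by simp
    qed
    show "height U' (r0 + 2, c) \<ge> int t - 1" if "c0 \<le> c" for c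
    proof -
      have "int (card (D 1)) \<le> height U' (r0 + 2, c)"
        by (rule height_ge[OF fin' _ D_anti]) (use that in \<open>auto simp: U'_def D_def\<close>)
      then show ?thesis using D_card by simp
    qed
    show "height U' (r1, c) \<le> 1" for c
    proof -
      obtain A where A: "A \<subseteq> U'" "anti A"
        "\<And>y. y \<in> A \<Longrightarrow> fst (r1, c) \<le> fst y \<and> snd y \<le> snd (r1, c)"
        "height U' (r1, c) = int (card A)"
          by (rule height_obtain[where x = "(r1, c)", OF fin']) (rule that; assumption | blast)
      have "fst ` A \<subseteq> {r1}" using A(1,3) rows' by force
      then have "card (fst ` A) \<le> card {r1}" by (intro card_mono) auto
      then show ?thesis using card_image[OF anti_inj_fst[OF A(2)]] A(4) by simp
    qed
    show "height U' (r, c) = 0" if "r1 < r" for r c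
    proof -
      obtain A where A: "A \<subseteq> U'" "anti A"
        "\<And>y. y \<in> A \<Longrightarrow> fst (r, c) \<le> fst y \<and> snd y \<le> snd (r, c)"
        "height U' (r, c) = int (card A)"
          by (rule height_obtain[where x = "(r, c)", OF fin']) (rule that; assumption | blast)
      have "A = {}" using A(1,3) rows' that by force
      then show ?thesis using A(4) by simp
    qed
  qed
qed

lemma height_exists_plain:
  assumes "finite U" "chain_cov le2 t U"
  obtains H where "hvalid t H" "\<And>x. x \<in> U \<Longrightarrow> dH H x = 1"
    "\<And>r c. (\<And>x. x \<in> U \<Longrightarrow> fst x < r) \<Longrightarrow> H (r, c) = 0"
proof (rule that)
  show V: "hvalid t (height U)" using height_valid[OF assms(1)] chain_cov_anti[OF assms(2)] by blast
  show "dH (height U) x = 1" if "x \<in> U" for x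
    using height_dH_ge[OF assms(1) that] hvalid_dH[OF V, of x] by linarith
  fix r c assume *: "\<And>x. x \<in> U \<Longrightarrow> fst x < r"
  obtain A where A: "A \<subseteq> U" "anti A"
    "\<And>y. y \<in> A \<Longrightarrow> fst (r, c) \<le> fst y \<and> snd y \<le> snd (r, c)"
    "height U (r, c) = int (card A)"
      by (rule height_obtain[where x = "(r, c)", OF assms(1)]) (rule that; assumption | blast)
  have "A = {}" using A(1,3) * by force
  then show "height U (r, c) = 0" using A(4) by simp
qed

section \<open>Exchanging chains along alternating paths\<close>

definition key :: "int \<times> int \<Rightarrow> int" where "key x = fst x + snd x"

lemma key_less: "le2 x y \<Longrightarrow> x \<noteq> y \<Longrightarrow> key x < key y"
  unfolding le2_def key_def by (cases x, cases y) auto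

text \<open>Successor map of a family of disjoint chains: \<open>p x = Some x\<close> says that \<open>x\<close> is not covered, and
  \<open>p x = None\<close> that \<open>x\<close> is the end of its chain, so that \<open>t\<close> bounds the number of chains.\<close>

definition succ_map :: "(int \<times> int) set \<Rightarrow> nat \<Rightarrow> (int \<times> int \<Rightarrow> (int \<times> int) option) \<Rightarrow> bool" where
  "succ_map V t p \<longleftrightarrow> (\<forall>x\<in>V. \<forall>y. p x = Some y \<longrightarrow> y \<in> V \<and> le2 x y)
    \<and> (\<forall>x\<in>V. \<forall>y\<in>V. \<forall>z. p x = Some z \<longrightarrow> p y = Some z \<longrightarrow> x = y)
    \<and> card {x \<in> V. p x = None} \<le> t"

lemma succ_mapD:
  assumes "succ_map V t p"
  shows "x \<in> V \<Longrightarrow> p x = Some y \<Longrightarrow> y \<in> V \<and> le2 x y"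
    and "x \<in> V \<Longrightarrow> y \<in> V \<Longrightarrow> p x = Some z \<Longrightarrow> p y = Some z \<Longrightarrow> x = y"
    and "card {x \<in> V. p x = None} \<le> t"
  using assms unfolding succ_map_def by blast+

text \<open>Successors increase \<open>key\<close> strictly, so a covered point leads to an end
  \<open>p = None\<close>; injectivity prevents it from running into an uncovered fixed point.
  Predecessors are unique, so two points with the same end lie on one chain, and the ends serve as
  colours.\<close>

lemma succ_map_cov:
  assumes fin: "finite V" and p: "succ_map V t p"
  shows "chain_cov le2 t {x \<in> V. p x \<noteq> Some x}"
proof -
  note step = succ_mapD(1)[OF p] and inj = succ_mapD(2)[OF p] and card = succ_mapD(3)[OF p]
  define R where "R = {(x, y). x \<in> V \<and> p x = Some y \<and> x \<noteq> y}"
  have R_le: "le2 x y" if "(x, y) \<in> R\<^sup>*" for x y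
    using that
  proof (induction rule: rtrancl_induct)
    case base
    then show ?case by (simp add: le2_def)
  next
    case (step y z)
    then have "le2 y z" using succ_mapD(1)[OF p] unfolding R_def by blast
    then show ?case using step.IH unfolding le2_def by simp
  qed
  have "\<exists>z\<in>V. (x, z) \<in> R\<^sup>* \<and> p z = None" if "x \<in> V" "p x \<noteq> Some x" for x
    using that
  proof (induction "card {y \<in> V. key x < key y}" arbitrary: x rule: less_induct)
    case less
    show ?case
    proof (cases "p x")
      case None
      then show ?thesis using less.prems by blast
    next
      case (Some y)
      then have y: "y \<in> V" "le2 x y" "x \<noteq> y" using step less.prems by auto
      have "p y \<noteq> Some y" using inj[OF less.prems(1) y(1) Some] y(3) by blast
      have "{z \<in> V. key y < key z} \<subset> {z \<in> V. key x < key z}"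
        using key_less[OF y(2,3)] y(1) by (auto intro: less_trans)
      then have "card {z \<in> V. key y < key z} < card {z \<in> V. key x < key z}"
        using fin by (intro psubset_card_mono) auto
      from less.hyps[OF this y(1) \<open>p y \<noteq> Some y\<close>]
      obtain z where "z \<in> V" "(y, z) \<in> R\<^sup>*" "p z = None" by blast
      moreover have "(x, y) \<in> R" unfolding R_def using Some y less.prems by blast
      ultimately show ?thesis by (meson converse_rtrancl_into_rtrancl)
    qed
  qed
  then obtain e where e: "\<And>x. x \<in> V \<Longrightarrow> p x \<noteq> Some x \<Longrightarrow> e x \<in> V \<and> (x, e x) \<in> R\<^sup>* \<and> p (e x) = None"
    by metis
  obtain h where h: "bij_betw h {x \<in> V. p x = None} {0..<card {x \<in> V. p x = None}}"
    using ex_bij_betw_finite_nat[of "{x \<in> V. p x = None}"] fin by auto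
  have sv: "single_valued (R\<inverse>)" unfolding single_valued_def R_def using inj by blast
  show ?thesis
  proof (rule chain_cov_rows[where rk = "\<lambda>x. h (e x)"])
    fix x assume x: "x \<in> {x \<in> V. p x \<noteq> Some x}"
    then have "h (e x) \<in> {0..<card {x \<in> V. p x = None}}"
      using bij_betwE[OF h] e by blast
    then show "h (e x) < t" using card by simp
  next
    fix x y assume xy: "x \<in> {x \<in> V. p x \<noteq> Some x}" "y \<in> {x \<in> V. p x \<noteq> Some x}" "h (e x) = h (e y)"
    then have "e x = e y" using h e unfolding bij_betw_def inj_on_def by blast
    then have "(e x, x) \<in> (R\<inverse>)\<^sup>*" "(e x, y) \<in> (R\<inverse>)\<^sup>*"
      using e[of x] e[of y] xy by (auto simp: rtrancl_converse)
    then have "(x, y) \<in> (R\<inverse>)\<^sup>* \<or> (y, x) \<in> (R\<inverse>)\<^sup>*" using single_valued_confluent[OF sv] by blast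
    then show "le2 x y \<or> le2 y x" using R_le[of x y] R_le[of y x] by (auto simp: rtrancl_converse)
  qed
qed

text \<open>The successor is the next point of the same colour. The last two clauses, distinct
  colours of ends and successors that stay in \<open>U\<close>, serve to follow the chain along the
  bottom row in \<open>row_toggle_le\<close>.\<close>

lemma succ_map_exists:
  fixes f :: "int \<times> int \<Rightarrow> nat"
  assumes fin: "finite V" and U: "U \<subseteq> V"
    and f: "\<And>x. x \<in> U \<Longrightarrow> f x < t"
      "\<And>x y. x \<in> U \<Longrightarrow> y \<in> U \<Longrightarrow> f x = f y \<Longrightarrow> le2 x y \<or> le2 y x"
  shows "\<exists>p. succ_map V t p \<and> (\<forall>x\<in>V. p x = Some x \<longleftrightarrow> x \<notin> U)
    \<and> (\<forall>x\<in>V. \<forall>y\<in>V. p x = None \<longrightarrow> p y = None \<longrightarrow> f x = f y \<longrightarrow> x = y)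
    \<and> (\<forall>x\<in>U. \<forall>y. p x = Some y \<longrightarrow> y \<in> U)"
proof -
  define S where "S x = {y \<in> U. f y = f x \<and> le2 x y \<and> x \<noteq> y}" for x
  define p where "p x = (if x \<notin> U then Some x else if S x = {} then None
    else Some (arg_min_on key (S x)))" for x
  have finS: "finite (S x)" for x
    unfolding S_def using finite_subset[OF U fin] by simp
  have am: "arg_min_on key (S x) \<in> S x" "\<And>y. y \<in> S x \<Longrightarrow> key (arg_min_on key (S x)) \<le> key y"
    if "S x \<noteq> {}" for x
    using arg_min_if_finite(1)[OF finS that, of key] arg_min_least[OF finS that, of _ key] by auto
  have Some: "z \<in> S x \<and> (\<forall>y\<in>S x. key z \<le> key y)" if "x \<in> U" "p x = Some z" for x z
    using that am[of x] unfolding p_def by (auto split: if_splits)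
  have same: "x = y" if "x \<in> U" "y \<in> U" "p x = Some z" "p y = Some z" for x y z
  proof (rule ccontr)
    assume "x \<noteq> y"
    have aux: False if "le2 x y" "x \<in> U" "y \<in> U" "x \<noteq> y" "p x = Some z" "p y = Some z" for x y
    proof -
      have "z \<in> S x" "z \<in> S y" using Some that by blast+
      then have "y \<in> S x" using that unfolding S_def by auto
      then have "key z \<le> key y" using Some that by blast
      moreover have "key y < key z" using \<open>z \<in> S y\<close> key_less unfolding S_def by blast
      ultimately show False by simp
    qed
    have "f x = f y" using Some[OF that(1,3)] Some[OF that(2,4)] unfolding S_def by simp
    then show False using f(2)[OF that(1,2)] aux[of x y] aux[of y x] that \<open>x \<noteq> y\<close> by blast
  qed
  have none: "x = y" if "x \<in> V" "y \<in> V" "p x = None" "p y = None" "f x = f y" for x y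
  proof (rule ccontr)
    assume "x \<noteq> y"
    moreover have *: "x \<in> U" "y \<in> U" "S x = {}" "S y = {}" using that unfolding p_def by (auto split: if_splits)
    moreover have "le2 x y \<or> le2 y x" using f(2) * that(5) by blast
    ultimately have "y \<in> S x \<or> x \<in> S y" using that(5) unfolding S_def by auto
    then show False using * by blast
  qed
  have "y \<in> V \<and> le2 x y" if "x \<in> V" "p x = Some y" for x y
  proof (cases "x \<in> U")
    case True
    then show ?thesis using Some[OF True that(2)] U unfolding S_def by auto
  next
    case False
    then show ?thesis using that unfolding p_def le2_def by auto
  qed
  moreover have "y \<in> U" if "x \<in> U" "p x = Some y" for x y
    using Some[OF that] unfolding S_def by auto
  moreover have "x = y" if "x \<in> V" "y \<in> V" "p x = Some z" "p y = Some z" for x y z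
  proof (cases "x \<in> U"; cases "y \<in> U")
    assume "x \<in> U" "y \<notin> U"
    then have "z \<in> U" "z = y" using Some[of x z] that unfolding S_def p_def by auto
    then show ?thesis using \<open>y \<notin> U\<close> by simp
  next
    assume "x \<notin> U" "y \<in> U"
    then have "z \<in> U" "z = x" using Some[of y z] that unfolding S_def p_def by auto
    then show ?thesis using \<open>x \<notin> U\<close> by simp
  qed (use same that in \<open>auto simp: p_def\<close>)
  moreover have "p x = Some x \<longleftrightarrow> x \<notin> U" if "x \<in> V" for x
  proof (cases "x \<in> U")
    case True
    then show ?thesis using Some[of x x] unfolding S_def by blast
  qed (simp add: p_def)
  moreover have "card {x \<in> V. p x = None} \<le> t"
  proof -
    have "inj_on f {x \<in> V. p x = None}" using none unfolding inj_on_def by blast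
    moreover have "f ` {x \<in> V. p x = None} \<subseteq> {..<t}" using f(1) unfolding p_def by (auto split: if_splits)
    ultimately show ?thesis using card_inj_on_le[of f "{x \<in> V. p x = None}" "{..<t}"] by simp
  qed
  ultimately show ?thesis unfolding succ_map_def using none by (intro exI[of _ p]) blast
qed

text \<open>The component of \<open>b\<close> in the symmetric difference of two chain covers, which are given by their
  successor maps \<open>p\<close> and \<open>q\<close>: the covers can be exchanged along it.\<close>

inductive_set alternating :: "'a set \<Rightarrow> ('a \<Rightarrow> 'a option) \<Rightarrow> ('a \<Rightarrow> 'a option) \<Rightarrow> 'a \<Rightarrow> 'a set"
  for V p q b where
  base: "b \<in> alternating V p q b"
| step: "y \<in> alternating V p q b \<Longrightarrow> p y = Some z \<Longrightarrow> x \<in> V \<Longrightarrow> q x = Some z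
    \<Longrightarrow> x \<in> alternating V p q b"

text \<open>Each point of the component other than \<open>b\<close> has the
  \<open>q\<close>-successor that some point of the component has under \<open>p\<close>, and these
  points are distinct. So the component has \<open>b\<close> as its only \<open>q\<close>-end and at
  most one \<open>p\<close>-end. With a \<open>p\<close>-end the exchange preserves both numbers of
  chains, without one it shifts a chain from \<open>q\<close> to \<open>p\<close>.\<close>

lemma exchange_card:
  assumes fin: "finite V" and b: "b \<in> V" "q b = None"
    and injq: "\<And>x y z. x \<in> V \<Longrightarrow> y \<in> V \<Longrightarrow> q x = Some z \<Longrightarrow> q y = Some z \<Longrightarrow> x = y"
    and cp: "card {x \<in> V. p x = None} \<le> t" and cq: "card {x \<in> V. q x = None} \<le> t"
    and A: "A = alternating V p q b"
  shows "card {x \<in> V. (if x \<in> A then q x else p x) = None} \<le> t \<and>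
      card {x \<in> V. (if x \<in> A then p x else q x) = None} \<le> t \<or>
    card {x \<in> V. (if x \<in> A then q x else p x) = None} \<le> t + 1 \<and>
      card {x \<in> V. (if x \<in> A then p x else q x) = None} \<le> t - 1"
proof -
  have AV: "A \<subseteq> V"
  proof
    fix x assume "x \<in> A"
    then show "x \<in> V" unfolding A by (cases rule: alternating.cases) (use b in auto)
  qed
  have finA: "finite A" using AV fin finite_subset by blast
  have bA: "b \<in> A" unfolding A by (rule alternating.base)
  have pre: "\<exists>y\<in>A. p y = q x \<and> q x \<noteq> None" if "x \<in> A" "x \<noteq> b" for x
    using that(1) unfolding A
    by (cases rule: alternating.cases) (use that(2) in auto)
  define e where "e = {x \<in> A. p x = None}"
  have qA: "{x \<in> A. q x = None} = {b}" using pre b bA by fastforce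
  obtain g where g: "\<And>x. x \<in> A - {b} \<Longrightarrow> g x \<in> A \<and> p (g x) = q x \<and> q x \<noteq> None"
    using pre by (metis DiffE insertI1)
  have "card (A - {b}) \<le> card (A - e)"
  proof (rule card_inj_on_le[where f = g])
    show "inj_on g (A - {b})"
    proof (rule inj_onI)
      fix x y assume "x \<in> A - {b}" "y \<in> A - {b}" "g x = g y"
      then show "x = y" using g[of x] g[of y] injq[of x y] AV by force
    qed
    show "g ` (A - {b}) \<subseteq> A - e" using g unfolding e_def by force
  qed (use finA in auto)
  moreover have "card (A - {b}) = card A - 1" using bA finA by simp
  moreover have eA: "e \<subseteq> A" unfolding e_def by auto
  moreover have "card (A - e) = card A - card e"
    using finA eA by (meson card_Diff_subset finite_subset)
  moreover have "card e \<le> card A" using eA finA card_mono by blast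
  moreover have "card A \<ge> 1" using card_mono[OF finA, of "{b}"] bA by simp
  ultimately have e1: "card e \<le> 1" by linarith
  define P where "P = {x \<in> V - A. p x = None}"
  define Q where "Q = {x \<in> V - A. q x = None}"
  have fins: "finite P" "finite Q" "finite e" using fin finA unfolding P_def Q_def e_def by auto
  have disj: "P \<inter> e = {}" "Q \<inter> e = {}" "b \<notin> P" "b \<notin> Q"
    using bA unfolding P_def Q_def e_def by auto
  have "{x \<in> V. p x = None} = P \<union> e" using AV unfolding P_def e_def by auto
  then have 1: "card {x \<in> V. p x = None} = card P + card e" using fins disj by (simp add: card_Un_disjoint)
  have "{x \<in> V. q x = None} = insert b Q" using AV qA bA unfolding Q_def by auto
  then have 2: "card {x \<in> V. q x = None} = Suc (card Q)" using fins disj by simp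
  have "{x \<in> V. (if x \<in> A then q x else p x) = None} = insert b P" using AV qA bA unfolding P_def by auto
  then have 3: "card {x \<in> V. (if x \<in> A then q x else p x) = None} = Suc (card P)" using fins disj by simp
  have "{x \<in> V. (if x \<in> A then p x else q x) = None} = Q \<union> e" using AV unfolding Q_def e_def by auto
  then have 4: "card {x \<in> V. (if x \<in> A then p x else q x) = None} = card Q + card e"
    using fins disj by (simp add: card_Un_disjoint)
  show ?thesis using 1 2 3 4 cp cq e1 by linarith
qed

text \<open>Optimal unions \<open>S\<close> and \<open>T\<close> for the two terms on the left are
  exchanged along the alternating component that contains \<open>T \<inter> Y\<close>. It avoids
  \<open>X\<close>, so the new unions lie in \<open>X \<union> K \<union> Y\<close> and in
  \<open>K\<close>; the two cases of \<open>exchange_card\<close> give the two terms of the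
  maximum.\<close>

lemma row_toggle_le:
  assumes fin: "finite X" "finite K" "finite Y"
    and X: "\<And>x. x \<in> X \<Longrightarrow> fst x = r0" and Y: "\<And>x. x \<in> Y \<Longrightarrow> fst x = r1"
    and K: "\<And>x. x \<in> K \<Longrightarrow> r0 < fst x \<and> fst x < r1" and r: "r0 < r1"
  shows "gk le2 (X \<union> K) w t + gk le2 (K \<union> Y) w t \<le>
    max (gk le2 (X \<union> K \<union> Y) w t + gk le2 K w t)
        (gk le2 (X \<union> K \<union> Y) w (t + 1) + gk le2 K w (t - 1))"
proof -
  define V where "V = X \<union> K \<union> Y"
  have finV: "finite V" unfolding V_def using fin by auto
  have disj: "X \<inter> K = {}" "X \<inter> Y = {}" "K \<inter> Y = {}" using X Y K r by fastforce+
  have finXK: "finite (X \<union> K)" "finite (K \<union> Y)" using fin by auto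
  obtain S where S: "S \<subseteq> X \<union> K" "chain_cov le2 t S" "gk le2 (X \<union> K) w t = sum w S"
    using gk_obtain[OF finXK(1)] .
  obtain T where T: "T \<subseteq> K \<union> Y" "chain_cov le2 t T" "gk le2 (K \<union> Y) w t = sum w T"
    using gk_obtain[OF finXK(2)] .
  have YV: "x \<in> Y" if "x \<in> V" "r1 \<le> fst x" for x
    using that X[of x] K[of x] r unfolding V_def by auto
  have XV: "x \<in> X" if "x \<in> V" "fst x \<le> r0" for x
    using that Y[of x] K[of x] r unfolding V_def by auto
  show ?thesis
  proof (cases "T \<inter> Y = {}")
    case True
    then have "T \<subseteq> K" using T by auto
    then have "sum w T \<le> gk le2 K w t" using gk_ge T(2) fin by blast
    moreover have "sum w S \<le> gk le2 (X \<union> K \<union> Y) w t"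
      using gk_ge[OF _ _ S(2)] S(1) fin by (metis finite_UnI le_supI1)
    ultimately show ?thesis using S T by linarith
  next
    case False
    have finTY: "finite (T \<inter> Y)" using fin by auto
    \<comment> \<open>All of \<open>T \<inter> Y\<close> is recoloured with the colour of its
      leftmost point \<open>b0\<close>. The points of that colour outside \<open>Y\<close> lie above
      and weakly to the left of \<open>b0\<close>, hence below every point of
      \<open>T \<inter> Y\<close> in the order.\<close>
    define b0 where "b0 = arg_min_on snd (T \<inter> Y)"
    have b0: "b0 \<in> T" "b0 \<in> Y" "\<And>x. x \<in> T \<Longrightarrow> x \<in> Y \<Longrightarrow> snd b0 \<le> snd x"
      using arg_min_if_finite(1)[OF finTY False, of snd] arg_min_least[OF finTY False, of _ snd]
      unfolding b0_def by auto
    obtain f :: "_ \<Rightarrow> nat" where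
      f: "\<And>x. x \<in> T \<Longrightarrow> f x < t" "\<And>x y. x \<in> T \<Longrightarrow> y \<in> T \<Longrightarrow> f x = f y \<Longrightarrow> le2 x y \<or> le2 y x"
      using T(2) unfolding chain_cov_def by blast
    define f' where "f' x = (if x \<in> Y then f b0 else f x)" for x
    have f'1: "f' x < t" if "x \<in> T" for x using f(1) b0 that unfolding f'_def by auto
    have aux: "le2 y x" if "x \<in> T" "y \<in> T" "x \<in> Y" "y \<notin> Y" "f y = f b0" for x y
    proof -
      have "fst y < r1" using that T(1) K by blast
      then have "le2 y b0" using f(2)[OF that(2) b0(1) that(5)] Y[OF b0(2)] unfolding le2_def by auto
      moreover have "le2 b0 x" using Y b0 that unfolding le2_def by simp
      ultimately show ?thesis unfolding le2_def by simp
    qed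
    have f'2: "le2 x y \<or> le2 y x" if xy: "x \<in> T" "y \<in> T" "f' x = f' y" for x y
    proof (cases "x \<in> Y"; cases "y \<in> Y")
      assume "x \<in> Y" "y \<in> Y"
      then show ?thesis using Y unfolding le2_def by auto
    next
      assume "x \<in> Y" "y \<notin> Y"
      then show ?thesis using aux[of x y] xy unfolding f'_def by auto
    next
      assume "x \<notin> Y" "y \<in> Y"
      then show ?thesis using aux[of y x] xy unfolding f'_def by auto
    next
      assume "x \<notin> Y" "y \<notin> Y"
      then show ?thesis using f(2) xy unfolding f'_def by auto
    qed
    have TV: "T \<subseteq> V" and SV: "S \<subseteq> V" using S T unfolding V_def by auto
    have "\<exists>q. succ_map V t q \<and> (\<forall>x\<in>V. q x = Some x \<longleftrightarrow> x \<notin> T)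
      \<and> (\<forall>x\<in>V. \<forall>y\<in>V. q x = None \<longrightarrow> q y = None \<longrightarrow> f' x = f' y \<longrightarrow> x = y)
      \<and> (\<forall>x\<in>T. \<forall>y. q x = Some y \<longrightarrow> y \<in> T)"
      by (rule succ_map_exists[OF finV TV f'1 f'2])
    then obtain q where q0: "succ_map V t q" "\<forall>x\<in>V. q x = Some x \<longleftrightarrow> x \<notin> T"
      "\<forall>x\<in>V. \<forall>y\<in>V. q x = None \<longrightarrow> q y = None \<longrightarrow> f' x = f' y \<longrightarrow> x = y"
      "\<forall>x\<in>T. \<forall>y. q x = Some y \<longrightarrow> y \<in> T" by blast
    note q = succ_mapD[OF q0(1)] q0(2-4)[rule_format]
    obtain fs :: "_ \<Rightarrow> nat" where
      fs: "\<And>x. x \<in> S \<Longrightarrow> fs x < t" "\<And>x y. x \<in> S \<Longrightarrow> y \<in> S \<Longrightarrow> fs x = fs y \<Longrightarrow> le2 x y \<or> le2 y x"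
      using S(2) unfolding chain_cov_def by blast
    have "\<exists>p. succ_map V t p \<and> (\<forall>x\<in>V. p x = Some x \<longleftrightarrow> x \<notin> S)
      \<and> (\<forall>x\<in>V. \<forall>y\<in>V. p x = None \<longrightarrow> p y = None \<longrightarrow> fs x = fs y \<longrightarrow> x = y)
      \<and> (\<forall>x\<in>S. \<forall>y. p x = Some y \<longrightarrow> y \<in> S)"
      by (rule succ_map_exists[OF finV SV fs])
    then obtain p where p0: "succ_map V t p" "\<forall>x\<in>V. p x = Some x \<longleftrightarrow> x \<notin> S" by blast
    note p = succ_mapD[OF p0(1)] p0(2)[rule_format]
    have Ynext: "y \<in> T \<inter> Y \<and> key x < key y" if "x \<in> T \<inter> Y" "q x = Some y" for x y
    proof -
      have xV: "x \<in> V" using that TV by blast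
      have "y \<in> V" "le2 x y" using q(1)[OF xV that(2)] by auto
      moreover have "y \<noteq> x" using q(4)[OF xV] that by auto
      ultimately show ?thesis using YV[of y] Y[of x] that q(6)[of x y] key_less[of x y]
        unfolding le2_def by auto
    qed
    \<comment> \<open>The end of the chain that now contains all of \<open>T \<inter> Y\<close>; the
      exchange starts here.\<close>
    define b where "b = arg_min_on (\<lambda>x. - key x) (T \<inter> Y)"
    have bm: "b \<in> T \<inter> Y" "\<And>x. x \<in> T \<inter> Y \<Longrightarrow> key x \<le> key b"
      using arg_min_if_finite(1)[OF finTY False, of "\<lambda>x. - key x"]
        arg_min_least[OF finTY False, of _ "\<lambda>x. - key x"] unfolding b_def by auto
    have bq: "q b = None"
      using Ynext[OF bm(1)] bm(2) by (metis not_le option.exhaust)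
    have bV: "b \<in> V" using bm(1) TV by blast
    define A where "A = alternating V p q b"
    have AV: "A \<subseteq> V"
    proof
      fix x assume "x \<in> A"
      then show "x \<in> V" unfolding A_def by (cases rule: alternating.cases) (use bV in auto)
    qed
    \<comment> \<open>\<open>S\<close> avoids \<open>Y\<close>, so \<open>p\<close> fixes the points
      of \<open>Y\<close>. An alternating step from such a point therefore goes to its
      \<open>q\<close>-predecessor, and the component runs backwards along the whole of
      \<open>T \<inter> Y\<close>.\<close>
    have YA: "x \<in> A" if "x \<in> T \<inter> Y" for x
      using that
    proof (induction "nat (key b - key x)" arbitrary: x rule: less_induct)
      case less
      have xV: "x \<in> V" using less.prems TV by blast
      show ?case
      proof (cases "q x")
        case None
        have "f' x = f' b" using less.prems bm(1) unfolding f'_def by auto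
        then have "x = b" using q(5)[OF xV bV None bq] by simp
        then show ?thesis unfolding A_def by (simp add: alternating.base)
      next
        case (Some y)
        have y: "y \<in> T \<inter> Y" "key x < key y" using Ynext[OF less.prems Some] by simp_all
        have "nat (key b - key y) < nat (key b - key x)" using y bm(2)[of y] by simp
        then have "y \<in> A" using less.hyps y(1) by blast
        moreover have "p y = Some y" using p(4)[of y] y(1) TV S(1) disj by blast
        ultimately show ?thesis unfolding A_def using Some xV alternating.step by metis
      qed
    qed
    \<comment> \<open>\<open>T\<close> avoids \<open>X\<close>, so \<open>q\<close> fixes the points
      of \<open>X\<close>. Entering \<open>x\<close> in \<open>X\<close> requires
      \<open>p y = Some x\<close> for some \<open>y\<close> already in the component; such a
      \<open>y\<close> is in the top row too, which the induction excludes.\<close>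
    have XA: "x \<notin> X" if "x \<in> A" for x
      using that unfolding A_def
    proof (induction rule: alternating.induct)
      case base
      then show ?case using bm(1) disj by blast
    next
      case (step y z x)
      show ?case
      proof
        assume "x \<in> X"
        then have "x \<notin> T" using T(1) disj by blast
        then have "z = x" using q(4)[OF step.hyps(3)] step.hyps by simp
        moreover have "y \<in> V" using step.hyps(1) AV unfolding A_def by blast
        ultimately have "le2 y x" using p(1) step.hyps(2) by blast
        then have "y \<in> X" using XV[OF \<open>y \<in> V\<close>] X[OF \<open>x \<in> X\<close>] unfolding le2_def by simp
        then show False using step.IH by simp
      qed
    qed
    define q1 where "q1 x = (if x \<in> A then q x else p x)" for x
    define q2 where "q2 x = (if x \<in> A then p x else q x)" for x
    \<comment> \<open>Points whose successors under \<open>q\<close> and \<open>p\<close> coincide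
      are exchanged together; this keeps the two spliced maps injective.\<close>
    have mixed: "x \<in> A \<longleftrightarrow> y \<in> A" if "x \<in> V" "y \<in> V" "q x = Some z" "p y = Some z" for x y z
    proof
      assume "y \<in> A"
      then show "x \<in> A" unfolding A_def using that alternating.step[of y V p q b z x] by blast
    next
      assume "x \<in> A"
      then show "y \<in> A" unfolding A_def
      proof (cases rule: alternating.cases)
        case base
        then show "y \<in> alternating V p q b" using bq that by simp
      next
        case (step y' z')
        then have "z' = z" using that by simp
        then have "y' = y" using step p(2)[of y' y z] that AV unfolding A_def by blast
        then show "y \<in> alternating V p q b" using step by simp
      qed
    qed
    define U1 where "U1 = {x \<in> V. q1 x \<noteq> Some x}"
    define U2 where "U2 = {x \<in> V. q2 x \<noteq> Some x}"
    have cov1: "chain_cov le2 t1 U1" if card: "card {x \<in> V. q1 x = None} \<le> t1" for t1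
    proof -
      have "y \<in> V \<and> le2 x y" if "x \<in> V" "q1 x = Some y" for x y
        using that p(1)[of x y] q(1)[of x y] unfolding q1_def by (cases "x \<in> A") simp_all
      moreover have "x = y" if "x \<in> V" "y \<in> V" "q1 x = Some z" "q1 y = Some z" for x y z
      proof (cases "x \<in> A"; cases "y \<in> A")
        assume "x \<in> A" "y \<in> A"
        then show ?thesis using that q(2)[of x y z] unfolding q1_def by simp
      next
        assume "x \<in> A" "y \<notin> A"
        then show ?thesis using that mixed[of x y z] unfolding q1_def by simp
      next
        assume "x \<notin> A" "y \<in> A"
        then show ?thesis using that mixed[of y x z] unfolding q1_def by simp
      next
        assume "x \<notin> A" "y \<notin> A"
        then show ?thesis using that p(2)[of x y z] unfolding q1_def by simp
      qed
      ultimately have "succ_map V t1 q1" using card unfolding succ_map_def by blast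
      then show ?thesis unfolding U1_def by (rule succ_map_cov[OF finV])
    qed
    have cov2: "chain_cov le2 t1 U2" if card: "card {x \<in> V. q2 x = None} \<le> t1" for t1
    proof -
      have "y \<in> V \<and> le2 x y" if "x \<in> V" "q2 x = Some y" for x y
        using that p(1)[of x y] q(1)[of x y] unfolding q2_def by (cases "x \<in> A") simp_all
      moreover have "x = y" if "x \<in> V" "y \<in> V" "q2 x = Some z" "q2 y = Some z" for x y z
      proof (cases "x \<in> A"; cases "y \<in> A")
        assume "x \<in> A" "y \<in> A"
        then show ?thesis using that p(2)[of x y z] unfolding q2_def by simp
      next
        assume "x \<in> A" "y \<notin> A"
        then show ?thesis using that mixed[of y x z] unfolding q2_def by simp
      next
        assume "x \<notin> A" "y \<in> A"
        then show ?thesis using that mixed[of x y z] unfolding q2_def by simp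
      next
        assume "x \<notin> A" "y \<notin> A"
        then show ?thesis using that q(2)[of x y z] unfolding q2_def by simp
      qed
      ultimately have "succ_map V t1 q2" using card unfolding succ_map_def by blast
      then show ?thesis unfolding U2_def by (rule succ_map_cov[OF finV])
    qed
    have weights: "sum w U1 + sum w U2 = sum w S + sum w T"
    proof -
      have ind: "sum w {x \<in> V. Q x} = (\<Sum>x\<in>V. if Q x then w x else 0)" for Q
        using finV by (rule sum.inter_filter)
      have "S = {x \<in> V. p x \<noteq> Some x}" "T = {x \<in> V. q x \<noteq> Some x}" using p(4) q(4) SV TV by auto
      then show ?thesis unfolding U1_def U2_def
        by (simp only: ind sum.distrib[symmetric]) (auto simp: q1_def q2_def intro!: sum.cong)
    qed
    have U2K: "U2 \<subseteq> K"
    proof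
      fix x assume x: "x \<in> U2"
      then have xV: "x \<in> V" and ne: "q2 x \<noteq> Some x" unfolding U2_def by auto
      have "x \<notin> X"
      proof
        assume "x \<in> X"
        then have "x \<notin> A" "x \<notin> T" using XA T(1) disj by blast+
        then show False using ne q(4)[OF xV] unfolding q2_def by simp
      qed
      moreover have "x \<notin> Y"
      proof
        assume "x \<in> Y"
        then have "x \<notin> S" using S(1) disj by blast
        then show False using ne p(4)[OF xV] q(4)[OF xV] YA \<open>x \<in> Y\<close> unfolding q2_def
          by (auto split: if_splits)
      qed
      ultimately show "x \<in> K" using xV unfolding V_def by blast
    qed
    have U1V: "U1 \<subseteq> V" unfolding U1_def by auto
    have "card {x \<in> V. q1 x = None} \<le> t \<and> card {x \<in> V. q2 x = None} \<le> t \<or>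
       card {x \<in> V. q1 x = None} \<le> t + 1 \<and> card {x \<in> V. q2 x = None} \<le> t - 1"
      unfolding q1_def q2_def
      by (rule exchange_card[where b = b]) (use finV bV bq q(2,3) p(3) in \<open>auto simp: A_def\<close>)
    then show ?thesis
    proof
      assume "card {x \<in> V. q1 x = None} \<le> t \<and> card {x \<in> V. q2 x = None} \<le> t"
      then have "sum w U1 \<le> gk le2 V w t" "sum w U2 \<le> gk le2 K w t"
        using gk_ge[OF finV U1V] gk_ge[OF fin(2) U2K] cov1 cov2 by auto
      then show ?thesis using weights S T unfolding V_def by linarith
    next
      assume "card {x \<in> V. q1 x = None} \<le> t + 1 \<and> card {x \<in> V. q2 x = None} \<le> t - 1"
      then have "sum w U1 \<le> gk le2 V w (t + 1)" "sum w U2 \<le> gk le2 K w (t - 1)"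
        using gk_ge[OF finV U1V] gk_ge[OF fin(2) U2K] cov1 cov2 by auto
      then show ?thesis using weights S T unfolding V_def by linarith
    qed
  qed
qed

section \<open>The toggle and corner relations\<close>

lemma hvalid_I:
  assumes "\<And>r c. 0 \<le> H (r, c) \<and> H (r, c) \<le> int t \<and> H (r, c) \<le> H (r, c + 1)
     \<and> H (r + 1, c) \<le> H (r, c) \<and> H (r, c) \<le> H (r + 1, c - 1) + 1"
  shows "hvalid t H"
  using assms unfolding hvalid_def by blast

lemma hvalid_D:
  assumes "hvalid t H"
  shows "0 \<le> H (r, c) \<and> H (r, c) \<le> int t \<and> H (r, c) \<le> H (r, c + 1)
     \<and> H (r + 1, c) \<le> H (r, c) \<and> H (r, c) \<le> H (r + 1, c - 1) + 1"
  using assms unfolding hvalid_def by blast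

text \<open>Shifting by \<open>a\<close> before taking the extrema covers the two cases in which the numbers of chains
  are \<open>(t, t)\<close> and \<open>(t + 1, t - 1)\<close>.\<close>

lemma hvalid_min:
  assumes "hvalid s H" "hvalid t G" "int t + a \<le> int u \<or> int s \<le> int u" "0 \<le> a"
  shows "hvalid u (\<lambda>x. min (H x) (G x + a))"
proof (rule hvalid_I)
  fix r c
  show "0 \<le> min (H (r, c)) (G (r, c) + a) \<and> min (H (r, c)) (G (r, c) + a) \<le> int u \<and>
    min (H (r, c)) (G (r, c) + a) \<le> min (H (r, c + 1)) (G (r, c + 1) + a) \<and>
    min (H (r + 1, c)) (G (r + 1, c) + a) \<le> min (H (r, c)) (G (r, c) + a) \<and>
    min (H (r, c)) (G (r, c) + a) \<le> min (H (r + 1, c - 1)) (G (r + 1, c - 1) + a) + 1"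
    using hvalid_D[OF assms(1), of r c] hvalid_D[OF assms(2), of r c] assms(3,4) by linarith
qed

lemma hvalid_max:
  assumes "hvalid s H" "hvalid t G" "int s \<le> int u + a" "int t \<le> int u"
  shows "hvalid u (\<lambda>x. max (H x - a) (G x))"
proof (rule hvalid_I)
  fix r c
  show "0 \<le> max (H (r, c) - a) (G (r, c)) \<and> max (H (r, c) - a) (G (r, c)) \<le> int u \<and>
    max (H (r, c) - a) (G (r, c)) \<le> max (H (r, c + 1) - a) (G (r, c + 1)) \<and>
    max (H (r + 1, c) - a) (G (r + 1, c)) \<le> max (H (r, c) - a) (G (r, c)) \<and>
    max (H (r, c) - a) (G (r, c)) \<le> max (H (r + 1, c - 1) - a) (G (r + 1, c - 1)) + 1"
    using hvalid_D[OF assms(1), of r c] hvalid_D[OF assms(2), of r c] assms(3,4) by linarith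
qed

lemma hvalid_weight_ge:
  assumes "finite V" "hvalid t H" "U \<subseteq> V" "\<And>x. x \<in> U \<Longrightarrow> dH H x = 1"
  shows "int (sum w U) \<le> (\<Sum>x\<in>V. int (w x) * dH H x)"
proof -
  have "int (sum w U) = (\<Sum>x\<in>U. int (w x) * dH H x)" using assms(4) by simp
  also have "\<dots> \<le> (\<Sum>x\<in>V. int (w x) * dH H x)"
    using assms(1,3) hvalid_dH[OF assms(2)] by (intro sum_mono2)
      (auto, metis mult_nonneg_nonneg of_nat_0_le_iff zero_le_one order_refl)
  finally show ?thesis .
qed

text \<open>The last three conditions below hold for a pair of extrema of \<open>H\<close> and \<open>G\<close> if one of the two
  functions dominates the other near the rows \<open>X\<close> and \<open>Y\<close>.\<close>

lemma combine_heights: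
  assumes fin: "finite X" "finite K" "finite Y"
    and disj: "X \<inter> K = {}" "X \<inter> Y = {}" "K \<inter> Y = {}"
    and H: "hvalid s H" and G: "hvalid s' G" and A: "hvalid t A" and B: "hvalid t B"
    and N: "N \<subseteq> X \<union> K \<union> Y" "\<And>x. x \<in> N \<Longrightarrow> dH H x = 1"
    and M: "M \<subseteq> K" "\<And>x. x \<in> M \<Longrightarrow> dH G x = 1"
    and AX: "\<And>x. x \<in> X \<Longrightarrow> dH A x = dH H x" and BY: "\<And>x. x \<in> Y \<Longrightarrow> dH B x = dH H x"
    and AB: "\<And>x. A x + B x = H x + G x"
  shows "sum w N + sum w M \<le> gk le2 (X \<union> K) w t + gk le2 (K \<union> Y) w t"
proof -
  let ?S = "\<lambda>V H. \<Sum>x\<in>V. int (w x) * dH H x"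
  have d: "dH A x + dH B x = dH H x + dH G x" for x
    using AB[of x] AB[of "(fst x + 1, snd x - 1)"] unfolding dH_def by linarith
  have "int (sum w N) + int (sum w M) \<le> ?S (X \<union> K \<union> Y) H + ?S K G"
    using hvalid_weight_ge[OF _ H N, of w] hvalid_weight_ge[OF _ G M, of w] fin by (intro add_mono) auto
  also have "?S (X \<union> K \<union> Y) H = ?S X H + ?S K H + ?S Y H"
    using fin disj by (simp add: sum.union_disjoint Int_Un_distrib2)
  also have "?S X H + ?S K H + ?S Y H + ?S K G = ?S X H + ?S Y H + (?S K A + ?S K B)"
    using d by (simp add: sum.distrib[symmetric] distrib_left[symmetric])
  also have "?S X H = ?S X A" using AX by simp
  also have "?S Y H = ?S Y B" using BY by simp
  also have "?S X A + ?S Y B + (?S K A + ?S K B) = ?S (X \<union> K) A + ?S (K \<union> Y) B"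
    using fin disj by (simp add: sum.union_disjoint)
  also have "\<dots> \<le> int (gk le2 (X \<union> K) w t) + int (gk le2 (K \<union> Y) w t)"
    using fin by (intro add_mono hvalid_weight A B) auto
  finally show ?thesis by linarith
qed

text \<open>Two height functions \<open>H\<close> and \<open>G\<close>, for the large and the inner
  set, are replaced by \<open>A\<close> and \<open>B\<close> with the same sum. By linearity of the
  weight it suffices that \<open>A\<close> has the increments of \<open>H\<close> on the top row and
  \<open>B\<close> those on the bottom row.\<close>

lemma row_toggle_ge:
  assumes fin: "finite X" "finite K" "finite Y"
    and X: "\<And>x. x \<in> X \<Longrightarrow> fst x = r0" and Y: "\<And>x. x \<in> Y \<Longrightarrow> fst x = r1"
    and K: "\<And>x. x \<in> K \<Longrightarrow> r0 < fst x \<and> fst x < r1" and r: "r0 < r1" and t: "1 \<le> t"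
  shows "gk le2 (X \<union> K \<union> Y) w t + gk le2 K w t
      \<le> gk le2 (X \<union> K) w t + gk le2 (K \<union> Y) w t" (is ?A)
    and "gk le2 (X \<union> K \<union> Y) w (t + 1) + gk le2 K w (t - 1)
      \<le> gk le2 (X \<union> K) w t + gk le2 (K \<union> Y) w t" (is ?B)
proof -
  define V where "V = X \<union> K \<union> Y"
  have disj: "X \<inter> K = {}" "X \<inter> Y = {}" "K \<inter> Y = {}" using X Y K r by fastforce+
  have finV: "finite V" unfolding V_def using fin by auto
  have rV: "r0 \<le> fst x" "fst x \<le> r1" if "x \<in> V" for x
    using that X[of x] Y[of x] K[of x] r unfolding V_def by auto
  define c0 where "c0 = Min (insert 0 (snd ` V)) - 1"
  have c0: "c0 < snd x" if "x \<in> V" for x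
  proof -
    have "Min (insert 0 (snd ` V)) \<le> snd x" using that finV by (intro Min_le) blast+
    then show ?thesis unfolding c0_def by simp
  qed
  \<comment> \<open>Saturation needs \<open>t\<close> rows for the auxiliary antidiagonal. With
    fewer rows, every row is a chain of its own and both terms on the right are total
    weights.\<close>
  consider "r1 - r0 \<le> int t" | "r0 + int t \<le> r1 - 1" by linarith
  then have "?A \<and> ?B"
  proof cases
    case 1
    have "chain_cov le2 t (X \<union> K)"
      by (rule chain_cov_rows[where rk = "\<lambda>x. nat (fst x - r0)"])
        (use X K r 1 in \<open>fastforce simp: le2_def\<close>)+
    then have S: "gk le2 (X \<union> K) w t = sum w X + sum w K"
      using fin disj by (simp add: gk_total sum.union_disjoint)
    have "chain_cov le2 t (K \<union> Y)"
      by (rule chain_cov_rows[where rk = "\<lambda>x. nat (fst x - r0 - 1)"])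
        (use Y K r 1 in \<open>fastforce simp: le2_def\<close>)+
    then have T: "gk le2 (K \<union> Y) w t = sum w K + sum w Y"
      using fin disj by (simp add: gk_total sum.union_disjoint)
    have "sum w V = sum w X + sum w K + sum w Y"
      using fin disj unfolding V_def by (simp add: sum.union_disjoint Int_Un_distrib2)
    then have le: "gk le2 V w t' \<le> sum w X + sum w K + sum w Y" "gk le2 K w t' \<le> sum w K" for t'
      using gk_le_sum[OF finV, of le2 w t'] gk_le_sum[OF fin(2), of le2 w t'] by simp_all
    show ?thesis unfolding S T V_def[symmetric]
      using le[of t] le(1)[of "t + 1"] le(2)[of "t - 1"] by linarith
  next
    case 2
    have ?A
    proof -
      obtain N where N: "N \<subseteq> V" "chain_cov le2 t N" "gk le2 V w t = sum w N" using gk_obtain[OF finV] .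
      obtain M where M: "M \<subseteq> K" "chain_cov le2 t M" "gk le2 K w t = sum w M" using gk_obtain[OF fin(2)] .
      obtain H where H: "hvalid t H" "\<And>x. x \<in> N \<Longrightarrow> dH H x = 1"
        by (rule height_exists_plain[OF finite_subset[OF N(1) finV] N(2)]) blast
      have Mr: "r0 < fst x \<and> fst x \<le> r1 - 1" "c0 < snd x" if "x \<in> M" for x
        using K[of x] M(1) c0[of x] that unfolding V_def by auto
      obtain G where G: "hvalid t G" "\<And>x. x \<in> M \<Longrightarrow> dH G x = 1"
        "\<And>c. c0 \<le> c \<Longrightarrow> G (r0 + 1, c) = int t" "\<And>r c. r1 - 1 < r \<Longrightarrow> G (r, c) = 0"
        by (rule height_exists[OF finite_subset[OF M(1) fin(2)] M(2) Mr 2]) blast+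
      \<comment> \<open>Near the top row \<open>G\<close> is at least \<open>t\<close> and so
        dominates \<open>H\<close>; from the row \<open>r1\<close> on it vanishes. Hence the minimum
        equals \<open>H\<close> at the top and the maximum equals \<open>H\<close> at the
        bottom.\<close>
      define A where "A x = min (H x) (G x + 0)" for x
      define B where "B x = max (H x - 0) (G x)" for x
      have A: "hvalid t A" unfolding A_def by (rule hvalid_min[OF H(1) G(1)]) auto
      have B: "hvalid t B" unfolding B_def by (rule hvalid_max[OF H(1) G(1)]) auto
      have AX: "dH A x = dH H x" if "x \<in> X" for x
      proof -
        have x: "fst x = r0" "c0 < snd x" using X c0 that unfolding V_def by auto
        have "int t \<le> G (r0, snd x)"
          using G(3)[of "snd x"] x hvalid_mono[OF G(1), of r0 "r0 + 1" "snd x" "snd x"] by simp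
        moreover have "G (r0 + 1, snd x - 1) = int t" using G(3)[of "snd x - 1"] x by simp
        moreover have "H (r0, snd x) \<le> int t" "H (r0 + 1, snd x - 1) \<le> int t"
          using hvalid_D[OF H(1)] by blast+
        ultimately show ?thesis using x(1) unfolding dH_def A_def by (cases x) auto
      qed
      have BY: "dH B x = dH H x" if "x \<in> Y" for x
      proof -
        have "0 \<le> H (r1, snd x)" "0 \<le> H (r1 + 1, snd x - 1)" using hvalid_D[OF H(1)] by blast+
        then show ?thesis using Y[OF that] G(4) unfolding dH_def B_def by (cases x) auto
      qed
      show ?A unfolding V_def[symmetric] N(3) M(3)
        by (rule combine_heights[OF fin disj H(1) G(1) A B _ H(2) M(1) G(2) AX BY])
          (use N(1) in \<open>auto simp: V_def A_def B_def\<close>)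
    qed
    moreover have ?B
    proof -
      obtain N where N: "N \<subseteq> V" "chain_cov le2 (t + 1) N" "gk le2 V w (t + 1) = sum w N"
        using gk_obtain[OF finV] .
      obtain M where M: "M \<subseteq> K" "chain_cov le2 (t - 1) M" "gk le2 K w (t - 1) = sum w M"
        using gk_obtain[OF fin(2)] .
      obtain G where G: "hvalid (t - 1) G" "\<And>x. x \<in> M \<Longrightarrow> dH G x = 1"
        by (rule height_exists_plain[OF finite_subset[OF M(1) fin(2)] M(2)]) blast
      have Nr: "r0 - 1 < fst x \<and> fst x \<le> r1" "c0 < snd x" if "x \<in> N" for x
        using rV[of x] N(1) c0[of x] that by auto
      \<comment> \<open>Starting the saturation one row higher gives \<open>H\<close> the value
        \<open>t + 1\<close> on the row \<open>r0\<close> and at least \<open>t\<close> on the next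
        one. So \<open>H - 1\<close> dominates \<open>G\<close> at the top, while
        \<open>H \<le> 1 \<le> G + 1\<close> at the bottom.\<close>
      have "r0 - 1 + int (t + 1) \<le> r1" using 2 by simp
      obtain H where H: "hvalid (t + 1) H" "\<And>x. x \<in> N \<Longrightarrow> dH H x = 1"
        "\<And>c. c0 \<le> c \<Longrightarrow> H (r0 - 1 + 1, c) = int (t + 1)"
        "\<And>c. c0 \<le> c \<Longrightarrow> H (r0 - 1 + 2, c) \<ge> int (t + 1) - 1"
        "\<And>c. H (r1, c) \<le> 1" "\<And>r c. r1 < r \<Longrightarrow> H (r, c) = 0"
        by (rule height_exists[OF finite_subset[OF N(1) finV] N(2) Nr \<open>r0 - 1 + int (t + 1) \<le> r1\<close>])
          blast+
      define A where "A x = max (H x - 1) (G x)" for x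
      define B where "B x = min (H x) (G x + 1)" for x
      have A: "hvalid t A" unfolding A_def by (rule hvalid_max[OF H(1) G(1)]) (use t in auto)
      have B: "hvalid t B" unfolding B_def by (rule hvalid_min[OF H(1) G(1)]) (use t in auto)
      have Gt: "0 \<le> G (r, c) \<and> G (r, c) \<le> int t - 1" for r c
        using hvalid_D[OF G(1), of r c] t by auto
      have AX: "dH A x = dH H x" if "x \<in> X" for x
      proof -
        have x: "fst x = r0" "c0 < snd x" using X c0 that unfolding V_def by auto
        have "H (r0, snd x) = int t + 1" "H (r0 + 1, snd x - 1) \<ge> int t"
          using H(3)[of "snd x"] H(4)[of "snd x - 1"] x by (auto simp: algebra_simps)
        then show ?thesis using x(1) Gt[of r0 "snd x"] Gt[of "r0 + 1" "snd x - 1"]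
          unfolding dH_def A_def by (cases x) auto
      qed
      have BY: "dH B x = dH H x" if "x \<in> Y" for x
        using Y[OF that] H(5)[of "snd x"] H(6)[of "r1 + 1" "snd x - 1"]
          Gt[of r1 "snd x"] Gt[of "r1 + 1" "snd x - 1"] unfolding dH_def B_def by (cases x) auto
      show ?B unfolding V_def[symmetric] N(3) M(3)
        by (rule combine_heights[OF fin disj H(1) G(1) A B _ H(2) M(1) G(2) AX BY])
          (use N(1) in \<open>auto simp: V_def A_def B_def\<close>)
    qed
    ultimately show ?thesis by blast
  qed
  then show ?A ?B by blast+
qed

theorem row_toggle:
  assumes "finite X" "finite K" "finite Y"
    and "\<And>x. x \<in> X \<Longrightarrow> fst x = r0" and "\<And>x. x \<in> Y \<Longrightarrow> fst x = r1"
    and "\<And>x. x \<in> K \<Longrightarrow> r0 < fst x \<and> fst x < r1" and "r0 < r1" and "1 \<le> t"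
  shows "gk le2 (X \<union> K) w t + gk le2 (K \<union> Y) w t =
    max (gk le2 (X \<union> K \<union> Y) w t + gk le2 K w t)
        (gk le2 (X \<union> K \<union> Y) w (t + 1) + gk le2 K w (t - 1))"
  using row_toggle_le[OF assms(1-7), of w t] row_toggle_ge[OF assms, of w] by simp

text \<open>In terms of parts: the \<open>t\<close>-th part does not decrease when a bottom row is
  added. It is one half of interlacing; the other half is \<open>row_toggle_ge\<close> with empty
  \<open>X\<close>. The maximum has the increments of \<open>H\<close> on the bottom row because
  \<open>G\<close> vanishes there and below.\<close>

lemma bottom_row_concave:
  assumes fin: "finite K" "finite Y"
    and Y: "\<And>x. x \<in> Y \<Longrightarrow> fst x = r1" and K: "\<And>x. x \<in> K \<Longrightarrow> fst x < r1" and t: "1 \<le> t"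
  shows "gk le2 K w t + gk le2 (K \<union> Y) w (t - 1) \<le> gk le2 K w (t - 1) + gk le2 (K \<union> Y) w t"
proof -
  have disj: "K \<inter> Y = {}" using Y K by fastforce
  obtain N where N: "N \<subseteq> K \<union> Y" "chain_cov le2 (t - 1) N" "gk le2 (K \<union> Y) w (t - 1) = sum w N"
    using gk_obtain[of "K \<union> Y"] fin by blast
  obtain M where M: "M \<subseteq> K" "chain_cov le2 t M" "gk le2 K w t = sum w M" using gk_obtain[OF fin(1)] .
  obtain H where H: "hvalid (t - 1) H" "\<And>x. x \<in> N \<Longrightarrow> dH H x = 1"
    by (rule height_exists_plain[OF finite_subset[OF N(1)] N(2)]) (use fin in blast)+
  obtain G where G: "hvalid t G" "\<And>x. x \<in> M \<Longrightarrow> dH G x = 1"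
      "\<And>r c. (\<And>x. x \<in> M \<Longrightarrow> fst x < r) \<Longrightarrow> G (r, c) = 0"
    by (rule height_exists_plain[OF finite_subset[OF M(1) fin(1)] M(2)]) blast
  define A where "A x = min (H x) (G x + 0)" for x
  define B where "B x = max (H x - 0) (G x)" for x
  have A: "hvalid (t - 1) A" unfolding A_def by (rule hvalid_min[OF H(1) G(1)]) auto
  have B: "hvalid t B" unfolding B_def by (rule hvalid_max[OF H(1) G(1)]) auto
  let ?S = "\<lambda>V H. \<Sum>x\<in>V. int (w x) * dH H x"
  have d: "dH H x + dH G x = dH A x + dH B x" for x unfolding dH_def A_def B_def by simp
  have BY: "dH B x = dH H x" if "x \<in> Y" for x
  proof -
    have "G (r, c) = 0" if "r1 \<le> r" for r c
    proof (rule G(3))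
      show "fst x < r" if "x \<in> M" for x using K[of x] that M(1) \<open>r1 \<le> r\<close> by auto
    qed
    then have "G (r1, c) = 0" "G (r1 + 1, c) = 0" for c by simp_all
    moreover have "0 \<le> H (r1, snd x)" "0 \<le> H (r1 + 1, snd x - 1)" using hvalid_D[OF H(1)] by blast+
    ultimately show ?thesis using Y[OF that] unfolding dH_def B_def by (cases x) auto
  qed
  have "int (sum w N) + int (sum w M) \<le> ?S (K \<union> Y) H + ?S K G"
    using hvalid_weight_ge[OF _ H(1) N(1) H(2), of w] hvalid_weight_ge[OF _ G(1) M(1) G(2), of w] fin
    by (intro add_mono) auto
  also have "?S (K \<union> Y) H = ?S K H + ?S Y B"
    using fin disj BY by (simp add: sum.union_disjoint)
  also have "?S K H + ?S Y B + ?S K G = ?S K A + (?S K B + ?S Y B)"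
    using d by (simp add: sum.distrib[symmetric] distrib_left[symmetric])
  also have "\<dots> = ?S K A + ?S (K \<union> Y) B"
    using fin disj by (simp add: sum.union_disjoint)
  also have "\<dots> \<le> int (gk le2 K w (t - 1)) + int (gk le2 (K \<union> Y) w t)"
    using fin by (intro add_mono hvalid_weight A B) auto
  finally show ?thesis using N M by linarith
qed

text \<open>The heavy point is incomparable to all of \<open>Q\<close>, so a chain through it can
  use only the column \<open>Z\<close>, which is itself a chain. One chain is thus spent on the
  heavy point and \<open>Z\<close>, and \<open>t - 1\<close> remain for \<open>Q\<close>; a union
  without the heavy point is no better because of its weight.\<close>

lemma top_corner_weight:
  assumes fin: "finite Q" "finite Z" and cQ: "\<And>x. x \<in> Q \<Longrightarrow> r0 < fst x \<and> snd x < c1"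
    and cZ: "\<And>x. x \<in> Z \<Longrightarrow> r0 < fst x \<and> snd x = c1" and t: "1 \<le> t"
    and big: "sum w Q + sum w Z \<le> w (r0, c1)"
  shows "gk le2 (insert (r0, c1) (Q \<union> Z)) w t = w (r0, c1) + sum w Z + gk le2 Q w (t - 1)"
proof (rule antisym)
  define p where "p = (r0, c1)"
  have pQ: "p \<notin> Q" "p \<notin> Z" "Q \<inter> Z = {}"
    using cQ[of p] cZ[of p] by (auto simp: p_def dest: cQ cZ)
  have finp: "finite (insert p (Q \<union> Z))" using fin by simp
  obtain U where U: "U \<subseteq> insert p (Q \<union> Z)" "chain_cov le2 t U" "gk le2 (insert p (Q \<union> Z)) w t = sum w U"
    using gk_obtain[OF finp] .
  have "sum w U \<le> w p + sum w Z + gk le2 Q w (t - 1)"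
  proof (cases "p \<in> U")
    case False
    then have "sum w U \<le> sum w (Q \<union> Z)" using U fin by (intro sum_mono2) auto
    also have "\<dots> = sum w Q + sum w Z" using fin pQ by (simp add: sum.union_disjoint)
    finally show ?thesis using big unfolding p_def by linarith
  next
    case True
    obtain f :: "_ \<Rightarrow> nat" where
      f: "\<And>x. x \<in> U \<Longrightarrow> f x < t" "\<And>x y. x \<in> U \<Longrightarrow> y \<in> U \<Longrightarrow> f x = f y \<Longrightarrow> le2 x y \<or> le2 y x"
      using U(2) unfolding chain_cov_def by blast
    have ne: "f x \<noteq> f p" if "x \<in> U \<inter> Q" for x
      using f(2)[of x p] that True cQ[of x] unfolding le2_def p_def by auto
    \<comment> \<open>The colour \<open>f p\<close> does not occur on \<open>U \<inter> Q\<close>;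
      renaming the colour \<open>t - 1\<close> to it leaves only colours below
      \<open>t - 1\<close>.\<close>
    have "chain_cov le2 (t - 1) (U \<inter> Q)"
      unfolding chain_cov_def
    proof (intro exI[of _ "\<lambda>x. if f x = t - 1 then f p else f x"] ballI conjI impI)
      fix x assume x: "x \<in> U \<inter> Q"
      then show "(if f x = t - 1 then f p else f x) < t - 1"
        using f(1)[of x] f(1)[OF True] ne[OF x] t by auto
      fix y assume y: "y \<in> U \<inter> Q"
        and "(if f x = t - 1 then f p else f x) = (if f y = t - 1 then f p else f y)"
      then have "f x = f y" using ne[OF x] ne[OF y] by (metis (full_types))
      then show "le2 x y \<or> le2 y x" using f(2) x y by blast
    qed
    then have "sum w (U \<inter> Q) \<le> gk le2 Q w (t - 1)" using gk_ge[OF fin(1)] by blast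
    moreover have "sum w (U \<inter> Z) \<le> sum w Z" using fin by (intro sum_mono2) auto
    moreover have "U = insert p (U \<inter> Q \<union> U \<inter> Z)" using U True by auto
    then have "sum w U = w p + (sum w (U \<inter> Q) + sum w (U \<inter> Z))"
      using fin pQ by (subst \<open>U = _\<close>, subst sum.insert) (auto intro!: sum.union_disjoint)
    ultimately show ?thesis by linarith
  qed
  then show "gk le2 (insert (r0, c1) (Q \<union> Z)) w t \<le> w (r0, c1) + sum w Z + gk le2 Q w (t - 1)"
    using U unfolding p_def by simp
  obtain M where M: "M \<subseteq> Q" "chain_cov le2 (t - 1) M" "gk le2 Q w (t - 1) = sum w M"
    using gk_obtain[OF fin(1)] .
  obtain f :: "_ \<Rightarrow> nat" where
    f: "\<And>x. x \<in> M \<Longrightarrow> f x < t - 1" "\<And>x y. x \<in> M \<Longrightarrow> y \<in> M \<Longrightarrow> f x = f y \<Longrightarrow> le2 x y \<or> le2 y x"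
    using M(2) unfolding chain_cov_def by blast
  have "chain_cov le2 t (insert p Z \<union> M)"
  proof (rule chain_cov_rows[where rk = "\<lambda>x. if x \<in> M then f x else t - 1"])
    fix x y assume "x \<in> insert p Z \<union> M" "y \<in> insert p Z \<union> M"
      "(if x \<in> M then f x else t - 1) = (if y \<in> M then f y else t - 1)"
    then have "x \<in> M \<and> y \<in> M \<and> f x = f y \<or> snd x = c1 \<and> snd y = c1"
      using f(1)[of x] f(1)[of y] cZ[of x] cZ[of y] unfolding p_def by (auto split: if_splits)
    then show "le2 x y \<or> le2 y x" using f(2)[of x y] unfolding le2_def by auto
  next
    fix x show "(if x \<in> M then f x else t - 1) < t" using f(1)[of x] t by auto
  qed
  then have "sum w (insert p Z \<union> M) \<le> gk le2 (insert p (Q \<union> Z)) w t"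
    using M(1) by (intro gk_ge[OF finp]) auto
  moreover have "sum w (insert p Z \<union> M) = w p + sum w Z + sum w M"
    using pQ M(1) fin finite_subset[OF M(1) fin(1)] by (subst sum.union_disjoint) auto
  ultimately show "w (r0, c1) + sum w Z + gk le2 Q w (t - 1) \<le> gk le2 (insert (r0, c1) (Q \<union> Z)) w t"
    using M unfolding p_def by simp
qed

text \<open>A huge weight on an auxiliary point above the last column forces one chain to run along that
  column; the toggle relation then becomes the corner relation.\<close>

theorem corner_rule:
  assumes fin: "finite P" "finite Z" "finite Y"
    and P: "\<And>x. x \<in> P \<Longrightarrow> fst x < r1 \<and> snd x < c1"
    and Z: "\<And>x. x \<in> Z \<Longrightarrow> fst x < r1 \<and> snd x = c1"
    and Y: "\<And>x. x \<in> Y \<Longrightarrow> fst x = r1 \<and> snd x < c1" and t: "1 \<le> t"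
  shows "gk le2 (insert (r1, c1) (P \<union> Z \<union> Y)) w t + gk le2 P w (t - 1) =
    w (r1, c1) + max (gk le2 (P \<union> Z) w t + gk le2 (P \<union> Y) w (t - 1))
                     (gk le2 (P \<union> Z) w (t - 1) + gk le2 (P \<union> Y) w t)"
proof -
  define r0 where "r0 = Min (insert r1 (fst ` (P \<union> Z))) - 1"
  have r0: "r0 < fst x" if "x \<in> P \<union> Z" for x
  proof -
    have "Min (insert r1 (fst ` (P \<union> Z))) \<le> fst x" using that fin by (intro Min_le) blast+
    then show ?thesis unfolding r0_def by simp
  qed
  have r01: "r0 < r1"
  proof -
    have "Min (insert r1 (fst ` (P \<union> Z))) \<le> r1" using fin by (intro Min_le) blast+
    then show ?thesis unfolding r0_def by simp
  qed
  define q where "q = (r0, c1)"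
  define p where "p = (r1, c1)"
  \<comment> \<open>The total weight of all other points, just enough for the hypothesis of
    \<open>top_corner_weight\<close> in its largest instance.\<close>
  define big where "big = sum w P + sum w Z + sum w Y + w p"
  define w' where "w' = w(q := big)"
  have q: "q \<notin> P" "q \<notin> Z" "q \<notin> Y" "q \<noteq> p" using r0[of q] r01 Y[of q] unfolding q_def p_def by auto
  have w': "w' x = w x" if "x \<noteq> q" for x using that unfolding w'_def by simp
  have w'V: "w' x = w x" if "x \<in> V" "q \<notin> V" for x V using that by (intro w') auto
  have w'q: "w' q = big" unfolding w'_def by simp
  have gk': "gk le2 V w' s = gk le2 V w s" if "q \<notin> V" for V s
    using w'V that by (intro gk_cong_le) simp_all
  have sum': "sum w' V = sum w V" if "q \<notin> V" for V
    using w'V that by simp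
  have pZ: "p \<notin> Z" "p \<notin> P" "p \<notin> Y" "P \<inter> Y = {}"
    using Z[of p] P[of p] Y[of p] by (auto simp: p_def dest: P Y)
  let ?K = "P \<union> Z"
  \<comment> \<open>The top row consists of \<open>q\<close> alone. The facts \<open>1\<close> and
    \<open>2\<close> evaluate the three terms containing \<open>q\<close>, and their common summand
    \<open>big + sum w Z\<close> cancels.\<close>
  have toggle: "gk le2 ({q} \<union> ?K) w' t + gk le2 (?K \<union> insert p Y) w' t =
    max (gk le2 ({q} \<union> ?K \<union> insert p Y) w' t + gk le2 ?K w' t)
        (gk le2 ({q} \<union> ?K \<union> insert p Y) w' (t + 1) + gk le2 ?K w' (t - 1))"
    by (rule row_toggle[of _ _ _ r0 r1]) (use fin P Z Y r0 r01 t in \<open>auto simp: q_def p_def\<close>)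
  have 1: "gk le2 ({q} \<union> ?K) w' t = big + sum w Z + gk le2 P w (t - 1)"
  proof -
    have "gk le2 (insert (r0, c1) (P \<union> Z)) w' t = w' (r0, c1) + sum w' Z + gk le2 P w' (t - 1)"
      using fin P Z r0 t q sum'[of P] sum'[of Z] w'q
      by (intro top_corner_weight) (auto simp: q_def[symmetric] big_def)
    then show ?thesis using w'q q sum'[of Z] gk'[of P] by (simp add: q_def)
  qed
  have 2: "gk le2 ({q} \<union> ?K \<union> insert p Y) w' s = big + (sum w Z + w p) + gk le2 (P \<union> Y) w (s - 1)"
    if s: "1 \<le> s" for s
  proof -
    have "gk le2 (insert (r0, c1) (P \<union> Y \<union> insert p Z)) w' s
      = w' (r0, c1) + sum w' (insert p Z) + gk le2 (P \<union> Y) w' (s - 1)"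
    proof (rule top_corner_weight[OF _ _ _ _ s])
      have "sum w' (P \<union> Y) + sum w' (insert p Z) = big"
        using sum'[of "P \<union> Y"] sum'[of "insert p Z"] q fin pZ
        unfolding big_def by (simp add: sum.union_disjoint)
      then show "sum w' (P \<union> Y) + sum w' (insert p Z) \<le> w' (r0, c1)" using w'q by (simp add: q_def)
      show "r0 < fst x \<and> snd x < c1" if "x \<in> P \<union> Y" for x
        using that P[of x] Y[of x] r0[of x] r01 by auto
      show "r0 < fst x \<and> snd x = c1" if "x \<in> insert p Z" for x
        using that Z[of x] r0[of x] r01 by (auto simp: p_def)
    qed (use fin in simp_all)
    moreover have "{q} \<union> ?K \<union> insert p Y = insert (r0, c1) (P \<union> Y \<union> insert p Z)" by (auto simp: q_def)
    ultimately show ?thesis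
      using w'q q sum'[of "insert p Z"] gk'[of "P \<union> Y"] fin pZ by (simp add: q_def add.commute)
  qed
  have "insert (r1, c1) (P \<union> Z \<union> Y) = ?K \<union> insert p Y" unfolding p_def by auto
  moreover have "gk le2 ?K w' s = gk le2 ?K w s" "gk le2 (?K \<union> insert p Y) w' s = gk le2 (?K \<union> insert p Y) w s" for s
    using gk' q by auto
  ultimately show ?thesis using toggle 1 2[OF t] 2[of "t + 1"] t
    unfolding p_def[symmetric] by (simp add: max_def split: if_splits)
qed

section \<open>Shapes of signed labels\<close>

text \<open>With \<open>u x\<close> meaning \<open>x < c x\<close>, the Coxeter element runs through \<open>{1..k}\<close> by first descending
  through the labels without \<open>u\<close> and then ascending through those with \<open>u\<close>, and through \<open>{k + 1..m}\<close>
  the other way around. The following coordinates turn these orders into the order of integers.\<close>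

definition rho :: "(nat \<Rightarrow> bool) \<Rightarrow> nat \<Rightarrow> int" where
  "rho u l = (if u l then int l else - int l)"

definition kappa :: "nat \<Rightarrow> (nat \<Rightarrow> bool) \<Rightarrow> nat \<Rightarrow> int" where
  "kappa m u r = (if u r then int r - int m - 1 else int m + 1 - int r)"

definition pos :: "nat \<Rightarrow> (nat \<Rightarrow> bool) \<Rightarrow> nat \<times> nat \<Rightarrow> int \<times> int" where
  "pos m u = (\<lambda>(l, r). (rho u l, kappa m u r))"

definition pos_inv :: "nat \<Rightarrow> int \<times> int \<Rightarrow> nat \<times> nat" where
  "pos_inv m = (\<lambda>(a, b). (nat \<bar>a\<bar>, nat (int m + 1 - \<bar>b\<bar>)))"

definition lab_le :: "nat \<Rightarrow> (nat \<Rightarrow> bool) \<Rightarrow> nat \<times> nat \<Rightarrow> nat \<times> nat \<Rightarrow> bool" where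
  "lab_le m u x y \<longleftrightarrow> le2 (pos m u x) (pos m u y)"

definition rect :: "nat \<Rightarrow> nat \<Rightarrow> (nat \<times> nat) set" where
  "rect m k = {1..k} \<times> {k + 1..m}"

definition shape :: "nat \<Rightarrow> (nat \<Rightarrow> bool) \<Rightarrow> (nat \<times> nat \<Rightarrow> nat) \<Rightarrow> nat \<Rightarrow> nat \<Rightarrow> nat" where
  "shape m u F k i = gk (lab_le m u) (rect m k) F (Suc i) - gk (lab_le m u) (rect m k) F i"

definition boxes :: "nat \<Rightarrow> (nat \<Rightarrow> bool) \<Rightarrow> (nat \<times> nat) set" where
  "boxes m L = {(l, r). 1 \<le> l \<and> l < r \<and> r \<le> m \<and> L l \<and> \<not> L r}"

definition fill :: "nat \<Rightarrow> (nat \<Rightarrow> bool) \<Rightarrow> (nat \<times> nat \<Rightarrow> nat) set" where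
  "fill m L = {F. \<forall>x. x \<notin> boxes m L \<longrightarrow> F x = 0}"

text \<open>The chain \<open>b 0 \<ge> a 0 \<ge> b 1 \<ge> a 1 \<ge> \<dots>\<close>: the skew shape
  \<open>b / a\<close> is a horizontal strip.\<close>

definition interlace :: "(nat \<Rightarrow> nat) \<Rightarrow> (nat \<Rightarrow> nat) \<Rightarrow> bool" where
  "interlace a b \<longleftrightarrow> (\<forall>i. a i \<le> b i \<and> b (Suc i) \<le> a i)"

text \<open>\<open>s k\<close> belongs to the boundary point between the labels \<open>k\<close> and
  \<open>k + 1\<close>, with parts numbered from 0. The values beyond \<open>m\<close> are fixed so
  that equality of functions is equality of sequences.\<close>

definition interlacing_seqs :: "nat \<Rightarrow> (nat \<Rightarrow> bool) \<Rightarrow> (nat \<Rightarrow> nat \<Rightarrow> nat) set" where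
  "interlacing_seqs m L = {s. (\<forall>i. s 0 i = 0) \<and> (\<forall>k\<ge>m. \<forall>i. s k i = 0) \<and>
     (\<forall>k\<in>{1..m}. if L k then interlace (s (k - 1)) (s k) else interlace (s k) (s (k - 1)))}"

lemma finite_rect [simp]: "finite (rect m k)"
  unfolding rect_def by simp

lemma finite_boxes [simp]: "finite (boxes m L)"
  by (rule finite_subset[of _ "{1..m} \<times> {1..m}"]) (auto simp: boxes_def)

lemma pos_inv: "snd x \<le> m \<Longrightarrow> pos_inv m (pos m u x) = x"
  by (cases x) (auto simp: pos_inv_def pos_def rho_def kappa_def)

lemma gk_lab_le:
  assumes "A \<subseteq> {x. snd x \<le> m}"
  shows "gk (lab_le m u) A F t = gk le2 (pos m u ` A) (F \<circ> pos_inv m) t"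
  by (rule gk_transport[symmetric])
    (use assms in \<open>auto simp: lab_le_def pos_inv subset_iff intro!: inj_on_inverseI[where g = "pos_inv m"]\<close>)

text \<open>Interchanging the coordinates turns columns into rows, so that the row relations also
  serve for columns.\<close>

lemma gk_lab_le_swap:
  assumes "A \<subseteq> {x. snd x \<le> m}"
  shows "gk (lab_le m u) A F t
    = gk le2 ((prod.swap \<circ> pos m u) ` A) (F \<circ> pos_inv m \<circ> prod.swap) t"
  by (rule gk_transport[symmetric])
    (use assms in \<open>auto simp: lab_le_def pos_inv le2_def subset_iff
      intro!: inj_on_inverseI[where g = "pos_inv m \<circ> prod.swap"]\<close>)

lemma gk_negate: "gk (lab_le m (\<lambda>x. \<not> u x)) A F t = gk (lab_le m u) A F t"
proof -
  have "rho (\<lambda>x. \<not> u x) l = - rho u l" "kappa m (\<lambda>x. \<not> u x) r = - kappa m u r" for l r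
    by (simp_all add: rho_def kappa_def)
  then show ?thesis by (intro gk_cong_le) (auto simp: lab_le_def le2_def pos_def)
qed

text \<open>The row \<open>k\<close> has coordinate \<open>k\<close> or \<open>-k\<close>, outside
  the range of all smaller labels. After a reversal of all signs, if necessary, it is the bottom
  row.\<close>

lemma row_interlace:
  fixes m :: nat and u :: "nat \<Rightarrow> bool"
  assumes "1 \<le> k" "C \<subseteq> {..m}" "t \<ge> 1"
  defines "g \<equiv> gk (lab_le m u)"
  shows "g ({1..k - 1} \<times> C) F t + g ({1..k} \<times> C) F (t - 1)
      \<le> g ({1..k - 1} \<times> C) F (t - 1) + g ({1..k} \<times> C) F t"
    and "g ({1..k} \<times> C) F (t + 1) + g ({1..k - 1} \<times> C) F (t - 1)
      \<le> g ({1..k - 1} \<times> C) F t + g ({1..k} \<times> C) F t"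
proof -
  define A where "A = {1..k - 1} \<times> C"
  define Y where "Y = {k} \<times> C"
  have fin: "finite A" "finite Y" using assms(2) finite_subset unfolding A_def Y_def by auto
  have *: "{1..k} \<times> C = A \<union> Y" using assms(1) unfolding A_def Y_def by auto
  have sub: "A \<subseteq> {x. snd x \<le> m}" "A \<union> Y \<subseteq> {x. snd x \<le> m}"
    using assms(2) unfolding A_def Y_def by auto
  have main: "gk (lab_le m v) A F t + gk (lab_le m v) (A \<union> Y) F (t - 1)
      \<le> gk (lab_le m v) A F (t - 1) + gk (lab_le m v) (A \<union> Y) F t \<and>
    gk (lab_le m v) (A \<union> Y) F (t + 1) + gk (lab_le m v) A F (t - 1)
      \<le> gk (lab_le m v) A F t + gk (lab_le m v) (A \<union> Y) F t" if v: "v k" for v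
  proof -
    have Yr: "fst x = int k" if "x \<in> pos m v ` Y" for x
      using that v unfolding Y_def by (auto simp: pos_def rho_def)
    have Ar: "- int k < fst x \<and> fst x < int k" if "x \<in> pos m v ` A" for x
      using that unfolding A_def by (auto simp: pos_def rho_def)
    have k: "- int k < int k" using assms(1) by simp
    have fin': "finite (pos m v ` A)" "finite (pos m v ` Y)" using fin by auto
    show ?thesis unfolding gk_lab_le[OF sub(1)] gk_lab_le[OF sub(2)] image_Un
      using bottom_row_concave[OF fin' Yr, of t "F \<circ> pos_inv m"] Ar assms(3)
        row_toggle_ge(2)[of "{}", OF _ fin' _ Yr Ar k assms(3), of "F \<circ> pos_inv m"] by simp
  qed
  have "u k \<or> (\<not> u k)" by blast
  then show "g ({1..k - 1} \<times> C) F t + g ({1..k} \<times> C) F (t - 1)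
      \<le> g ({1..k - 1} \<times> C) F (t - 1) + g ({1..k} \<times> C) F t"
    "g ({1..k} \<times> C) F (t + 1) + g ({1..k - 1} \<times> C) F (t - 1)
      \<le> g ({1..k - 1} \<times> C) F t + g ({1..k} \<times> C) F t"
    using main[of u] main[of "\<lambda>x. \<not> u x"] unfolding * g_def gk_negate A_def by auto
qed

lemma col_interlace:
  fixes m :: nat and u :: "nat \<Rightarrow> bool"
  assumes "1 \<le> k" "k \<le> m" "finite R" "t \<ge> 1"
  defines "g \<equiv> gk (lab_le m u)"
  shows "g (R \<times> {k + 1..m}) F t + g (R \<times> {k..m}) F (t - 1)
      \<le> g (R \<times> {k + 1..m}) F (t - 1) + g (R \<times> {k..m}) F t"
    and "g (R \<times> {k..m}) F (t + 1) + g (R \<times> {k + 1..m}) F (t - 1)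
      \<le> g (R \<times> {k + 1..m}) F t + g (R \<times> {k..m}) F t"
proof -
  define A where "A = R \<times> {k + 1..m}"
  define Y where "Y = R \<times> {k}"
  have fin: "finite A" "finite Y" using assms(3) unfolding A_def Y_def by auto
  have *: "R \<times> {k..m} = A \<union> Y" using assms(2) unfolding A_def Y_def by auto
  have sub: "A \<subseteq> {x. snd x \<le> m}" "A \<union> Y \<subseteq> {x. snd x \<le> m}"
    using assms(2) unfolding A_def Y_def by auto
  have main: "gk (lab_le m v) A F t + gk (lab_le m v) (A \<union> Y) F (t - 1)
      \<le> gk (lab_le m v) A F (t - 1) + gk (lab_le m v) (A \<union> Y) F t \<and>
    gk (lab_le m v) (A \<union> Y) F (t + 1) + gk (lab_le m v) A F (t - 1)
      \<le> gk (lab_le m v) A F t + gk (lab_le m v) (A \<union> Y) F t" if v: "\<not> v k" for v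
  proof -
    let ?f = "prod.swap \<circ> pos m v"
    define c where "c = int m + 1 - int k"
    have Yr: "fst x = c" if "x \<in> ?f ` Y" for x
      using that v unfolding Y_def c_def by (auto simp: pos_def kappa_def)
    have Ar: "- c < fst x \<and> fst x < c" if "x \<in> ?f ` A" for x
      using that unfolding A_def c_def by (auto simp: pos_def kappa_def)
    have k: "- c < c" using assms(2) unfolding c_def by simp
    have fin': "finite (?f ` A)" "finite (?f ` Y)" using fin by auto
    show ?thesis unfolding gk_lab_le_swap[OF sub(1)] gk_lab_le_swap[OF sub(2)] image_Un
      using bottom_row_concave[OF fin' Yr, of t "F \<circ> pos_inv m \<circ> prod.swap"] Ar assms(4)
        row_toggle_ge(2)[of "{}", OF _ fin' _ Yr Ar k assms(4), of "F \<circ> pos_inv m \<circ> prod.swap"]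
      by simp
  qed
  show "g (R \<times> {k + 1..m}) F t + g (R \<times> {k..m}) F (t - 1)
      \<le> g (R \<times> {k + 1..m}) F (t - 1) + g (R \<times> {k..m}) F t"
    "g (R \<times> {k..m}) F (t + 1) + g (R \<times> {k + 1..m}) F (t - 1)
      \<le> g (R \<times> {k + 1..m}) F t + g (R \<times> {k..m}) F t"
    using main[of u] main[of "\<lambda>x. \<not> u x"] unfolding * g_def gk_negate A_def by auto
qed

lemma gk_fill:
  assumes "F \<in> fill m L" "finite A" "B \<subseteq> A" "\<And>l r. (l, r) \<in> A \<Longrightarrow> (l, r) \<in> boxes m L \<Longrightarrow> (l, r) \<in> B"
  shows "gk le A F t = gk le B F t"
proof (rule gk_support[OF assms(2,3)])
  fix x assume "x \<in> A - B"
  then have "x \<notin> boxes m L" using assms(4)[of "fst x" "snd x"] by auto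
  then show "F x = 0" using assms(1) unfolding fill_def by blast
qed

lemma interlaceI:
  assumes "\<And>t. t \<ge> 1 \<Longrightarrow> A t + B (t - 1) \<le> A (t - 1) + B t"
    and "\<And>t. t \<ge> 1 \<Longrightarrow> B (t + 1) + A (t - 1) \<le> A t + B t"
    and "mono A" "mono B"
  shows "interlace (\<lambda>i. A (Suc i) - A i) (\<lambda>i. B (Suc i) - B i :: nat)"
  unfolding interlace_def
proof (intro allI conjI)
  fix i
  have m: "A i \<le> A (Suc i)" "B i \<le> B (Suc i)" "B (Suc i) \<le> B (Suc (Suc i))"
    using assms(3,4) by (auto simp: mono_iff_le_Suc)
  show "A (Suc i) - A i \<le> B (Suc i) - B i" using assms(1)[of "Suc i"] m by simp
  show "B (Suc (Suc i)) - B (Suc i) \<le> A (Suc i) - A i" using assms(2)[of "Suc i"] m by simp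
qed

lemma mono_gk: "finite V \<Longrightarrow> mono (gk le V w)"
  by (intro monoI gk_mono) auto

text \<open>If \<open>k\<close> is a row label, the filling vanishes on column \<open>k\<close>, so
  the step from \<open>k - 1\<close> to \<open>k\<close> amounts to adding the row \<open>k\<close>.
  If \<open>k\<close> is a column label, the filling vanishes on row \<open>k\<close>, and the step
  amounts to deleting the column \<open>k\<close>.\<close>

lemma shape_interlacing:
  assumes F: "F \<in> fill m L"
  shows "shape m u F \<in> interlacing_seqs m L"
proof -
  let ?g = "\<lambda>V. gk (lab_le m u) V F"
  have "rect m 0 = {}" unfolding rect_def by simp
  moreover have "rect m k = {}" if "k \<ge> m" for k using that unfolding rect_def by simp
  moreover have "gk (lab_le m u) {} F t = 0" for t
    using gk_le_sum[of "{}" "lab_le m u" F t] by simp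
  moreover have "if L k then interlace (shape m u F (k - 1)) (shape m u F k)
      else interlace (shape m u F k) (shape m u F (k - 1))" if k: "1 \<le> k" "k \<le> m" for k
  proof (cases "L k")
    case True
    have 1: "?g (rect m (k - 1)) t = ?g ({1..k - 1} \<times> {k + 1..m}) t" for t
    proof (rule gk_fill[OF F])
      fix l r assume "(l, r) \<in> rect m (k - 1)" "(l, r) \<in> boxes m L"
      moreover from this have "r \<noteq> k" using True unfolding boxes_def by auto
      ultimately show "(l, r) \<in> {1..k - 1} \<times> {k + 1..m}" using k unfolding rect_def by auto
    qed (use k in \<open>auto simp: rect_def\<close>)
    have 2: "rect m k = {1..k} \<times> {k + 1..m}" unfolding rect_def ..
    have "interlace (shape m u F (k - 1)) (shape m u F k)"
      unfolding shape_def 1 2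
      by (rule interlaceI[OF row_interlace mono_gk mono_gk]) (use k in auto)
    then show ?thesis using True by simp
  next
    case False
    have 1: "?g (rect m k) t = ?g ({1..k - 1} \<times> {k + 1..m}) t" for t
    proof (rule gk_fill[OF F])
      fix l r assume "(l, r) \<in> rect m k" "(l, r) \<in> boxes m L"
      moreover from this have "l \<noteq> k" using False unfolding boxes_def by auto
      ultimately show "(l, r) \<in> {1..k - 1} \<times> {k + 1..m}" using k unfolding rect_def by auto
    qed (use k in \<open>auto simp: rect_def\<close>)
    have 2: "rect m (k - 1) = {1..k - 1} \<times> {k..m}" using k unfolding rect_def by simp
    have "interlace (shape m u F k) (shape m u F (k - 1))"
      unfolding shape_def 1 2
      by (rule interlaceI[OF col_interlace mono_gk mono_gk]) (use k in auto)
    then show ?thesis using False by simp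
  qed
  moreover have "shape m u F 0 i = 0" "k \<ge> m \<Longrightarrow> shape m u F k i = 0" for k i
    unfolding shape_def using calculation(1,2,3) by simp_all
  ultimately show ?thesis unfolding interlacing_seqs_def by (auto simp del: One_nat_def split: if_splits)
qed

section \<open>Exchanging adjacent labels of opposite sign\<close>

abbreviation swap_lab :: "nat \<Rightarrow> nat \<times> nat \<Rightarrow> nat \<times> nat" where
  "swap_lab j \<equiv> map_prod (transpose j (Suc j)) (transpose j (Suc j))"

lemma swap_lab_swap_lab [simp]: "swap_lab j (swap_lab j x) = x"
  by (cases x) simp

text \<open>The exchange replaces the coordinates \<open>j, -(j + 1)\<close> by
  \<open>j + 1, -j\<close>, or conversely. No other label has a coordinate of absolute value
  \<open>j\<close> or \<open>j + 1\<close>, so no order relation changes.\<close>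

lemma rho_swap:
  assumes "u j \<noteq> u (Suc j)" "1 \<le> j" "1 \<le> a" "1 \<le> b"
  shows "rho (u \<circ> transpose j (Suc j)) (transpose j (Suc j) a)
      \<le> rho (u \<circ> transpose j (Suc j)) (transpose j (Suc j) b) \<longleftrightarrow> rho u a \<le> rho u b"
  using assms unfolding rho_def by (auto simp: transpose_def split: if_splits)

lemma kappa_swap:
  assumes "u j \<noteq> u (Suc j)" "1 \<le> j" "Suc j \<le> m" "a \<le> m" "b \<le> m"
  shows "kappa m (u \<circ> transpose j (Suc j)) (transpose j (Suc j) a)
      \<le> kappa m (u \<circ> transpose j (Suc j)) (transpose j (Suc j) b) \<longleftrightarrow> kappa m u a \<le> kappa m u b"
  using assms unfolding kappa_def by (auto simp: transpose_def split: if_splits)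

lemma gk_swap:
  assumes u: "u j \<noteq> u (Suc j)" "1 \<le> j" "Suc j \<le> m" and A: "A \<subseteq> {1..} \<times> {..m}"
  shows "gk (lab_le m (u \<circ> transpose j (Suc j))) (swap_lab j ` A) (F \<circ> swap_lab j) t
    = gk (lab_le m u) A F t"
proof (rule gk_transport)
  show "inj_on (swap_lab j) A" by (rule inj_on_inverseI[where g = "swap_lab j"]) simp
  fix x y assume "x \<in> A" "y \<in> A"
  then have "1 \<le> fst x" "snd x \<le> m" "1 \<le> fst y" "snd y \<le> m" using A by auto
  then show "(lab_le m (u \<circ> transpose j (Suc j)) (swap_lab j x) (swap_lab j y)
      \<or> lab_le m (u \<circ> transpose j (Suc j)) (swap_lab j y) (swap_lab j x))
    \<longleftrightarrow> (lab_le m u x y \<or> lab_le m u y x)"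
    using u unfolding lab_le_def le2_def pos_def
    by (cases x; cases y) (simp only: map_prod_simp prod.case fst_conv snd_conv rho_swap kappa_swap)
qed simp

text \<open>Only the rectangle for \<open>k = j\<close> separates the labels \<open>j\<close> and
  \<open>j + 1\<close>; every other one is mapped to itself.\<close>

lemma shape_swap:
  assumes u: "u j \<noteq> u (Suc j)" "1 \<le> j" "Suc j \<le> m" and "k \<noteq> j"
  shows "shape m (u \<circ> transpose j (Suc j)) (F \<circ> swap_lab j) k = shape m u F k"
proof -
  have "swap_lab j x \<in> rect m k" if "x \<in> rect m k" for x
    using that assms(2-4) unfolding rect_def by (cases x) (auto simp: transpose_def)
  then have "swap_lab j ` rect m k = rect m k"
    using image_eqI[of _ "swap_lab j" "swap_lab j _" "rect m k"] by fastforce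
  then show ?thesis
    using gk_swap[OF u, of "rect m k" F] unfolding shape_def by (fastforce simp: rect_def)
qed

section \<open>The bijection onto interlacing sequences\<close>

text \<open>The piecewise linear form of the Bender--Knuth involution: each part of \<open>s\<close>
  is reflected in the interval left to it by \<open>a\<close> (inside \<open>s\<close>) and
  \<open>b\<close> (around \<open>s\<close>). At \<open>i = 0\<close> only \<open>b 0\<close> bounds
  it from above.\<close>

definition toggle :: "(nat \<Rightarrow> nat) \<Rightarrow> (nat \<Rightarrow> nat) \<Rightarrow> (nat \<Rightarrow> nat) \<Rightarrow> nat \<Rightarrow> nat" where
  "toggle a b s i = (if i = 0 then b 0 + max (a 0) (b 1) - s 0
     else min (a (i - 1)) (b i) + max (a i) (b (Suc i)) - s i)"

text \<open>Fomin's local rule in piecewise linear form: \<open>s\<close> is the shape inside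
  \<open>a\<close> and \<open>b\<close>, and the entry \<open>x\<close> of the corner box enters the
  first part only.\<close>

definition corner :: "(nat \<Rightarrow> nat) \<Rightarrow> (nat \<Rightarrow> nat) \<Rightarrow> (nat \<Rightarrow> nat) \<Rightarrow> nat \<Rightarrow> nat \<Rightarrow> nat" where
  "corner a b s x i = (if i = 0 then max (a 0) (b 0) + x
     else max (a i) (b i) + min (a (i - 1)) (b (i - 1)) - s (i - 1))"

definition uncorner :: "(nat \<Rightarrow> nat) \<Rightarrow> (nat \<Rightarrow> nat) \<Rightarrow> (nat \<Rightarrow> nat) \<Rightarrow> nat \<Rightarrow> nat" where
  "uncorner a b s i = max (a (Suc i)) (b (Suc i)) + min (a i) (b i) - s (Suc i)"

text \<open>Factoring out \<open>N t + K (t - 1)\<close>, the maximum becomes one of a part of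
  \<open>K\<close> and a part of \<open>N\<close>. The difference of the relations for
  \<open>t + 1\<close> and \<open>t\<close> then has the form \<open>min + max\<close>, since a sum
  minus the maximum is the minimum.\<close>

lemma toggle_parts:
  fixes S T N K :: "nat \<Rightarrow> nat"
  assumes eq: "\<And>t. 1 \<le> t \<Longrightarrow> S t + T t = max (N t + K t) (N (t + 1) + K (t - 1))"
    and mono: "mono S" "mono T" "mono N" "mono K" and zero: "S 0 = 0" "T 0 = 0" "N 0 = 0" "K 0 = 0"
  shows "T (Suc i) - T i = toggle (\<lambda>i. K (Suc i) - K i) (\<lambda>i. N (Suc i) - N i) (\<lambda>i. S (Suc i) - S i) i"
proof (cases i)
  case 0
  have "N 1 \<le> N 2" using mono(3) by (simp add: mono_def)
  then show ?thesis using eq[of 1] zero 0 by (auto simp: toggle_def numeral_2_eq_2 max_def split: if_splits)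
next
  case (Suc t)
  have m: "S (Suc t) \<le> S (Suc (Suc t))" "T (Suc t) \<le> T (Suc (Suc t))"
    "N (Suc t) \<le> N (Suc (Suc t))" "N (Suc (Suc t)) \<le> N (Suc (Suc (Suc t)))"
    "K t \<le> K (Suc t)" "K (Suc t) \<le> K (Suc (Suc t))"
    using mono by (simp_all add: mono_iff_le_Suc)
  \<comment> \<open>Increments in place of truncated differences make every case of the maxima and
    minima linear.\<close>
  obtain a a' b b' where "N (Suc (Suc t)) = N (Suc t) + a" "N (Suc (Suc (Suc t))) = N (Suc t) + a + a'"
    "K (Suc t) = K t + b" "K (Suc (Suc t)) = K t + b + b'" using m le_Suc_ex by metis
  then show ?thesis using eq[of "Suc t"] eq[of "Suc (Suc t)"] m(1,2)
    unfolding toggle_def Suc by (auto simp: max_def min_def split: if_splits)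
qed

lemma corner_parts:
  fixes N U A B :: "nat \<Rightarrow> nat"
  assumes eq: "\<And>t. 1 \<le> t \<Longrightarrow> N t + U (t - 1) = x + max (A t + B (t - 1)) (A (t - 1) + B t)"
    and mono: "mono N" "mono U" "mono A" "mono B" and zero: "N 0 = 0" "U 0 = 0" "A 0 = 0" "B 0 = 0"
  shows "N (Suc i) - N i = corner (\<lambda>i. A (Suc i) - A i) (\<lambda>i. B (Suc i) - B i) (\<lambda>i. U (Suc i) - U i) x i"
proof (cases i)
  case 0
  then show ?thesis using eq[of 1] zero by (simp add: corner_def)
next
  case (Suc t)
  have m: "N (Suc t) \<le> N (Suc (Suc t))" "U t \<le> U (Suc t)"
    "A (Suc t) \<le> A (Suc (Suc t))" "A t \<le> A (Suc t)"
    "B t \<le> B (Suc t)" "B (Suc t) \<le> B (Suc (Suc t))"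
    using mono by (simp_all add: mono_iff_le_Suc)
  obtain a a' b b' where "A (Suc t) = A t + a" "A (Suc (Suc t)) = A t + a + a'"
    "B (Suc t) = B t + b" "B (Suc (Suc t)) = B t + b + b'" using m le_Suc_ex by metis
  then show ?thesis using eq[of "Suc t"] eq[of "Suc (Suc t)"] m(1,2)
    unfolding corner_def Suc by (auto simp: max_def min_def split: if_splits)
qed

lemma interlace_toggle:
  assumes "interlace a s" "interlace s b"
  shows "interlace a (toggle a b s)" "interlace (toggle a b s) b" "toggle a b (toggle a b s) = s"
proof -
  have s: "a i \<le> s i" "s (Suc i) \<le> a i" "s i \<le> b i" "b (Suc i) \<le> s i" for i
    using assms unfolding interlace_def by auto
  have t: "max (a i) (b (Suc i)) \<le> toggle a b s i \<and> toggle a b s i \<le> b i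
      \<and> (i \<noteq> 0 \<longrightarrow> toggle a b s i \<le> a (i - 1)) \<and> toggle a b (toggle a b s) i = s i" for i
    using s[of i] s[of "i - 1"] unfolding toggle_def by (cases i) auto
  show "toggle a b (toggle a b s) = s" using t by blast
  show "interlace a (toggle a b s)" "interlace (toggle a b s) b"
    unfolding interlace_def using t t[of "Suc _"] by auto
qed

lemma interlace_corner:
  assumes "interlace s a" "interlace s b"
  shows "interlace a (corner a b s x)" "interlace b (corner a b s x)"
    "uncorner a b (corner a b s x) = s"
proof -
  have s: "s i \<le> a i" "s i \<le> b i" "a (Suc i) \<le> s i" "b (Suc i) \<le> s i" for i
    using assms unfolding interlace_def by auto
  have t: "max (a i) (b i) \<le> corner a b s x i" for i
    using s[of "i - 1"] unfolding corner_def by (cases i) auto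
  have t': "corner a b s x (Suc i) \<le> min (a i) (b i)" for i
    using s[of i] unfolding corner_def by auto
  show "interlace a (corner a b s x)" "interlace b (corner a b s x)"
    unfolding interlace_def using t t' by auto
  show "uncorner a b (corner a b s x) = s"
  proof
    fix i show "uncorner a b (corner a b s x) i = s i"
      using s[of i] unfolding uncorner_def corner_def by auto
  qed
qed

lemma interlace_uncorner:
  assumes "interlace a s" "interlace b s"
  shows "interlace (uncorner a b s) a" "interlace (uncorner a b s) b"
    "corner a b (uncorner a b s) (s 0 - max (a 0) (b 0)) = s"
proof -
  have s: "a i \<le> s i" "b i \<le> s i" "s (Suc i) \<le> a i" "s (Suc i) \<le> b i" for i
    using assms unfolding interlace_def by auto
  have t: "uncorner a b s i \<le> min (a i) (b i)" "max (a (Suc i)) (b (Suc i)) \<le> uncorner a b s i" for i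
    using s[of i] s[of "Suc i"] unfolding uncorner_def by auto
  show "interlace (uncorner a b s) a" "interlace (uncorner a b s) b"
    unfolding interlace_def using t by auto
  show "corner a b (uncorner a b s) (s 0 - max (a 0) (b 0)) = s"
  proof
    fix i show "corner a b (uncorner a b s) (s 0 - max (a 0) (b 0)) i = s i"
      using s[of i] s[of "i - 1"] unfolding uncorner_def corner_def by (cases i) auto
  qed
qed

lemma fill_zero: "F \<in> fill m L \<Longrightarrow> x \<notin> boxes m L \<Longrightarrow> F x = 0"
  unfolding fill_def by blast

lemma fillI: "(\<And>x. x \<notin> boxes m L \<Longrightarrow> F x = 0) \<Longrightarrow> F \<in> fill m L"
  unfolding fill_def by blast

text \<open>Among the rows \<open>1..j + 1\<close>, opposite signs give \<open>j\<close> and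
  \<open>j + 1\<close> the coordinates \<open>j\<close> and \<open>-(j + 1)\<close>, or their
  negatives: they are the two extreme rows, and the rows below \<open>j\<close> lie between
  them.\<close>

lemma lab_row_toggle:
  assumes u: "u j \<noteq> u (Suc j)" and j: "1 \<le> j" and C: "C \<subseteq> {..m}" and t: "1 \<le> t"
  defines "g \<equiv> gk (lab_le m u)"
  shows "g ({1..j} \<times> C) F t + g (insert (Suc j) {1..j - 1} \<times> C) F t =
    max (g ({1..Suc j} \<times> C) F t + g ({1..j - 1} \<times> C) F t)
        (g ({1..Suc j} \<times> C) F (t + 1) + g ({1..j - 1} \<times> C) F (t - 1))"
proof -
  define K where "K = {1..j - 1} \<times> C"
  define X where "X = {Suc j} \<times> C"
  define Y where "Y = {j} \<times> C"
  have fin: "finite X" "finite K" "finite Y"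
    using C finite_subset unfolding K_def X_def Y_def by auto
  have eqs: "{1..j} \<times> C = K \<union> Y" "insert (Suc j) {1..j - 1} \<times> C = X \<union> K"
    "{1..Suc j} \<times> C = X \<union> K \<union> Y"
    using j unfolding K_def X_def Y_def by (auto simp: le_Suc_eq)
  have sub: "X \<union> K \<union> Y \<subseteq> {x. snd x \<le> m}" "X \<union> K \<subseteq> {x. snd x \<le> m}" "K \<union> Y \<subseteq> {x. snd x \<le> m}"
    "K \<subseteq> {x. snd x \<le> m}"
    using C unfolding X_def K_def Y_def by auto
  have main: "gk (lab_le m v) (K \<union> Y) F t + gk (lab_le m v) (X \<union> K) F t =
    max (gk (lab_le m v) (X \<union> K \<union> Y) F t + gk (lab_le m v) K F t)
        (gk (lab_le m v) (X \<union> K \<union> Y) F (t + 1) + gk (lab_le m v) K F (t - 1))"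
    if v: "v j" "\<not> v (Suc j)" for v
  proof -
    have Xr: "fst x = - int (Suc j)" if "x \<in> pos m v ` X" for x
      using that v unfolding X_def by (auto simp: pos_def rho_def)
    have Yr: "fst x = int j" if "x \<in> pos m v ` Y" for x
      using that v unfolding Y_def by (auto simp: pos_def rho_def)
    have Kr: "- int (Suc j) < fst x \<and> fst x < int j" if "x \<in> pos m v ` K" for x
      using that unfolding K_def by (auto simp: pos_def rho_def)
    have fin': "finite (pos m v ` X)" "finite (pos m v ` K)" "finite (pos m v ` Y)" using fin by auto
    show ?thesis unfolding sub[THEN gk_lab_le] image_Un
      using row_toggle[OF fin' Xr Yr Kr _ t, where w = "F \<circ> pos_inv m"] by simp
  qed
  consider "u j" "\<not> u (Suc j)" | "\<not> u j" "\<not> \<not> u (Suc j)" using u by blast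
  then show ?thesis
  proof cases
    case 1
    then show ?thesis using main[of u] unfolding eqs g_def K_def[symmetric] by simp
  next
    case 2
    then show ?thesis using main[of "\<lambda>x. \<not> u x"] unfolding eqs g_def gk_negate K_def[symmetric] by simp
  qed
qed

text \<open>In \<open>rect m j\<close> the row \<open>j\<close> and the column \<open>j + 1\<close>
  have the coordinates of largest absolute value. Opposite signs make them, up to reversal, the
  bottom row and the rightmost column, which meet in the corner.\<close>

lemma lab_corner_rule:
  assumes u: "u j \<noteq> u (Suc j)" and j: "1 \<le> j" "Suc j \<le> m" and t: "1 \<le> t"
  defines "g \<equiv> gk (lab_le m u)"
  shows "g (rect m j) F t + g ({1..j - 1} \<times> {j + 2..m}) F (t - 1) = F (j, Suc j) +
    max (g ({1..j - 1} \<times> {Suc j..m}) F t + g ({1..j} \<times> {j + 2..m}) F (t - 1))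
        (g ({1..j - 1} \<times> {Suc j..m}) F (t - 1) + g ({1..j} \<times> {j + 2..m}) F t)"
proof -
  define P where "P = {1..j - 1} \<times> {j + 2..m}"
  define Z where "Z = {1..j - 1} \<times> {Suc j}"
  define Y where "Y = {j} \<times> {j + 2..m}"
  have fin: "finite P" "finite Z" "finite Y" unfolding P_def Z_def Y_def by auto
  have eqs: "rect m j = insert (j, Suc j) (P \<union> Z \<union> Y)" "{1..j - 1} \<times> {Suc j..m} = P \<union> Z"
    "{1..j} \<times> {j + 2..m} = P \<union> Y"
    using j unfolding P_def Z_def Y_def rect_def by auto
  have sub: "insert (j, Suc j) (P \<union> Z \<union> Y) \<subseteq> {x. snd x \<le> m}" "P \<union> Z \<subseteq> {x. snd x \<le> m}"
    "P \<union> Y \<subseteq> {x. snd x \<le> m}" "P \<subseteq> {x. snd x \<le> m}"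
    using j unfolding P_def Z_def Y_def by auto
  have main: "gk (lab_le m v) (insert (j, Suc j) (P \<union> Z \<union> Y)) F t + gk (lab_le m v) P F (t - 1) =
    F (j, Suc j) + max (gk (lab_le m v) (P \<union> Z) F t + gk (lab_le m v) (P \<union> Y) F (t - 1))
        (gk (lab_le m v) (P \<union> Z) F (t - 1) + gk (lab_le m v) (P \<union> Y) F t)"
    if v: "v j" "\<not> v (Suc j)" for v
  proof -
    define c where "c = int m - int j"
    have Pr: "fst x < int j \<and> snd x < c" if "x \<in> pos m v ` P" for x
      using that j unfolding P_def c_def by (auto simp: pos_def rho_def kappa_def)
    have Zr: "fst x < int j \<and> snd x = c" if "x \<in> pos m v ` Z" for x
      using that j v unfolding Z_def c_def by (auto simp: pos_def rho_def kappa_def)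
    have Yr: "fst x = int j \<and> snd x < c" if "x \<in> pos m v ` Y" for x
      using that j v unfolding Y_def c_def by (auto simp: pos_def rho_def kappa_def)
    have p: "pos m v (j, Suc j) = (int j, c)" using v unfolding c_def by (simp add: pos_def rho_def kappa_def)
    have "pos_inv m (int j, c) = (j, Suc j)" using pos_inv[of "(j, Suc j)" m v] j p by simp
    then show ?thesis unfolding sub[THEN gk_lab_le] image_Un image_insert p
      using corner_rule[OF fin[THEN finite_imageI] Pr Zr Yr t, where w = "F \<circ> pos_inv m"] by simp
  qed
  consider "u j" "\<not> u (Suc j)" | "\<not> u j" "\<not> \<not> u (Suc j)" using u by blast
  then show ?thesis
  proof cases
    case 1
    then show ?thesis using main[of u] unfolding eqs g_def P_def[symmetric] by simp
  next
    case 2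
    then show ?thesis using main[of "\<lambda>x. \<not> u x"] unfolding eqs g_def gk_negate P_def[symmetric] by simp
  qed
qed

lemma swap_lab_rect:
  assumes "1 \<le> j" "Suc j \<le> m"
  shows "swap_lab j ` rect m j = insert (Suc j) {1..j - 1} \<times> insert j {j + 2..m}"
proof -
  have "transpose j (Suc j) ` {1..j} = insert (Suc j) {1..j - 1}"
  proof -
    have "{1..j} = insert j {1..j - 1}" using assms by auto
    moreover have "transpose j (Suc j) ` {1..j - 1} = id ` {1..j - 1}"
      by (intro image_cong) (auto simp: transpose_def)
    ultimately show ?thesis by simp
  qed
  moreover have "transpose j (Suc j) ` {j + 1..m} = insert j {j + 2..m}"
  proof -
    have "{j + 1..m} = insert (Suc j) {j + 2..m}" using assms by auto
    moreover have "transpose j (Suc j) ` {j + 2..m} = id ` {j + 2..m}"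
      by (intro image_cong) (auto simp: transpose_def)
    ultimately show ?thesis by simp
  qed
  ultimately show ?thesis unfolding rect_def by (simp add: map_prod_surj_on)
qed

lemma gk_swap_rect:
  assumes u: "u j \<noteq> u (Suc j)" "1 \<le> j" "Suc j \<le> m"
  shows "gk (lab_le m (u \<circ> transpose j (Suc j))) (rect m j) (F \<circ> swap_lab j) t
    = gk (lab_le m u) (insert (Suc j) {1..j - 1} \<times> insert j {j + 2..m}) F t"
proof -
  have sub: "swap_lab j ` rect m j \<subseteq> {1..} \<times> {..m}" using assms unfolding swap_lab_rect[OF u(2,3)] by auto
  have "swap_lab j ` swap_lab j ` rect m j = rect m j" unfolding image_image by simp
  then show ?thesis using gk_swap[OF u sub, of F t] unfolding swap_lab_rect[OF u(2,3)] by simp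
qed

text \<open>As \<open>j\<close> and \<open>j + 1\<close> are row labels, no box has a column
  \<open>j\<close> or \<open>j + 1\<close>. In the old labels the exchanged rectangle therefore has
  the rows \<open>1..j - 1\<close> and \<open>j + 1\<close> over the common columns, which is the
  second term of \<open>lab_row_toggle\<close>.\<close>

lemma shape_toggle:
  assumes F: "F \<in> fill m L" and L: "L j" "L (Suc j)" and u: "u j \<noteq> u (Suc j)" "1 \<le> j" "Suc j \<le> m"
  shows "shape m (u \<circ> transpose j (Suc j)) (F \<circ> swap_lab j) j
    = toggle (shape m u F (j - 1)) (shape m u F (Suc j)) (shape m u F j)"
proof -
  let ?g = "\<lambda>V. gk (lab_le m u) V F"
  define C where "C = {j + 2..m}"
  have C: "C \<subseteq> {..m}" unfolding C_def by auto
  have r: "r \<noteq> j \<and> r \<noteq> Suc j" if "(l, r) \<in> boxes m L" for l r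
    using that L unfolding boxes_def by auto
  have K: "?g (rect m (j - 1)) t = ?g ({1..j - 1} \<times> C) t" for t
  proof (rule gk_fill[OF F])
    fix l r assume "(l, r) \<in> rect m (j - 1)" "(l, r) \<in> boxes m L"
    then show "(l, r) \<in> {1..j - 1} \<times> C" using r[of l r] unfolding rect_def C_def by auto
  qed (auto simp: rect_def C_def)
  have S: "?g (rect m j) t = ?g ({1..j} \<times> C) t" for t
  proof (rule gk_fill[OF F])
    fix l r assume "(l, r) \<in> rect m j" "(l, r) \<in> boxes m L"
    then show "(l, r) \<in> {1..j} \<times> C" using r[of l r] unfolding rect_def C_def by auto
  qed (auto simp: rect_def C_def)
  have T: "gk (lab_le m (u \<circ> transpose j (Suc j))) (rect m j) (F \<circ> swap_lab j) t
      = ?g (insert (Suc j) {1..j - 1} \<times> C) t" for t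
    unfolding gk_swap_rect[OF u]
  proof (rule gk_fill[OF F])
    fix l r assume "(l, r) \<in> insert (Suc j) {1..j - 1} \<times> insert j {j + 2..m}" "(l, r) \<in> boxes m L"
    then show "(l, r) \<in> insert (Suc j) {1..j - 1} \<times> C" using r[of l r] unfolding C_def by auto
  qed (auto simp: C_def)
  have N: "rect m (Suc j) = {1..Suc j} \<times> C" unfolding rect_def C_def by simp
  have fin: "finite (A \<times> C)" if "finite A" for A :: "nat set" using that unfolding C_def by simp
  have eq: "?g ({1..j} \<times> C) t + ?g (insert (Suc j) {1..j - 1} \<times> C) t =
    max (?g ({1..Suc j} \<times> C) t + ?g ({1..j - 1} \<times> C) t)
        (?g ({1..Suc j} \<times> C) (t + 1) + ?g ({1..j - 1} \<times> C) (t - 1))" if "1 \<le> t" for t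
    by (rule lab_row_toggle[of u j C m t F, OF u(1,2) C that])
  show ?thesis
    unfolding shape_def S T N K
    by (rule ext, rule toggle_parts[where S = "?g ({1..j} \<times> C)" and T = "?g (insert (Suc j) {1..j - 1} \<times> C)"
        and N = "?g ({1..Suc j} \<times> C)" and K = "?g ({1..j - 1} \<times> C)", OF eq]) (auto intro!: mono_gk fin)
qed

text \<open>In the old labels the exchange replaces row \<open>j\<close> by row \<open>j + 1\<close>
  and column \<open>j + 1\<close> by column \<open>j\<close>, and both replacements carry no boxes.
  What remains is the inner rectangle of \<open>lab_corner_rule\<close>.\<close>

lemma shape_corner:
  assumes F: "F \<in> fill m L" and L: "L j" "\<not> L (Suc j)" and u: "u j \<noteq> u (Suc j)" "1 \<le> j" "Suc j \<le> m"
  shows "shape m u F j = corner (shape m u F (j - 1)) (shape m u F (Suc j))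
    (shape m (u \<circ> transpose j (Suc j)) (F \<circ> swap_lab j) j) (F (j, Suc j))"
proof -
  let ?g = "\<lambda>V. gk (lab_le m u) V F"
  have r: "l \<noteq> Suc j \<and> r \<noteq> j" if "(l, r) \<in> boxes m L" for l r
    using that L unfolding boxes_def by auto
  have A: "?g (rect m (j - 1)) t = ?g ({1..j - 1} \<times> {Suc j..m}) t" for t
  proof (rule gk_fill[OF F])
    fix l r assume "(l, r) \<in> rect m (j - 1)" "(l, r) \<in> boxes m L"
    then show "(l, r) \<in> {1..j - 1} \<times> {Suc j..m}" using r[of l r] unfolding rect_def by auto
  qed (auto simp: rect_def)
  have B: "?g (rect m (Suc j)) t = ?g ({1..j} \<times> {j + 2..m}) t" for t
  proof (rule gk_fill[OF F])
    fix l r assume "(l, r) \<in> rect m (Suc j)" "(l, r) \<in> boxes m L"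
    then show "(l, r) \<in> {1..j} \<times> {j + 2..m}" using r[of l r] unfolding rect_def by auto
  qed (auto simp: rect_def)
  have U: "gk (lab_le m (u \<circ> transpose j (Suc j))) (rect m j) (F \<circ> swap_lab j) t
      = ?g ({1..j - 1} \<times> {j + 2..m}) t" for t
    unfolding gk_swap_rect[OF u]
  proof (rule gk_fill[OF F])
    fix l r assume "(l, r) \<in> insert (Suc j) {1..j - 1} \<times> insert j {j + 2..m}" "(l, r) \<in> boxes m L"
    then show "(l, r) \<in> {1..j - 1} \<times> {j + 2..m}" using r[of l r] by auto
  qed auto
  have eq: "?g (rect m j) t + ?g ({1..j - 1} \<times> {j + 2..m}) (t - 1) = F (j, Suc j) +
    max (?g ({1..j - 1} \<times> {Suc j..m}) t + ?g ({1..j} \<times> {j + 2..m}) (t - 1))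
        (?g ({1..j - 1} \<times> {Suc j..m}) (t - 1) + ?g ({1..j} \<times> {j + 2..m}) t)" if "1 \<le> t" for t
    by (rule lab_corner_rule[of u j m t F, OF u that])
  show ?thesis
    unfolding shape_def A B U
    by (rule ext, rule corner_parts[where N = "?g (rect m j)" and U = "?g ({1..j - 1} \<times> {j + 2..m})"
        and A = "?g ({1..j - 1} \<times> {Suc j..m})" and B = "?g ({1..j} \<times> {j + 2..m})", OF eq]) (auto intro!: mono_gk)
qed

lemma seqs_update:
  assumes s: "s \<in> interlacing_seqs m L" and j: "1 \<le> j" "Suc j \<le> m"
    and L': "\<And>k. k \<noteq> j \<Longrightarrow> k \<noteq> Suc j \<Longrightarrow> L' k = L k"
    and a: "if L' j then interlace (s (j - 1)) a else interlace a (s (j - 1))"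
      "if L' (Suc j) then interlace a (s (Suc j)) else interlace (s (Suc j)) a"
  shows "s(j := a) \<in> interlacing_seqs m L'"
proof -
  have "if L' k then interlace ((s(j := a)) (k - 1)) ((s(j := a)) k)
    else interlace ((s(j := a)) k) ((s(j := a)) (k - 1))" if "k \<in> {1..m}" for k
  proof -
    consider "k = j" | "k = Suc j" | "k \<noteq> j" "k \<noteq> Suc j" by blast
    then show ?thesis
    proof cases
      case 3
      then have "k - 1 \<noteq> j" using that by auto
      then show ?thesis using s 3 L'[of k] that unfolding interlacing_seqs_def by (simp del: One_nat_def)
    qed (use a j in auto)
  qed
  moreover have "(s(j := a)) 0 i = 0" for i using s j unfolding interlacing_seqs_def by simp
  moreover have "(s(j := a)) k i = 0" if "m \<le> k" for k i
    using s j that unfolding interlacing_seqs_def by simp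
  ultimately show ?thesis unfolding interlacing_seqs_def by blast
qed

lemma seqsD:
  assumes "s \<in> interlacing_seqs m L" "1 \<le> j" "Suc j \<le> m"
  shows "if L j then interlace (s (j - 1)) (s j) else interlace (s j) (s (j - 1))"
    "if L (Suc j) then interlace (s j) (s (Suc j)) else interlace (s (Suc j)) (s j)"
proof -
  have "if L k then interlace (s (k - 1)) (s k) else interlace (s k) (s (k - 1))" if "k \<in> {1..m}" for k
    using assms(1) that unfolding interlacing_seqs_def by blast
  from this[of j] this[of "Suc j"] show
    "if L j then interlace (s (j - 1)) (s j) else interlace (s j) (s (j - 1))"
    "if L (Suc j) then interlace (s j) (s (Suc j)) else interlace (s (Suc j)) (s j)"
    using assms(2,3) by auto
qed

lemma transpose_less:
  assumes "a < b" "\<not> (a = j \<and> b = Suc j)"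
  shows "transpose j (Suc j) a < transpose j (Suc j) b"
  using assms by (auto simp: transpose_def)

text \<open>The map for \<open>u\<close> is the map for the exchanged signs, preceded by relabelling
  and followed by the toggle at \<open>j\<close>, which is an involution on interlacing
  sequences.\<close>

lemma bij_toggle_step:
  assumes bij: "bij_betw (shape m (u \<circ> transpose j (Suc j))) (fill m L) (interlacing_seqs m L)"
    and L: "L j" "L (Suc j)" and u: "u j \<noteq> u (Suc j)" "1 \<le> j" "Suc j \<le> m"
  shows "bij_betw (shape m u) (fill m L) (interlacing_seqs m L)"
proof -
  define tog where "tog s = s(j := toggle (s (j - 1)) (s (Suc j)) (s j))" for s :: "nat \<Rightarrow> nat \<Rightarrow> nat"
  have box: "swap_lab j x \<in> boxes m L" if "x \<in> boxes m L" for x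
  proof -
    obtain l r where x: "x = (l, r)" by (cases x)
    then have "r \<noteq> j" "r \<noteq> Suc j" using that L unfolding boxes_def by auto
    then show ?thesis using that L u(2) unfolding x boxes_def
      by (auto simp: transpose_def)
  qed
  have "F \<circ> swap_lab j \<in> fill m L" if F: "F \<in> fill m L" for F
  proof -
    have "F (swap_lab j x) = 0" if "x \<notin> boxes m L" for x
      using box[of "swap_lab j x"] that by (intro fill_zero[OF F]) auto
    then show ?thesis by (intro fillI) simp
  qed
  then have 1: "bij_betw (\<lambda>F. F \<circ> swap_lab j) (fill m L) (fill m L)"
    by (intro bij_betw_byWitness[where f' = "\<lambda>F. F \<circ> swap_lab j"]) (auto simp: fun_eq_iff)
  have tog: "tog s \<in> interlacing_seqs m L \<and> tog (tog s) = s" if s: "s \<in> interlacing_seqs m L" for s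
  proof -
    have i: "interlace (s (j - 1)) (s j)" "interlace (s j) (s (Suc j))"
      using seqsD[OF s u(2,3)] L by auto
    have "tog s \<in> interlacing_seqs m L"
      unfolding tog_def by (rule seqs_update[OF s u(2,3)]) (use L interlace_toggle[OF i] in auto)
    moreover have "j - 1 \<noteq> j" using u(2) by simp
    then have "tog (tog s) = s" unfolding tog_def using interlace_toggle(3)[OF i] by simp
    ultimately show ?thesis by blast
  qed
  then have 2: "bij_betw tog (interlacing_seqs m L) (interlacing_seqs m L)"
    by (intro bij_betw_byWitness[where f' = tog]) auto
  have "shape m u F = tog (shape m (u \<circ> transpose j (Suc j)) (F \<circ> swap_lab j))" if F: "F \<in> fill m L" for F
  proof -
    have "shape m (u \<circ> transpose j (Suc j)) (F \<circ> swap_lab j) = tog (shape m u F)"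
      unfolding tog_def
      by (rule ext) (use shape_toggle[OF F L u] shape_swap[OF u] in \<open>simp\<close>)
    then show ?thesis using tog shape_interlacing[OF F] by simp
  qed
  then show ?thesis
    using bij_betw_trans[OF bij_betw_trans[OF 1 bij] 2] by (subst bij_betw_cong) (auto simp: o_def)
qed

text \<open>The exchange deletes one box. On the side of fillings its entry is the missing datum; on
  the side of sequences the same number is the excess
  \<open>s j 0 - max (s (j - 1) 0) (s (Suc j) 0)\<close>.\<close>

lemma bij_corner_step:
  assumes bij: "bij_betw (shape m (u \<circ> transpose j (Suc j))) (fill m (L \<circ> transpose j (Suc j)))
      (interlacing_seqs m (L \<circ> transpose j (Suc j)))"
    and L: "L j" "\<not> L (Suc j)" and u: "u j \<noteq> u (Suc j)" "1 \<le> j" "Suc j \<le> m"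
  shows "bij_betw (shape m u) (fill m L) (interlacing_seqs m L)"
proof -
  define L' where "L' = L \<circ> transpose j (Suc j)"
  define u' where "u' = u \<circ> transpose j (Suc j)"
  \<comment> \<open>Relabelling carries the corner entry to \<open>(Suc j, j)\<close>, which is not
    a box. It is erased there and stored separately; no rectangle contains this point, so the shapes
    are unaffected.\<close>
  define h where "h F = ((F \<circ> swap_lab j)((Suc j, j) := 0), F (j, Suc j))" for F :: "nat \<times> nat \<Rightarrow> nat"
  define h' where "h' = (\<lambda>(G, x). (G \<circ> swap_lab j)((j, Suc j) := x :: nat))"
  have L'j: "\<not> L' j" "L' (Suc j)" using L unfolding L'_def by auto
  have L'k: "L' k = L k" if "k \<noteq> j" "k \<noteq> Suc j" for k
    using that unfolding L'_def by (simp add: transpose_def)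
  have box: "swap_lab j x \<in> boxes m L'" if "x \<in> boxes m L" "x \<noteq> (j, Suc j)" for x
  proof -
    obtain l r where x: "x = (l, r)" by (cases x)
    show ?thesis using that transpose_less[of l r j] u(2,3) unfolding x boxes_def L'_def
      by (auto simp: transpose_def split: if_splits)
  qed
  have box': "swap_lab j x \<in> boxes m L" if "x \<in> boxes m L'" for x
  proof -
    obtain l r where x: "x = (l, r)" by (cases x)
    have "\<not> (l = j \<and> r = Suc j)" using that L'j unfolding x boxes_def by auto
    then show ?thesis using that transpose_less[of l r j] u(2,3) unfolding x boxes_def L'_def
      by (auto simp: transpose_def split: if_splits)
  qed
  have corner_box: "(j, Suc j) \<in> boxes m L" "(Suc j, j) \<notin> boxes m L'"
    using L u unfolding boxes_def by auto
  have sw: "swap_lab j (j, Suc j) = (Suc j, j)" "swap_lab j (Suc j, j) = (j, Suc j)" by auto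
  have h: "h F \<in> fill m L' \<times> UNIV" if F: "F \<in> fill m L" for F
  proof -
    have "((F \<circ> swap_lab j)((Suc j, j) := 0)) x = 0" if "x \<notin> boxes m L'" for x
    proof (cases "x = (Suc j, j)")
      case False
      then have "swap_lab j x \<noteq> (j, Suc j)" using sw swap_lab_swap_lab by metis
      then have "swap_lab j x \<notin> boxes m L" using box[of "swap_lab j x"] that by auto
      then show ?thesis using fill_zero[OF F] False by simp
    qed simp
    then show ?thesis unfolding h_def by (auto intro!: fillI)
  qed
  have h': "h' y \<in> fill m L" if y: "y \<in> fill m L' \<times> UNIV" for y
  proof -
    obtain G x where Gx: "y = (G, x)" by (cases y)
    have "((G \<circ> swap_lab j)((j, Suc j) := x)) z = 0" if "z \<notin> boxes m L" for z
    proof -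
      have "z \<noteq> (j, Suc j)" using that corner_box by auto
      moreover have "swap_lab j z \<notin> boxes m L'" using box'[of "swap_lab j z"] that by auto
      moreover have "G \<in> fill m L'" using y Gx by simp
      ultimately show ?thesis using fill_zero[of G m L' "swap_lab j z"] by simp
    qed
    then show ?thesis unfolding h'_def Gx by (auto intro!: fillI)
  qed
  have 1: "bij_betw h (fill m L) (fill m L' \<times> UNIV)"
  proof (rule bij_betw_byWitness[where f' = h'])
    show "\<forall>F\<in>fill m L. h' (h F) = F"
    proof (intro ballI ext)
      fix F x assume "F \<in> fill m L"
      show "h' (h F) x = F x"
      proof (cases "x = (j, Suc j)")
        case False
        then have "swap_lab j x \<noteq> (Suc j, j)" using sw swap_lab_swap_lab by metis
        then show ?thesis using False unfolding h_def h'_def by simp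
      qed (simp add: h_def h'_def)
    qed
    show "\<forall>y\<in>fill m L' \<times> UNIV. h (h' y) = y"
    proof
      fix y assume y: "y \<in> fill m L' \<times> (UNIV :: nat set)"
      obtain G x where Gx: "y = (G, x)" by (cases y)
      have G0: "G (Suc j, j) = 0" using y corner_box Gx fill_zero[of G m L' "(Suc j, j)"] by simp
      have "(((G \<circ> swap_lab j)((j, Suc j) := x) \<circ> swap_lab j)((Suc j, j) := 0)) z = G z" for z
      proof (cases "z = (Suc j, j)")
        case False
        then have "swap_lab j z \<noteq> (j, Suc j)" using sw swap_lab_swap_lab by metis
        then show ?thesis using False by simp
      qed (simp add: G0)
      then show "h (h' y) = y" unfolding h_def h'_def Gx by auto
    qed
  qed (blast intro: h h')+
  have 2: "bij_betw (map_prod (shape m u') id) (fill m L' \<times> (UNIV :: nat set)) (interlacing_seqs m L' \<times> UNIV)"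
    using bij unfolding u'_def[symmetric] L'_def[symmetric] bij_betw_def
    by (auto intro!: map_prod_inj_on map_prod_surj_on)
  define k where "k = (\<lambda>(s, x). s(j := corner (s (j - 1)) (s (Suc j)) (s j) x))"
  define k' where "k' s = (s(j := uncorner (s (j - 1)) (s (Suc j)) (s j)),
      s j 0 - max (s (j - 1) 0) (s (Suc j) 0))" for s
  have j1: "j - 1 \<noteq> j" using u(2) by simp
  have k: "k y \<in> interlacing_seqs m L \<and> k' (k y) = y" if y: "y \<in> interlacing_seqs m L' \<times> UNIV" for y
  proof -
    obtain s x where sx: "y = (s, x)" by (cases y)
    have s: "s \<in> interlacing_seqs m L'" using y sx by auto
    have i: "interlace (s j) (s (j - 1))" "interlace (s j) (s (Suc j))"
      using seqsD[OF s u(2,3)] L'j by auto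
    have "k y \<in> interlacing_seqs m L"
      unfolding k_def sx prod.case
      by (rule seqs_update[OF s u(2,3)]) (use L L'k interlace_corner[OF i] in auto)
    moreover have "k' (k y) = y" unfolding k_def k'_def sx
      using interlace_corner(3)[OF i, of x] j1 by (simp add: corner_def)
    ultimately show ?thesis by blast
  qed
  have k': "k' s \<in> interlacing_seqs m L' \<times> UNIV \<and> k (k' s) = s" if s: "s \<in> interlacing_seqs m L" for s
  proof -
    have i: "interlace (s (j - 1)) (s j)" "interlace (s (Suc j)) (s j)"
      using seqsD[OF s u(2,3)] L by auto
    have "s(j := uncorner (s (j - 1)) (s (Suc j)) (s j)) \<in> interlacing_seqs m L'"
      by (rule seqs_update[OF s u(2,3)]) (use L'j L'k interlace_uncorner[OF i] in auto)
    moreover have "k (k' s) = s" unfolding k_def k'_def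
      using interlace_uncorner(3)[OF i] j1 by simp
    ultimately show ?thesis unfolding k'_def by simp
  qed
  have 3: "bij_betw k (interlacing_seqs m L' \<times> UNIV) (interlacing_seqs m L)"
    by (rule bij_betw_byWitness[where f' = k']; use k k' in blast)
  have "shape m u F = k (map_prod (shape m u') id (h F))" if F: "F \<in> fill m L" for F
  proof -
    have "shape m u' ((F \<circ> swap_lab j)((Suc j, j) := 0)) = shape m u' (F \<circ> swap_lab j)"
      unfolding shape_def by (intro ext arg_cong2[of _ _ _ _ "(-)"] gk_cong_le) (auto simp: rect_def)
    moreover have "shape m u F = k (shape m u' (F \<circ> swap_lab j), F (j, Suc j))"
      unfolding k_def u'_def prod.case
      by (rule ext) (use shape_corner[OF F L u] shape_swap[OF u] j1 in simp)
    ultimately show ?thesis unfolding h_def by simp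
  qed
  then show ?thesis
    using bij_betw_trans[OF bij_betw_trans[OF 1 2] 3] by (subst bij_betw_cong) (auto simp: o_def)
qed

text \<open>Among the rows with boxes the first row label has the coordinate of smallest absolute
  value, so its sign alters no comparison with the others; being a row label, it is the column of no
  box.\<close>

lemma shape_first_sign:
  assumes F: "F \<in> fill m L" and i: "L i" "\<And>l. 1 \<le> l \<Longrightarrow> l < i \<Longrightarrow> \<not> L l"
  shows "shape m (u(i := b)) F = shape m u F"
proof -
  have "gk (lab_le m (u(i := b))) (rect m k) F t = gk (lab_le m u) (rect m k) F t" for k t
  proof -
    let ?B = "rect m k \<inter> boxes m L"
    have B: "gk le (rect m k) F t = gk le ?B F t" for le by (rule gk_fill[OF F]) auto
    have "gk (lab_le m (u(i := b))) ?B F t = gk (lab_le m u) ?B F t"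
    proof (rule gk_cong_le)
      fix x y assume "x \<in> ?B" "y \<in> ?B"
      moreover obtain l r l' r' where xy: "x = (l, r)" "y = (l', r')" by (metis surj_pair)
      ultimately have l: "i \<le> l" "i \<le> l'" "1 \<le> l" "1 \<le> l'" "r \<noteq> i" "r' \<noteq> i"
        using i unfolding boxes_def by (auto intro: leI)
      have "rho (u(i := b)) l \<le> rho (u(i := b)) l' \<longleftrightarrow> rho u l \<le> rho u l'" if "l \<noteq> l'"
        using l that unfolding rho_def by auto
      moreover have "rho (u(i := b)) l' \<le> rho (u(i := b)) l \<longleftrightarrow> rho u l' \<le> rho u l" if "l \<noteq> l'"
        using l that unfolding rho_def by auto
      ultimately show "(lab_le m (u(i := b)) x y \<or> lab_le m (u(i := b)) y x) \<longleftrightarrow> (lab_le m u x y \<or> lab_le m u y x)"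
        using l unfolding lab_le_def le2_def pos_def xy by (cases "l = l'") (auto simp: kappa_def)
    qed simp
    then show ?thesis using B by metis
  qed
  then show ?thesis unfolding shape_def by simp
qed

text \<open>In an initial run \<open>i, \<dots>, k\<close> of row labels the signs can be changed at will: the sign of the
  first one is irrelevant, and opposite adjacent signs are exchanged by toggles.\<close>

lemma bij_change_sign:
  assumes run: "\<And>l. i \<le> l \<Longrightarrow> l \<le> k \<Longrightarrow> L l" and i: "1 \<le> i" "i \<le> k" "k < m"
    and first: "\<And>l. 1 \<le> l \<Longrightarrow> l < i \<Longrightarrow> \<not> L l"
    and bij: "\<And>u. u k = b \<Longrightarrow> u (Suc k) = c \<Longrightarrow> bij_betw (shape m u) (fill m L) (interlacing_seqs m L)"
    and u: "u (Suc k) = c"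
  shows "bij_betw (shape m u) (fill m L) (interlacing_seqs m L)"
proof -
  have "bij_betw (shape m v) (fill m L) (interlacing_seqs m L)"
    if "j \<le> k" "i \<le> j" "v j = b" "v (Suc k) = c" for j v
    using that
  proof (induction j arbitrary: v rule: inc_induct)
    case base
    then show ?case using bij by simp
  next
    case (step j)
    show ?case
    proof (cases "v (Suc j) = b")
      case True
      then show ?thesis using step by simp
    next
      case False
      \<comment> \<open>The exchange carries the sign \<open>b\<close> from \<open>j\<close> to
        \<open>Suc j\<close>, where the induction hypothesis applies; the sign of
        \<open>Suc k\<close> is not touched since \<open>j < k\<close>.\<close>
      have "bij_betw (shape m (v \<circ> transpose j (Suc j))) (fill m L) (interlacing_seqs m L)"
        using step by (intro step.IH) (auto simp: transpose_def)
      then show ?thesis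
        by (rule bij_toggle_step) (use run[of j] run[of "Suc j"] step False i in auto)
    qed
  qed
  from this[of i "u(i := b)"]
  have "bij_betw (shape m (u(i := b))) (fill m L) (interlacing_seqs m L)" using i u by auto
  then show ?thesis
    using shape_first_sign[of _ m L i u b] run[of i] first i by (subst (asm) bij_betw_cong) auto
qed

theorem shape_bij: "bij_betw (shape m u) (fill m L) (interlacing_seqs m L)"
proof (induction "card (boxes m L)" arbitrary: L u rule: less_induct)
  case less
  show ?case
  proof (cases "boxes m L = {}")
    case True
    \<comment> \<open>Without boxes all column labels precede all row labels, so a sequence first
      decreases from 0 and afterwards increases to 0.\<close>
    have zero: "s k i = 0" if s: "s \<in> interlacing_seqs m L" for s k i
    proof -
      have step: "if L k then interlace (s (k - 1)) (s k) else interlace (s k) (s (k - 1))"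
        if "k \<in> {1..m}" for k
        using s that unfolding interlacing_seqs_def by blast
      have ends: "s 0 i = 0" "\<And>k. k \<ge> m \<Longrightarrow> s k i = 0" using s unfolding interlacing_seqs_def by auto
      show ?thesis
      proof (cases "\<exists>l. 1 \<le> l \<and> l \<le> k \<and> L l")
        case False
        then show ?thesis
        proof (induction k)
          case (Suc k)
          show ?case
          proof (cases "Suc k \<le> m")
            case True
            then have "s (Suc k) i \<le> s k i" using step[of "Suc k"] Suc.prems unfolding interlace_def by auto
            then show ?thesis using Suc by (metis le_SucI le_zero_eq)
          qed (use ends in auto)
        qed (use ends in simp)
      next
        case True
        then have "s k i \<le> s (k + d) i" for d
        proof (induction d)
          case (Suc d)
          obtain l where l: "1 \<le> l" "l \<le> k" "L l" using True by blast
          show ?case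
          proof (cases "k + Suc d \<le> m")
            case True
            have "L (k + Suc d)" using \<open>boxes m L = {}\<close> l True unfolding boxes_def by auto
            then have "s (k + d) i \<le> s (k + Suc d) i"
              using step[of "k + Suc d"] True unfolding interlace_def by auto
            then show ?thesis using Suc by simp
          next
            case False
            then have "k + d \<ge> m" by simp
            then show ?thesis using Suc ends(2)[of "k + d"] by simp
          qed
        qed simp
        from this[of m] show ?thesis using ends(2)[of "k + m"] by simp
      qed
    qed
    have "(\<lambda>_. 0) \<in> fill m L" unfolding fill_def by simp
    then have "shape m u (\<lambda>_. 0) \<in> interlacing_seqs m L" by (rule shape_interlacing)
    then have "interlacing_seqs m L = {\<lambda>_ _. 0}" "shape m u (\<lambda>_. 0) = (\<lambda>_ _. 0)"
      using zero by (auto simp: fun_eq_iff) (metis ext)+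
    moreover have "fill m L = {\<lambda>_. 0}" using True unfolding fill_def by auto
    ultimately show ?thesis by (simp add: bij_betw_def)
  next
    case False
    then obtain l r where lr: "1 \<le> l" "l < r" "r \<le> m" "L l" "\<not> L r" unfolding boxes_def by auto
    \<comment> \<open>\<open>i\<close> is the first row label and \<open>r0\<close> the first column
      label after it. The labels \<open>i..k\<close> form the first run of rows, and
      \<open>(k, Suc k)\<close> is the corner box at its end, to be removed once \<open>k\<close>
      and \<open>Suc k\<close> have opposite signs.\<close>
    define i where "i = (LEAST l. 1 \<le> l \<and> L l)"
    have i: "1 \<le> i" "L i" "i \<le> l" "\<And>l. 1 \<le> l \<Longrightarrow> l < i \<Longrightarrow> \<not> L l"
      using LeastI[of "\<lambda>l. 1 \<le> l \<and> L l" l] Least_le[of "\<lambda>l. 1 \<le> l \<and> L l"] lr not_less_Least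
      unfolding i_def by (blast+)
    define r0 where "r0 = (LEAST r. i < r \<and> \<not> L r)"
    have r0: "i < r0" "\<not> L r0" "r0 \<le> r" "\<And>l. i < l \<Longrightarrow> l < r0 \<Longrightarrow> L l"
      using LeastI[of "\<lambda>r. i < r \<and> \<not> L r" r] Least_le[of "\<lambda>r. i < r \<and> \<not> L r"] lr i(3) not_less_Least
      unfolding r0_def by (fastforce+)
    define k where "k = r0 - 1"
    have k: "r0 = Suc k" "i \<le> k" "k < m" "1 \<le> k" using r0 lr i unfolding k_def by auto
    have run: "L l" if "i \<le> l" "l \<le> k" for l using that r0(4)[of l] i(2) k by (cases "l = i") auto
    define L' where "L' = L \<circ> transpose k (Suc k)"
    have L'k: "\<not> L' k" "L' (Suc k)" "L k" "\<not> L (Suc k)"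
      using run[of k] k r0(2) unfolding L'_def by auto
    have "card (boxes m L') < card (boxes m L)"
    proof -
      have "swap_lab k ` boxes m L' \<subset> boxes m L"
      proof
        show "swap_lab k ` boxes m L' \<subseteq> boxes m L"
        proof
          fix x assume "x \<in> swap_lab k ` boxes m L'"
          then obtain l r where x: "x = swap_lab k (l, r)" "(l, r) \<in> boxes m L'" by auto
          have "\<not> (l = k \<and> r = Suc k)" using x L'k unfolding boxes_def by auto
          then show "x \<in> boxes m L" using x transpose_less[of l r k] k
            unfolding boxes_def L'_def by (auto simp: transpose_def split: if_splits)
        qed
        have "(k, Suc k) \<in> boxes m L" using L'k k unfolding boxes_def by auto
        moreover have "(k, Suc k) \<notin> swap_lab k ` boxes m L'"
        proof
          assume "(k, Suc k) \<in> swap_lab k ` boxes m L'"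
          then obtain y where y: "(k, Suc k) = swap_lab k y" "y \<in> boxes m L'" by (rule imageE)
          then have "y = swap_lab k (k, Suc k)" by (metis swap_lab_swap_lab)
          then show False using y(2) unfolding boxes_def by simp
        qed
        ultimately show "swap_lab k ` boxes m L' \<noteq> boxes m L" by blast
      qed
      then have "card (swap_lab k ` boxes m L') < card (boxes m L)" by (intro psubset_card_mono) auto
      moreover have "inj_on (swap_lab k) (boxes m L')" by (rule inj_on_inverseI[where g = "swap_lab k"]) simp
      ultimately show ?thesis by (simp add: card_image)
    qed
    then have IH: "bij_betw (shape m v) (fill m L') (interlacing_seqs m L')" for v by (rule less)
    show ?thesis
    proof (rule bij_change_sign[where i = i and k = k and b = "\<not> u (Suc k)" and c = "u (Suc k)"])
      show "bij_betw (shape m v) (fill m L) (interlacing_seqs m L)"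
        if "v k = (\<not> u (Suc k))" "v (Suc k) = u (Suc k)" for v
        by (rule bij_corner_step[of m v k]) (use IH L'k that k in \<open>auto simp: L'_def\<close>)
    qed (use run i k in auto)
  qed
qed

section \<open>Coxeter elements and Auslander--Reiten quivers\<close>

text \<open>A local form of the known description of Coxeter elements: a cycle that climbs from 1 to
  \<open>n + 1\<close> through some labels and descends through the others. A step passes over
  labels of the other direction only, and the direction changes only at 1 and
  \<open>n + 1\<close>.\<close>

definition cycle_like :: "nat \<Rightarrow> (nat \<Rightarrow> nat) \<Rightarrow> bool" where
  "cycle_like n c \<longleftrightarrow> (\<forall>x>n + 1. c x = x) \<and> (\<forall>x\<in>{1..n + 1}. 1 \<le> c x \<and> c x \<le> n + 1 \<and> c x \<noteq> x
    \<and> (x < c x \<longrightarrow> (\<forall>z. x < z \<longrightarrow> z < c x \<longrightarrow> c z < z) \<and> (c x = n + 1 \<or> c x < c (c x)))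
    \<and> (c x < x \<longrightarrow> (\<forall>z. c x < z \<longrightarrow> z < x \<longrightarrow> z < c z) \<and> (c x = 1 \<or> c (c x) < c x)))"

definition transp_prod :: "nat list \<Rightarrow> nat \<Rightarrow> nat" where
  "transp_prod as = foldr (\<lambda>a g. simple_transp a \<circ> g) as id"

lemma transp_prod_simps [simp]:
  "transp_prod [] = id" "transp_prod (a # as) = simple_transp a \<circ> transp_prod as"
  by (simp_all add: transp_prod_def)

lemma transp_prod_append: "transp_prod (xs @ ys) = transp_prod xs \<circ> transp_prod ys"
  by (induction xs) (simp_all add: comp_assoc)

lemma simple_transp_commute:
  "Suc a < n \<Longrightarrow> simple_transp n \<circ> simple_transp a = simple_transp a \<circ> simple_transp n"
  by (auto simp: simple_transp_def fun_eq_iff)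

lemma simple_transp_commute_list:
  assumes "\<forall>a\<in>set as. Suc a < n"
  shows "simple_transp n \<circ> transp_prod as = transp_prod as \<circ> simple_transp n"
  using assms
proof (induction as)
  case (Cons a as)
  have "simple_transp n \<circ> transp_prod (a # as) = (simple_transp n \<circ> simple_transp a) \<circ> transp_prod as"
    by (simp only: transp_prod_simps comp_assoc)
  also have "\<dots> = simple_transp a \<circ> (simple_transp n \<circ> transp_prod as)"
    using Cons.prems by (simp only: simple_transp_commute list.set_intros comp_assoc)
  also have "simple_transp n \<circ> transp_prod as = transp_prod as \<circ> simple_transp n"
    by (rule Cons.IH) (use Cons.prems in simp)
  also have "simple_transp a \<circ> (transp_prod as \<circ> simple_transp n) = transp_prod (a # as) \<circ> simple_transp n"
    by (simp only: transp_prod_simps comp_assoc)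
  finally show ?case .
qed simp

text \<open>The last simple transposition commutes with all others except its neighbour
  \<open>n\<close>, so it can be moved to that end of the product which does not pass this
  neighbour.\<close>

lemma coxeter_element_Suc:
  assumes "coxeter_element (Suc n) c"
  obtains c' where "coxeter_element n c'" "c = c' \<circ> simple_transp (Suc n) \<or> c = simple_transp (Suc n) \<circ> c'"
proof -
  obtain as where as: "distinct as" "set as = {1..Suc n}" "c = transp_prod as"
    using assms unfolding coxeter_element_def transp_prod_def by blast
  have "Suc n \<in> set as" unfolding as(2) by simp
  from split_list[OF this] obtain xs ys where xy: "as = xs @ Suc n # ys" by blast
  have d: "distinct (xs @ ys)" "Suc n \<notin> set (xs @ ys)" using as(1) xy by auto
  have "set (xs @ ys) = set as - {Suc n}" using d(2) unfolding xy by auto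
  also have "\<dots> = {1..n}" unfolding as(2) by auto
  finally have d3: "set (xs @ ys) = {1..n}" .
  note d = d d3
  have cox: "coxeter_element n (transp_prod xs \<circ> transp_prod ys)"
    unfolding coxeter_element_def transp_prod_def[symmetric]
    by (rule exI[of _ "xs @ ys"]) (use d in \<open>simp add: transp_prod_append\<close>)
  have c: "c = transp_prod xs \<circ> simple_transp (Suc n) \<circ> transp_prod ys"
    using as(3) unfolding xy by (simp add: transp_prod_append comp_assoc)
  show ?thesis
  proof (cases "n \<in> set ys")
    case True
    then have "\<forall>a\<in>set xs. Suc a < Suc n" using d by (fastforce simp: less_le)
    then have "c = simple_transp (Suc n) \<circ> (transp_prod xs \<circ> transp_prod ys)"
      using simple_transp_commute_list[of xs "Suc n"] unfolding c by (metis comp_assoc)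
    then show ?thesis using that cox by blast
  next
    case False
    then have "\<forall>a\<in>set ys. Suc a < Suc n" using d by (fastforce simp: less_le)
    then have "c = (transp_prod xs \<circ> transp_prod ys) \<circ> simple_transp (Suc n)"
      using simple_transp_commute_list[of ys "Suc n"] unfolding c by (metis comp_assoc)
    then show ?thesis using that cox by blast
  qed
qed

lemma cycle_likeD:
  assumes "cycle_like n c" "1 \<le> x" "x \<le> n + 1"
  shows "1 \<le> c x" "c x \<le> n + 1" "c x \<noteq> x"
    "x < c x \<Longrightarrow> x < z \<Longrightarrow> z < c x \<Longrightarrow> c z < z" "x < c x \<Longrightarrow> c x = n + 1 \<or> c x < c (c x)"
    "c x < x \<Longrightarrow> c x < z \<Longrightarrow> z < x \<Longrightarrow> z < c z" "c x < x \<Longrightarrow> c x = 1 \<or> c (c x) < c x"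
  using assms unfolding cycle_like_def by auto

text \<open>The factor inserts \<open>n + 2\<close> into the cycle right after \<open>n + 1\<close>,
  which becomes an ascending label.\<close>

lemma cycle_like_Suc_right:
  assumes c: "cycle_like n c" and n: "1 \<le> n"
  shows "cycle_like (Suc n) (c \<circ> simple_transp (Suc n))"
proof -
  define d where "d = c \<circ> simple_transp (Suc n)"
  have fix': "c x = x" if "x > n + 1" for x using c that unfolding cycle_like_def by blast
  have d1: "d (n + 1) = n + 2" "d (n + 2) = c (n + 1)" "\<And>x. x \<le> n \<Longrightarrow> d x = c x" "\<And>x. x > n + 2 \<Longrightarrow> d x = x"
    using fix' unfolding d_def simple_transp_def by auto
  have cn: "1 \<le> c (n + 1)" "c (n + 1) \<le> n" using cycle_likeD(1-3)[OF c, of "n + 1"] by auto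
  have "1 \<le> d x \<and> d x \<le> Suc n + 1 \<and> d x \<noteq> x
    \<and> (x < d x \<longrightarrow> (\<forall>z. x < z \<longrightarrow> z < d x \<longrightarrow> d z < z) \<and> (d x = Suc n + 1 \<or> d x < d (d x)))
    \<and> (d x < x \<longrightarrow> (\<forall>z. d x < z \<longrightarrow> z < x \<longrightarrow> z < d z) \<and> (d x = 1 \<or> d (d x) < d x))"
    if x: "x \<in> {1..Suc n + 1}" for x
  proof -
    consider "x \<le> n" | "x = n + 1" | "x = n + 2" using x by fastforce
    then show ?thesis
    proof cases
      case 1
      note * = cycle_likeD[OF c, of x]
      have dx: "d x = c x" using 1 d1 by simp
      have a: "d z < z" if "x < z" "z < c x" "x < c x" for z
        using *(2) *(4)[of z] that d1(3)[of z] x 1 by auto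
      have b: "c x = Suc n + 1 \<or> c x < d (c x)" if "x < c x"
        using *(2,5) that d1(1) d1(3)[of "c x"] x 1 by (cases "c x = n + 1") auto
      have e: "z < d z" if "c x < z" "z < x" for z
        using *(6)[of z] that d1(3)[of z] x 1 by auto
      have f: "c x = 1 \<or> d (c x) < c x" if "c x < x"
        using *(7) that d1(3)[of "c x"] x 1 by auto
      show ?thesis unfolding dx using *(1-3) a b e f x 1 by auto
    next
      case 2
      then show ?thesis using d1 by auto
    next
      case 3
      have dx: "d x = c (n + 1)" using 3 d1 by simp
      note * = cycle_likeD[OF c, of "n + 1"]
      have e: "z < d z" if "c (n + 1) < z" "z < x" for z
        using *(6)[of z] that d1(1) d1(3)[of z] cn 3 by (cases "z = n + 1") auto
      have f: "c (n + 1) = 1 \<or> d (c (n + 1)) < c (n + 1)"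
        using *(7) d1(3)[of "c (n + 1)"] cn by auto
      show ?thesis unfolding dx using cn e f 3 by auto
    qed
  qed
  then show ?thesis unfolding cycle_like_def d_def[symmetric] using d1(4) by auto
qed

text \<open>The factor inserts \<open>n + 2\<close> into the cycle right before
  \<open>n + 1\<close>, which stays a descending label.\<close>

lemma cycle_like_Suc_left:
  assumes c: "cycle_like n c" and n: "1 \<le> n"
  shows "cycle_like (Suc n) (simple_transp (Suc n) \<circ> c)"
proof -
  define d where "d = simple_transp (Suc n) \<circ> c"
  have fix': "c x = x" if "x > n + 1" for x using c that unfolding cycle_like_def by blast
  have rng: "c x \<le> n + 1" if "1 \<le> x" "x \<le> n + 1" for x using cycle_likeD(2)[OF c that] .
  have d1: "d (n + 2) = n + 1" "\<And>x. 1 \<le> x \<Longrightarrow> x \<le> n + 1 \<Longrightarrow> d x = (if c x = n + 1 then n + 2 else c x)"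
    "\<And>x. x > n + 2 \<Longrightarrow> d x = x"
    using fix' rng unfolding d_def simple_transp_def by fastforce+
  have cn: "1 \<le> c (n + 1)" "c (n + 1) \<le> n" using cycle_likeD(1-3)[OF c, of "n + 1"] by auto
  have "1 \<le> d x \<and> d x \<le> Suc n + 1 \<and> d x \<noteq> x
    \<and> (x < d x \<longrightarrow> (\<forall>z. x < z \<longrightarrow> z < d x \<longrightarrow> d z < z) \<and> (d x = Suc n + 1 \<or> d x < d (d x)))
    \<and> (d x < x \<longrightarrow> (\<forall>z. d x < z \<longrightarrow> z < x \<longrightarrow> z < d z) \<and> (d x = 1 \<or> d (d x) < d x))"
    if x: "x \<in> {1..Suc n + 1}" for x
  proof -
    consider "x \<le> n + 1" "c x = n + 1" | "x \<le> n + 1" "c x \<noteq> n + 1" | "x = n + 2" using x by fastforce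
    then show ?thesis
    proof cases
      case 1
      have dx: "d x = n + 2" using 1 x d1 by auto
      have xn: "x < n + 1" using 1 cn by (cases "x = n + 1") auto
      have a: "d z < z" if "x < z" "z < n + 2" for z
      proof (cases "z = n + 1")
        case True
        then show ?thesis using d1(2)[of "n + 1"] cn by auto
      next
        case False
        then have "c z < z" using cycle_likeD(4)[OF c, of x z] that x 1 xn by auto
        then show ?thesis using d1(2)[of z] that x by auto
      qed
      show ?thesis unfolding dx using a xn by auto
    next
      case 2
      note * = cycle_likeD[OF c, of x]
      have dx: "d x = c x" using 2 x d1 by auto
      have cx: "1 \<le> c x" "c x \<le> n" using *(1,2) 2 x by auto
      have a: "d z < z" if "x < z" "z < c x" "x < c x" for z
        using *(4)[of z] that d1(2)[of z] x 2 cx by auto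
      have b: "c x = Suc n + 1 \<or> c x < d (c x)" if "x < c x"
        using *(5) that d1(2)[of "c x"] x 2 cx by auto
      have e: "z < d z" if "c x < z" "z < x" for z
        using *(6)[of z] that d1(2)[of z] x 2 cx by auto
      have f: "c x = 1 \<or> d (c x) < c x" if "c x < x"
        using *(7) that d1(2)[of "c x"] x 2 cx by auto
      show ?thesis unfolding dx using *(3) cx a b e f x 2 by auto
    next
      case 3
      then show ?thesis using d1(1) d1(2)[of "n + 1"] cn by auto
    qed
  qed
  then show ?thesis unfolding cycle_like_def d_def[symmetric] using d1(3) by auto
qed

lemma coxeter_cycle_like:
  assumes "1 \<le> n" "coxeter_element n c"
  shows "cycle_like n c"
  using assms
proof (induction n arbitrary: c rule: dec_induct)
  case base
  obtain c' where c': "coxeter_element 0 c'" "c = c' \<circ> simple_transp 1 \<or> c = simple_transp 1 \<circ> c'"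
    using coxeter_element_Suc[of 0 c] base by auto
  have "c' = id" using c'(1) unfolding coxeter_element_def by auto
  then have "c = simple_transp 1" using c'(2) by auto
  then show ?case unfolding cycle_like_def simple_transp_def by (auto simp: le_Suc_eq)
next
  case (step n)
  then show ?case using coxeter_element_Suc[of n c] cycle_like_Suc_left cycle_like_Suc_right by metis
qed

text \<open>Within \<open>{1..k}\<close> the permutation \<open>c\<close> is the successor map of
  the order given by \<open>rho\<close>, and it leaves the set only from the maximum. The turn at 1
  fits because \<open>u 1\<close> holds, so 1 follows the descending labels; the turn at
  \<open>n + 1\<close> is outside as \<open>k \<le> n\<close>.\<close>

lemma cycle_like_rho:
  assumes c: "cycle_like n c" and k: "k \<le> n" and x: "1 \<le> x" "x \<le> k"
  defines "u \<equiv> \<lambda>x. x < c x"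
  shows "c x \<le> k \<Longrightarrow> rho u x < rho u (c x)"
    and "1 \<le> y \<Longrightarrow> y \<le> k \<Longrightarrow> rho u x < rho u y \<Longrightarrow> c x \<le> k \<and> rho u (c x) \<le> rho u y"
proof -
  have u1: "u 1" using cycle_likeD(1,3)[OF c, of 1] unfolding u_def by auto
  note * = cycle_likeD[OF c, of x]
  have up: "c x = n + 1 \<or> u (c x)" if "u x" using *(5) that x k unfolding u_def by auto
  have down: "c x = 1 \<or> \<not> u (c x)" if "\<not> u x"
    using *(3,7) that x k unfolding u_def by (metis le_trans linorder_neqE_nat not_less_iff_gr_or_eq trans_le_add1)
  have cx: "1 \<le> c x" "c x \<noteq> x" using *(1,3) x k by auto
  show "rho u x < rho u (c x)" if "c x \<le> k"
  proof (cases "u x")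
    case True
    then have "u (c x)" "x < c x" using up that k unfolding u_def by auto
    then show ?thesis using True unfolding rho_def by simp
  next
    case False
    then have "c x < x" using cx unfolding u_def by simp
    moreover have "c x = 1 \<or> \<not> u (c x)" using down False by blast
    ultimately show ?thesis using False cx x u1 unfolding rho_def by auto
  qed
  show "c x \<le> k \<and> rho u (c x) \<le> rho u y" if y: "1 \<le> y" "y \<le> k" "rho u x < rho u y"
  proof (cases "u x")
    case True
    then have uy: "u y" "x < y" using y x unfolding rho_def by (auto split: if_splits)
    have "c x \<le> y"
    proof (rule ccontr)
      assume "\<not> c x \<le> y"
      then have "c y < y" using *(4)[of y] True uy x k unfolding u_def by auto
      then show False using uy(1) unfolding u_def by simp
    qed
    then show ?thesis using up[OF True] uy y k unfolding rho_def by auto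
  next
    case False
    then have lt: "c x < x" using cx unfolding u_def by simp
    have "u y \<or> y \<le> c x"
    proof (rule ccontr)
      assume h: "\<not> (u y \<or> y \<le> c x)"
      then have "y < x" using y x False unfolding rho_def by auto
      then have "y < c y" using *(6)[of y] h lt x k by auto
      then show False using h unfolding u_def by simp
    qed
    then show ?thesis using down[OF False] lt x y u1 cx unfolding rho_def by (auto split: if_splits)
  qed
qed

text \<open>The mirror image of \<open>cycle_like_rho\<close>: now the turn at \<open>n + 1\<close>,
  a descending label, is inside, and \<open>1 \<le> k\<close> keeps the turn at 1 outside.\<close>

lemma cycle_like_kappa:
  assumes c: "cycle_like n c" and k: "1 \<le> k" and x: "k < x" "x \<le> n + 1"
  defines "u \<equiv> \<lambda>x. x < c x"
  shows "k < c x \<Longrightarrow> kappa (n + 1) u x < kappa (n + 1) u (c x)"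
    and "k < y \<Longrightarrow> y \<le> n + 1 \<Longrightarrow> kappa (n + 1) u x < kappa (n + 1) u y
      \<Longrightarrow> k < c x \<and> kappa (n + 1) u (c x) \<le> kappa (n + 1) u y"
proof -
  have um: "\<not> u (n + 1)" using cycle_likeD(2,3)[OF c, of "n + 1"] unfolding u_def by auto
  note * = cycle_likeD[OF c, of x]
  have up: "c x = n + 1 \<or> u (c x)" if "u x" using *(5) that x k unfolding u_def by auto
  have cx: "c x \<le> n + 1" "c x \<noteq> x" using *(2,3) x k by auto
  have down: "c x = 1 \<or> \<not> u (c x)" if "\<not> u x"
    using *(7) cx that x k unfolding u_def by auto
  show "kappa (n + 1) u x < kappa (n + 1) u (c x)" if "k < c x"
  proof (cases "u x")
    case True
    then have "x < c x" unfolding u_def by auto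
    then show ?thesis using True up[OF True] um cx unfolding kappa_def by auto
  next
    case False
    then have "c x < x" using cx unfolding u_def by simp
    then show ?thesis using False down[OF False] that k cx unfolding kappa_def by auto
  qed
  show "k < c x \<and> kappa (n + 1) u (c x) \<le> kappa (n + 1) u y"
    if y: "k < y" "y \<le> n + 1" "kappa (n + 1) u x < kappa (n + 1) u y"
  proof (cases "u x")
    case True
    then have lt: "x < c x" unfolding u_def by auto
    have "\<not> u y \<or> c x \<le> y"
    proof (rule ccontr)
      assume h: "\<not> (\<not> u y \<or> c x \<le> y)"
      then have "x < y" using y x True unfolding kappa_def by auto
      then have "c y < y" using *(4)[of y] h lt x k by auto
      then show False using h unfolding u_def by simp
    qed
    then show ?thesis using up[OF True] lt x y um cx unfolding kappa_def by (auto split: if_splits)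
  next
    case False
    then have uy: "\<not> u y" "y < x" using y x unfolding kappa_def by (auto split: if_splits)
    have "y \<le> c x"
    proof (rule ccontr)
      assume "\<not> y \<le> c x"
      then have "y < c y" using *(6)[of y] uy x k by auto
      then show False using uy(1) unfolding u_def by simp
    qed
    then show ?thesis using down[OF False] uy y k cx unfolding kappa_def by auto
  qed
qed

section \<open>Paths in the quiver and chains in the grid\<close>

lemma is_path_successively: "is_path V E p \<longleftrightarrow> p \<noteq> [] \<and> set p \<subseteq> V \<and> successively E p"
  unfolding is_path_def successively_conv_nth by simp

lemma is_path_append:
  assumes "is_path V E p" "is_path V E q" "last p = hd q"
  shows "is_path V E (p @ tl q)"
proof (cases q)
  case (Cons a q')
  then show ?thesis
    using assms unfolding is_path_successively by (cases q') (auto simp: successively_append_iff)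
qed (use assms in \<open>simp add: is_path_def\<close>)

text \<open>Paths and chains have the same unions up to enlargement, so both definitions of the
  Greene--Kleitman invariant agree.\<close>

lemma GK_M_eq_gk:
  fixes rk :: "'a \<Rightarrow> int"
  assumes fin: "finite V" and ne: "V \<noteq> {}"
    and refl: "\<And>x. le x x" and trans: "\<And>x y z. le x y \<Longrightarrow> le y z \<Longrightarrow> le x z"
    and rk: "\<And>x y. x \<in> V \<Longrightarrow> y \<in> V \<Longrightarrow> le x y \<Longrightarrow> x \<noteq> y \<Longrightarrow> rk x < rk y"
    and edge: "\<And>x y. x \<in> V \<Longrightarrow> y \<in> V \<Longrightarrow> E x y \<Longrightarrow> le x y"
    and conn: "\<And>x y. x \<in> V \<Longrightarrow> y \<in> V \<Longrightarrow> le x y \<Longrightarrow> \<exists>p. is_path V E p \<and> hd p = x \<and> last p = y"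
  shows "GK_M V E g t = gk le V g t"
proof (cases "t = 0")
  case False
  have path_le: "le x y \<or> le y x" if p: "is_path V E p" and xy: "x \<in> set p" "y \<in> set p" for p x y
  proof -
    have "sorted_wrt le p"
    proof -
      have "successively le p" using p edge unfolding is_path_def successively_conv_nth
        by (meson Suc_lessD nth_mem subsetD)
      then show ?thesis by (subst successively_conv_sorted_wrt[symmetric]) (auto intro: transpI trans)
    qed
    then show ?thesis using xy refl
      by (metis in_set_conv_nth linorder_neqE_nat sorted_wrt_nth_less)
  qed
  \<comment> \<open>The greatest element is removed, the rest lies on a path ending at its own
    greatest element, and a connecting path leads on from there.\<close>
  have chain_path: "\<exists>p. is_path V E p \<and> C \<subseteq> set p \<and> last p \<in> C \<and> (\<forall>x\<in>C. le x (last p))"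
    if "finite C" "C \<noteq> {}" "C \<subseteq> V" "\<And>x y. x \<in> C \<Longrightarrow> y \<in> C \<Longrightarrow> le x y \<or> le y x" for C
    using that
  proof (induction "card C" arbitrary: C rule: less_induct)
    case less
    define y where "y = arg_min_on (\<lambda>x. - rk x) C"
    have y: "y \<in> C" "\<And>x. x \<in> C \<Longrightarrow> rk x \<le> rk y"
      using arg_min_if_finite(1)[OF less.prems(1,2), of "\<lambda>x. - rk x"]
        arg_min_least[OF less.prems(1,2), of _ "\<lambda>x. - rk x"] unfolding y_def by auto
    have top: "le x y" if "x \<in> C" for x
    proof (rule ccontr)
      assume "\<not> le x y"
      then have "le y x" "y \<noteq> x" using less.prems(4)[OF that y(1)] refl by auto
      then have "rk y < rk x" using rk y(1) that less.prems(3) by blast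
      then show False using y(2)[OF that] by simp
    qed
    show ?case
    proof (cases "C - {y} = {}")
      case True
      then have "C = {y}" using y(1) by auto
      then show ?thesis using less.prems(3) refl by (intro exI[of _ "[y]"]) (auto simp: is_path_def)
    next
      case False
      have "card (C - {y}) < card C" using y(1) less.prems(1) by (intro psubset_card_mono) auto
      moreover have "finite (C - {y})" "C - {y} \<subseteq> V" using less.prems by auto
      moreover have "le x z \<or> le z x" if "x \<in> C - {y}" "z \<in> C - {y}" for x z
        using that less.prems(4) by blast
      ultimately obtain p where p: "is_path V E p" "C - {y} \<subseteq> set p" "last p \<in> C - {y}"
        using less.hyps[of "C - {y}"] False by blast
      obtain q where q: "is_path V E q" "hd q = last p" "last q = y"
        using conn[of "last p" y] p(3) y(1) top less.prems(3) by blast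
      have "last p \<noteq> y" using p(3) by blast
      then have tl: "tl q \<noteq> []" using q unfolding is_path_def by (cases q) auto
      have "last (p @ tl q) = y" using q(3) tl by (simp add: last_tl)
      moreover have "y \<in> set (p @ tl q)" using calculation tl last_in_set[of "p @ tl q"] by auto
      ultimately show ?thesis using is_path_append[OF p(1) q(1)] q(2) p(2) y(1) top
        by (intro exI[of _ "p @ tl q"]) auto
    qed
  qed
  let ?W = "{sum g (\<Union>p \<in> set ps. set p) | ps. length ps = t \<and> (\<forall>p \<in> set ps. is_path V E p)}"
  have "?W \<subseteq> sum g ` Pow V" unfolding is_path_def by fast
  then have finW: "finite ?W" using fin finite_subset by blast
  have union_le: "sum g (\<Union>p \<in> set ps. set p) \<le> gk le V g t"
    if ps: "length ps = t" "\<And>p. p \<in> set ps \<Longrightarrow> is_path V E p" for ps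
  proof -
    let ?U = "\<Union>p \<in> set ps. set p"
    define f where "f x = (LEAST i. i < t \<and> x \<in> set (ps ! i))" for x
    have f: "f x < t \<and> x \<in> set (ps ! f x)" if x: "x \<in> ?U" for x
    proof -
      obtain p where "p \<in> set ps" "x \<in> set p" using x by blast
      then obtain i where "i < t \<and> x \<in> set (ps ! i)" using ps(1) by (metis in_set_conv_nth)
      then show ?thesis unfolding f_def by (rule LeastI)
    qed
    have "chain_cov le t ?U"
    proof (rule chain_cov_rows[where rk = f])
      fix x y assume "x \<in> ?U" "y \<in> ?U" "f x = f y"
      then show "le x y \<or> le y x" using f[of x] f[of y] path_le[of "ps ! f x" x y] ps(1,2) by auto
    qed (use f in blast)
    moreover have "?U \<subseteq> V" using ps(2) unfolding is_path_def by blast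
    ultimately show ?thesis using gk_ge[OF fin] by blast
  qed
  have "Max ?W = gk le V g t"
  proof (rule Max_eqI[OF finW])
    fix s assume "s \<in> ?W"
    then show "s \<le> gk le V g t" using union_le by blast
  next
    obtain U where U: "U \<subseteq> V" "chain_cov le t U" "gk le V g t = sum g U" using gk_obtain[OF fin] .
    obtain f :: "_ \<Rightarrow> nat" where
      f: "\<And>x. x \<in> U \<Longrightarrow> f x < t" "\<And>x y. x \<in> U \<Longrightarrow> y \<in> U \<Longrightarrow> f x = f y \<Longrightarrow> le x y \<or> le y x"
      using U(2) unfolding chain_cov_def by blast
    have "\<exists>p. is_path V E p \<and> {x \<in> U. f x = i} \<subseteq> set p" for i
    proof (cases "{x \<in> U. f x = i} = {}")
      case True
      \<comment> \<open>Paths are nonempty, so an empty colour class is assigned a path of one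
        arbitrary vertex; here \<open>V \<noteq> {}\<close> enters.\<close>
      obtain v where "v \<in> V" using ne by blast
      then show ?thesis using True by (intro exI[of _ "[v]"]) (auto simp: is_path_def)
    next
      case False
      then show ?thesis using chain_path[of "{x \<in> U. f x = i}"] f(2) U(1) finite_subset[OF U(1) fin] by auto
    qed
    then obtain P where P: "\<And>i. is_path V E (P i) \<and> {x \<in> U. f x = i} \<subseteq> set (P i)" by metis
    define ps where "ps = map P [0..<t]"
    have "U \<subseteq> (\<Union>p \<in> set ps. set p)" using P f(1) unfolding ps_def by fastforce
    moreover have sub: "(\<Union>p \<in> set ps. set p) \<subseteq> V" using P unfolding ps_def is_path_def by auto
    ultimately have le: "gk le V g t \<le> sum g (\<Union>p \<in> set ps. set p)"
      using U(3) by (simp add: sum_mono2)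
    have "length ps = t" "\<forall>p \<in> set ps. is_path V E p" using P unfolding ps_def by auto
    then have "sum g (\<Union>p \<in> set ps. set p) \<in> ?W" by blast
    moreover have "sum g (\<Union>p \<in> set ps. set p) = gk le V g t"
      using le union_le[of ps] P unfolding ps_def by (intro antisym) auto
    ultimately show "gk le V g t \<in> ?W" by (simp only:)
  qed
  then show ?thesis using False unfolding GK_M_def by simp
qed (simp add: GK_M_def)

lemma AR_k_vertices_eq: "k \<le> n \<Longrightarrow> AR_k_vertices n k = rect (n + 1) k"
  unfolding AR_k_vertices_def AR_vertices_def rect_def by auto

text \<open>First the row label is moved by \<open>c\<close> until it agrees with that of
  \<open>y\<close>, then the column label. Every step goes to the next coordinate, so it neither
  overshoots \<open>y\<close> nor leaves the rectangle.\<close>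

lemma AR_path_exists:
  assumes c: "cycle_like n c" and k: "1 \<le> k" "k \<le> n"
    and xy: "x \<in> rect (n + 1) k" "y \<in> rect (n + 1) k"
    and le: "lab_le (n + 1) (\<lambda>x. x < c x) x y"
  shows "\<exists>p. is_path (rect (n + 1) k) (AR_edge c) p \<and> hd p = x \<and> last p = y"
  using xy le
proof (induction "nat (key (pos (n + 1) (\<lambda>x. x < c x) y) - key (pos (n + 1) (\<lambda>x. x < c x) x))"
    arbitrary: x rule: less_induct)
  case less
  let ?u = "\<lambda>x. x < c x"
  obtain l r where x: "x = (l, r)" by (cases x)
  obtain l' r' where y: "y = (l', r')" by (cases y)
  have lr: "1 \<le> l" "l \<le> k" "k < r" "r \<le> n + 1" "1 \<le> l'" "l' \<le> k" "k < r'" "r' \<le> n + 1"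
    using less.prems unfolding x y rect_def by auto
  have le: "rho ?u l \<le> rho ?u l'" "kappa (n + 1) ?u r \<le> kappa (n + 1) ?u r'"
    using less.prems unfolding x y lab_le_def le2_def pos_def by auto
  have extend: ?case if z: "z \<in> rect (n + 1) k" "AR_edge c x z" "lab_le (n + 1) ?u z y"
      "key (pos (n + 1) ?u x) < key (pos (n + 1) ?u z)" for z
  proof -
    have "key (pos (n + 1) ?u z) \<le> key (pos (n + 1) ?u y)"
      using z(3) unfolding lab_le_def le2_def key_def by simp
    then obtain p where p: "is_path (rect (n + 1) k) (AR_edge c) p" "hd p = z" "last p = y"
      using less.hyps[of z] z less.prems(2) by auto
    have "is_path (rect (n + 1) k) (AR_edge c) (x # p)"
      using p(1,2) z(2) less.prems(1) unfolding is_path_successively by (cases p) auto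
    then show ?thesis using p unfolding is_path_def by (intro exI[of _ "x # p"]) auto
  qed
  show ?case
  proof (cases "rho ?u l < rho ?u l'")
    case True
    have s: "c l \<le> k" "rho ?u (c l) \<le> rho ?u l'" "rho ?u l < rho ?u (c l)" "1 \<le> c l"
      using cycle_like_rho[OF c k(2) lr(1,2)] lr(5,6) True cycle_likeD(1)[OF c, of l] lr k by auto
    show ?thesis
      by (rule extend[of "(c l, r)"])
        (use s lr le in \<open>auto simp: x y rect_def AR_edge_def lab_le_def le2_def pos_def key_def\<close>)
  next
    case False
    show ?thesis
    proof (cases "kappa (n + 1) ?u r < kappa (n + 1) ?u r'")
      case True
      have s: "k < c r" "kappa (n + 1) ?u (c r) \<le> kappa (n + 1) ?u r'"
        "kappa (n + 1) ?u r < kappa (n + 1) ?u (c r)" "c r \<le> n + 1"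
        using cycle_like_kappa[OF c k(1) lr(3,4)] lr(7,8) True cycle_likeD(2)[OF c, of r] lr k by auto
      show ?thesis
        by (rule extend[of "(l, c r)"])
          (use s lr le in \<open>auto simp: x y rect_def AR_edge_def lab_le_def le2_def pos_def key_def\<close>)
    next
      case False
      then have "pos (n + 1) ?u x = pos (n + 1) ?u y"
        using \<open>\<not> rho ?u l < rho ?u l'\<close> le unfolding x y pos_def by simp
      then have "x = y" using pos_inv[of x "n + 1" ?u] pos_inv[of y "n + 1" ?u] lr x y by simp
      then show ?thesis using less.prems(1) by (intro exI[of _ "[x]"]) (auto simp: is_path_def)
    qed
  qed
qed

lemma GK_part_shape:
  assumes c: "cycle_like n c" and k: "1 \<le> k" "k \<le> n"
  shows "GK_part (AR_k_vertices n k) (AR_edge c) F (Suc i) = shape (n + 1) (\<lambda>x. x < c x) F k i"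
proof -
  let ?u = "\<lambda>x. x < c x"
  have "GK_M (rect (n + 1) k) (AR_edge c) F t = gk (lab_le (n + 1) ?u) (rect (n + 1) k) F t" for t
  proof (rule GK_M_eq_gk[where rk = "\<lambda>x. key (pos (n + 1) ?u x)"])
    show "rect (n + 1) k \<noteq> {}" using k unfolding rect_def by auto
    show "key (pos (n + 1) ?u x) < key (pos (n + 1) ?u y)"
      if "x \<in> rect (n + 1) k" "y \<in> rect (n + 1) k" "lab_le (n + 1) ?u x y" "x \<noteq> y" for x y
    proof (rule key_less)
      have "snd x \<le> n + 1" "snd y \<le> n + 1" using that(1,2) unfolding rect_def by auto
      then show "pos (n + 1) ?u x \<noteq> pos (n + 1) ?u y" using that(4) pos_inv by metis
    qed (use that in \<open>simp add: lab_le_def\<close>)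
    show "lab_le (n + 1) ?u x y"
      if "x \<in> rect (n + 1) k" "y \<in> rect (n + 1) k" "AR_edge c x y" for x y
    proof -
      obtain l r where x: "x = (l, r)" by (cases x)
      have lr: "1 \<le> l" "l \<le> k" "k < r" "r \<le> n + 1" using that unfolding x rect_def by auto
      have "y = (l, c r) \<or> y = (c l, r)" using that(3) unfolding x AR_edge_def by auto
      then show ?thesis
        using that(2) cycle_like_rho(1)[OF c k(2) lr(1,2)] cycle_like_kappa(1)[OF c k(1) lr(3,4)]
        unfolding x by (auto simp: rect_def lab_le_def le2_def pos_def)
    qed
  qed (use AR_path_exists[OF c k] in \<open>auto simp: lab_le_def le2_def\<close>)
  then show ?thesis unfolding GK_part_def shape_def AR_k_vertices_eq[OF k(2)] by simp
qed

section \<open>Partitions and reverse plane partitions\<close>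

lemma card_initial_segment:
  assumes "\<And>i i'. 1 \<le> i \<Longrightarrow> i \<le> i' \<Longrightarrow> i' \<le> p \<Longrightarrow> P i' \<Longrightarrow> P i" and i: "1 \<le> i" "i \<le> p"
  shows "i \<le> card {i \<in> {1..p}. P i} \<longleftrightarrow> P i"
proof
  assume "P i"
  then have "{1..i} \<subseteq> {i \<in> {1..p}. P i}" using assms by auto
  then have "card {1..i} \<le> card {i \<in> {1..p}. P i}" by (intro card_mono) auto
  then show "i \<le> card {i \<in> {1..p}. P i}" by simp
next
  assume le: "i \<le> card {i \<in> {1..p}. P i}"
  show "P i"
  proof (rule ccontr)
    assume "\<not> P i"
    then have "{i \<in> {1..p}. P i} \<subseteq> {1..<i}" using assms by (auto intro: ccontr simp: not_less)
    then have "card {i \<in> {1..p}. P i} \<le> card {1..<i}" by (intro card_mono) auto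
    then show False using le i by simp
  qed
qed

locale young =
  fixes lam :: "nat list" and p q m :: nat
  assumes partition: "is_partition lam" and nonempty: "lam \<noteq> []"
  defines "p \<equiv> length lam" and "q \<equiv> part1 lam" and "m \<equiv> part1 lam + length lam"
begin

abbreviation row where "row \<equiv> row_label lam"
abbreviation col where "col \<equiv> col_label lam"
abbreviation is_row where "is_row k \<equiv> k \<in> row_labels lam"

text \<open>The cells on the diagonal \<open>k\<close> are the cells \<open>(a k - x, b k - x)\<close> with \<open>x < min (a k) (b k)\<close>.\<close>

definition a :: "nat \<Rightarrow> nat" where "a k = card {i \<in> {1..p}. row i \<le> k}"
definition b :: "nat \<Rightarrow> nat" where "b k = card {j \<in> {1..q}. k < col j}"

lemma m_eq: "m = p + q"
  unfolding m_def p_def q_def by simp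

lemma part_antimono: "1 \<le> i \<Longrightarrow> i \<le> i' \<Longrightarrow> i' \<le> p \<Longrightarrow> part lam i' \<le> part lam i"
  using partition unfolding is_partition_def part_def p_def sorted_wrt_iff_nth_less
  by (cases "i = i'") auto

lemma part_1: "part lam 1 = q"
  using nonempty unfolding part_def q_def part1_def by (cases lam) auto

lemma part_le: "1 \<le> i \<Longrightarrow> i \<le> p \<Longrightarrow> part lam i \<le> q"
  using part_antimono[of 1 i] part_1 by simp

lemma part_pos: "1 \<le> i \<Longrightarrow> i \<le> p \<Longrightarrow> 1 \<le> part lam i"
  using partition nth_mem[of "i - 1" lam] unfolding is_partition_def part_def p_def
  by (metis One_nat_def Suc_le_eq diff_less_Suc less_one linorder_not_less not_less_eq_eq
      order_less_le_trans Suc_pred' le_eq_less_or_eq)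

lemma pq_pos: "1 \<le> p" "1 \<le> q"
  using nonempty part_pos[of 1] part_1 unfolding p_def by (auto simp: Suc_le_eq)

lemma conj_part_ge: "1 \<le> i \<Longrightarrow> i \<le> p \<Longrightarrow> i \<le> conj_part lam j \<longleftrightarrow> j \<le> part lam i"
  using card_initial_segment[of p "\<lambda>i. j \<le> part lam i" i] part_antimono
  unfolding conj_part_def p_def by (auto simp: conj_assoc intro: order_trans)

lemma conj_part_le: "conj_part lam j \<le> p"
proof -
  have "conj_part lam j \<le> card {1..p}" unfolding conj_part_def p_def by (rule card_mono) auto
  then show ?thesis by simp
qed

lemma conj_part_antimono: "j \<le> j' \<Longrightarrow> conj_part lam j' \<le> conj_part lam j"
  unfolding conj_part_def by (intro card_mono) auto

lemma row_strict: "1 \<le> i \<Longrightarrow> i < i' \<Longrightarrow> i' \<le> p \<Longrightarrow> row i < row i'"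
  using part_antimono[of i i'] part_le[of i] unfolding row_label_def q_def[symmetric] by auto

lemma col_strict: "1 \<le> j \<Longrightarrow> j < j' \<Longrightarrow> j' \<le> q \<Longrightarrow> col j' < col j"
  using conj_part_antimono[of j j'] unfolding col_label_def q_def[symmetric] by auto

lemma row_less_col: "1 \<le> i \<Longrightarrow> i \<le> p \<Longrightarrow> 1 \<le> j \<Longrightarrow> j \<le> q \<Longrightarrow> row i < col j \<longleftrightarrow> j \<le> part lam i"
  using conj_part_ge[of i j] part_le[of i] unfolding row_label_def col_label_def q_def[symmetric]
  by auto

lemma row_neq_col: "1 \<le> i \<Longrightarrow> i \<le> p \<Longrightarrow> 1 \<le> j \<Longrightarrow> j \<le> q \<Longrightarrow> row i \<noteq> col j"
  using conj_part_ge[of i j] part_le[of i] unfolding row_label_def col_label_def q_def[symmetric]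
  by (cases "j \<le> part lam i") auto

lemma row_range: "1 \<le> i \<Longrightarrow> i \<le> p \<Longrightarrow> 1 \<le> row i \<and> row i \<le> m"
  using part_pos[of i] unfolding row_label_def m_eq q_def[symmetric] by auto

lemma col_range: "1 \<le> j \<Longrightarrow> j \<le> q \<Longrightarrow> 1 \<le> col j \<and> col j \<le> m"
  using conj_part_le[of j] unfolding col_label_def m_eq q_def[symmetric] by auto

lemma row_inj: "inj_on row {1..p}"
  by (rule strict_mono_on_imp_inj_on) (auto simp: strict_mono_on_def row_strict)

lemma col_inj: "inj_on col {1..q}"
  by (rule inj_onI) (metis atLeastAtMost_iff col_strict linorder_neqE_nat less_irrefl)

lemma row_labels_eq: "row_labels lam = row ` {1..p}"
  unfolding row_labels_def p_def ..

lemma col_labels_eq: "col_labels lam = col ` {1..q}"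
  unfolding col_labels_def q_def ..

text \<open>By counting: \<open>p\<close> row labels and \<open>q\<close> column labels, all
  distinct, fill \<open>{1..m}\<close> since \<open>m = p + q\<close>.\<close>

lemma labels_partition: "row_labels lam \<inter> col_labels lam = {}" "row_labels lam \<union> col_labels lam = {1..m}"
proof -
  show disj: "row_labels lam \<inter> col_labels lam = {}"
    unfolding row_labels_eq col_labels_eq using row_neq_col by auto
  have "card (row_labels lam \<union> col_labels lam) = m"
    using disj card_image[OF row_inj] card_image[OF col_inj]
    unfolding row_labels_eq col_labels_eq m_eq by (simp add: card_Un_disjoint)
  moreover have "row_labels lam \<union> col_labels lam \<subseteq> {1..m}"
    unfolding row_labels_eq col_labels_eq using row_range col_range by auto
  ultimately show "row_labels lam \<union> col_labels lam = {1..m}"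
    by (intro card_subset_eq) auto
qed

lemma not_row: "1 \<le> k \<Longrightarrow> k \<le> m \<Longrightarrow> \<not> is_row k \<longleftrightarrow> k \<in> col_labels lam"
  using labels_partition by (metis Int_iff Un_iff atLeastAtMost_iff empty_iff)

lemma Fer_iff: "(i, j) \<in> Fer lam \<longleftrightarrow> 1 \<le> i \<and> i \<le> p \<and> 1 \<le> j \<and> j \<le> q \<and> row i < col j"
  using row_less_col[of i j] part_le[of i] unfolding Fer_def p_def[symmetric] by auto

lemma le_a: "1 \<le> i \<Longrightarrow> i \<le> p \<Longrightarrow> i \<le> a k \<longleftrightarrow> row i \<le> k"
  unfolding a_def by (rule card_initial_segment)
    (metis le_neq_implies_less row_strict less_imp_le order_trans)

lemma le_b: "1 \<le> j \<Longrightarrow> j \<le> q \<Longrightarrow> j \<le> b k \<longleftrightarrow> k < col j"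
  unfolding b_def by (rule card_initial_segment)
    (metis le_neq_implies_less col_strict order_less_trans)

lemma a_le: "a k \<le> p" and b_le: "b k \<le> q"
proof -
  have "a k \<le> card {1..p}" "b k \<le> card {1..q}" unfolding a_def b_def by (rule card_mono; auto)+
  then show "a k \<le> p" "b k \<le> q" by simp_all
qed

lemma a_0: "a 0 = 0"
  using row_range unfolding a_def by (fastforce simp: card_eq_0_iff)

lemma b_m: "m \<le> k \<Longrightarrow> b k = 0"
  using col_range unfolding b_def by (auto simp: card_eq_0_iff) (meson le_trans not_less)

text \<open>The labels \<open>1..k\<close> consist of \<open>a k\<close> row labels and
  \<open>q - b k\<close> column labels.\<close>

lemma ab: "k \<le> m \<Longrightarrow> k + b k = a k + q"
proof -
  assume k: "k \<le> m"
  have "{1..k} = row ` {i \<in> {1..p}. row i \<le> k} \<union> col ` {j \<in> {1..q}. \<not> k < col j}" (is "_ = ?A \<union> ?B")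
  proof (intro set_eqI iffI)
    fix x assume x: "x \<in> {1..k}"
    then have "x \<in> row_labels lam \<union> col_labels lam" using k labels_partition(2) by auto
    then show "x \<in> ?A \<union> ?B" using x unfolding row_labels_eq col_labels_eq by auto
  next
    fix x assume "x \<in> ?A \<union> ?B"
    then show "x \<in> {1..k}" using row_range col_range by auto
  qed
  moreover have "?A \<inter> ?B = {}" using row_neq_col by auto
  ultimately have "card {1..k} = card ?A + card ?B" by (subst \<open>{1..k} = _\<close>, intro card_Un_disjoint) auto
  then have "k = card ?A + card ?B" by simp
  moreover have "card ?A = a k" unfolding a_def
    by (rule card_image) (rule inj_on_subset[OF row_inj], auto)
  moreover have "card ?B = q - b k"
  proof -
    have "{j \<in> {1..q}. \<not> k < col j} = {1..q} - {j \<in> {1..q}. k < col j}" by auto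
    moreover have "card ({1..q} - {j \<in> {1..q}. k < col j}) = q - b k"
      unfolding b_def by (subst card_Diff_subset) auto
    ultimately have "card {j \<in> {1..q}. \<not> k < col j} = q - b k" by (rule ssubst)
    moreover have "card ?B = card {j \<in> {1..q}. \<not> k < col j}"
      by (rule card_image) (rule inj_on_subset[OF col_inj], auto)
    ultimately show ?thesis by simp
  qed
  ultimately show ?thesis using b_le[of k] by simp
qed

lemma ab_step_row:
  assumes "Suc k \<le> m" "is_row (Suc k)"
  shows "a (Suc k) = Suc (a k)" "b (Suc k) = b k"
proof -
  obtain i where i: "i \<in> {1..p}" "row i = Suc k" using assms(2) unfolding row_labels_eq by auto
  have "{i \<in> {1..p}. row i \<le> Suc k} = insert i {i \<in> {1..p}. row i \<le> k}"
  proof (intro set_eqI iffI)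
    fix x assume x: "x \<in> {i \<in> {1..p}. row i \<le> Suc k}"
    then have "x = i" if "row x = Suc k" using inj_onD[OF row_inj, of x i] i that by auto
    then show "x \<in> insert i {i \<in> {1..p}. row i \<le> k}" using x by (auto simp: le_Suc_eq)
  qed (use i in auto)
  then show "a (Suc k) = Suc (a k)" using i unfolding a_def by simp
  then show "b (Suc k) = b k" using ab[of k] ab[of "Suc k"] assms(1) by simp
qed

lemma ab_step_col:
  assumes "Suc k \<le> m" "\<not> is_row (Suc k)"
  shows "a (Suc k) = a k" "b k = Suc (b (Suc k))"
proof -
  have "row i \<noteq> Suc k" if "i \<in> {1..p}" for i
    using imageI[OF that, of row] assms(2) unfolding row_labels_eq by auto
  then have "{i \<in> {1..p}. row i \<le> Suc k} = {i \<in> {1..p}. row i \<le> k}" by (auto simp: le_Suc_eq)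
  then show "a (Suc k) = a k" unfolding a_def by simp
  then show "b k = Suc (b (Suc k))" using ab[of k] ab[of "Suc k"] assms(1) by simp
qed

text \<open>By \<open>ab\<close> the cell \<open>(a k, b k)\<close> is itself on the diagonal
  \<open>k\<close>; it is the last one there, and the position of a cell is its distance from
  it.\<close>

lemma Fer_ab:
  assumes "(i, j) \<in> Fer lam"
  shows "i \<le> a (q + i - j)" "j \<le> b (q + i - j)" "1 \<le> q + i - j" "q + i - j < m"
    "a (q + i - j) - i = b (q + i - j) - j"
proof -
  have ij: "1 \<le> i" "i \<le> p" "1 \<le> j" "j \<le> q" "row i < col j" using assms Fer_iff by auto
  have j: "j \<le> part lam i" "i \<le> conj_part lam j" using row_less_col conj_part_ge ij by auto
  show 1: "i \<le> a (q + i - j)" using le_a[of i] ij j part_le[of i] unfolding row_label_def q_def[symmetric] by auto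
  show 2: "j \<le> b (q + i - j)" using le_b[of j] ij j unfolding col_label_def q_def[symmetric] by auto
  show 3: "1 \<le> q + i - j" "q + i - j < m" using ij m_eq by auto
  show "a (q + i - j) - i = b (q + i - j) - j" using ab[of "q + i - j"] 1 2 3 ij by linarith
qed

lemma Fer_I:
  assumes "1 \<le> i" "i \<le> a k" "1 \<le> j" "j \<le> b k"
  shows "(i, j) \<in> Fer lam"
  using assms le_a[of i k] le_b[of j k] a_le[of k] b_le[of k] unfolding Fer_iff by auto

text \<open>The maximum in \<open>delta\<close> is attained at the last cell
  \<open>(a k, b k)\<close>. So the index used by \<open>RSK\<close>, counted from 0, is the
  distance of the cell from the south-east end of its diagonal.\<close>

lemma delta_eq:
  assumes ij: "(i, j) \<in> Fer lam"
  defines "k \<equiv> q + i - j"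
  shows "delta lam k - min i j = a k - i"
proof -
  note F = Fer_ab[OF ij, folded k_def]
  have ij': "1 \<le> i" "1 \<le> j" "j \<le> q" using ij Fer_iff by auto
  have kab: "k + b k = a k + q" using ab[of k] F by simp
  have diag_iff: "(i', j') \<in> diag lam k \<longleftrightarrow> (i', j') \<in> Fer lam \<and> q + i' = k + j'" for i' j'
    unfolding diag_def q_def[symmetric] by auto
  have "Max ((\<lambda>(i, j). min i j) ` diag lam k) = min (a k) (b k)"
  proof (rule Max_eqI)
    have "diag lam k \<subseteq> {1..p} \<times> {1..q}" using diag_iff Fer_iff by auto
    then show "finite ((\<lambda>(i, j). min i j) ` diag lam k)" using finite_subset by blast
    show "y \<le> min (a k) (b k)" if "y \<in> (\<lambda>(i, j). min i j) ` diag lam k" for y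
    proof -
      obtain i' j' where y: "y = min i' j'" "(i', j') \<in> Fer lam" "q + i' = k + j'"
        using \<open>y \<in> _\<close> diag_iff by auto
      then have "q + i' - j' = k" by simp
      then show ?thesis using Fer_ab(1,2)[OF y(2)] y(1) by auto
    qed
    have "(a k, b k) \<in> diag lam k" using diag_iff Fer_I[of "a k" k "b k"] F ij' kab by auto
    then show "min (a k) (b k) \<in> (\<lambda>(i, j). min i j) ` diag lam k" by force
  qed
  then have "delta lam k = min (a k) (b k)" unfolding delta_def .
  moreover have "q + i = k + j" using ij' unfolding k_def by simp
  ultimately show ?thesis using F(1,2,5) by (auto simp: min_def)
qed

section \<open>Interlacing sequences read along diagonals as reverse plane partitions\<close>

definition to_rpp :: "(nat \<Rightarrow> nat \<Rightarrow> nat) \<Rightarrow> nat \<times> nat \<Rightarrow> nat" where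
  "to_rpp s = restrict (\<lambda>(i, j). s (q + i - j) (a (q + i - j) - i)) (Fer lam)"

definition from_rpp :: "(nat \<times> nat \<Rightarrow> nat) \<Rightarrow> nat \<Rightarrow> nat \<Rightarrow> nat" where
  "from_rpp f k x = (if x < min (a k) (b k) then f (a k - x, b k - x) else 0)"

lemma seq_step_row:
  assumes "s \<in> interlacing_seqs m is_row" "Suc k \<le> m" "is_row (Suc k)"
  shows "s k x \<le> s (Suc k) x" "s (Suc k) (Suc x) \<le> s k x"
proof -
  have "\<forall>k\<in>{1..m}. if is_row k then interlace (s (k - 1)) (s k) else interlace (s k) (s (k - 1))"
    using assms(1) unfolding interlacing_seqs_def by blast
  from bspec[OF this, of "Suc k"]
  have "if is_row (Suc k) then interlace (s k) (s (Suc k)) else interlace (s (Suc k)) (s k)"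
    using assms(2) by (auto split: if_splits)
  then show "s k x \<le> s (Suc k) x" "s (Suc k) (Suc x) \<le> s k x" using assms(3) unfolding interlace_def by auto
qed

lemma seq_step_col:
  assumes "s \<in> interlacing_seqs m is_row" "Suc k \<le> m" "\<not> is_row (Suc k)"
  shows "s (Suc k) x \<le> s k x" "s k (Suc x) \<le> s (Suc k) x"
proof -
  have "\<forall>k\<in>{1..m}. if is_row k then interlace (s (k - 1)) (s k) else interlace (s k) (s (k - 1))"
    using assms(1) unfolding interlacing_seqs_def by blast
  from bspec[OF this, of "Suc k"]
  have "if is_row (Suc k) then interlace (s k) (s (Suc k)) else interlace (s (Suc k)) (s k)"
    using assms(2) by (auto split: if_splits)
  then show "s (Suc k) x \<le> s k x" "s k (Suc x) \<le> s (Suc k) x" using assms(3) unfolding interlace_def by auto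
qed

text \<open>From the left, a shape gains at most one part at each row label and none at a column
  label, so it has at most \<open>a k\<close> parts; from the right, the roles are interchanged and
  the bound is \<open>b k\<close>.\<close>

lemma seq_vanish:
  assumes s: "s \<in> interlacing_seqs m is_row" and x: "min (a k) (b k) \<le> x"
  shows "s k x = 0"
proof (cases "k \<le> m")
  case True
  have A: "k \<le> m \<Longrightarrow> a k \<le> x \<Longrightarrow> s k x = 0" for k x
  proof (induction k arbitrary: x)
    case 0
    then show ?case using s unfolding interlacing_seqs_def by simp
  next
    case (Suc k)
    show ?case
    proof (cases "is_row (Suc k)")
      case True
      then obtain y where y: "x = Suc y" "a k \<le> y"
        using ab_step_row(1)[of k] Suc.prems by (cases x) auto
      then show ?thesis using seq_step_row(2)[OF s Suc.prems(1) True, of y] Suc.IH[of y] Suc.prems by simp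
    next
      case False
      then show ?thesis using seq_step_col(1)[OF s Suc.prems(1) False, of x] Suc.IH[of x] Suc.prems
          ab_step_col(1)[of k] by simp
    qed
  qed
  have B: "k \<le> m \<Longrightarrow> b k \<le> x \<Longrightarrow> s k x = 0" for k x
  proof (induction k arbitrary: x rule: inc_induct)
    case base
    then show ?case using s unfolding interlacing_seqs_def by simp
  next
    case (step k)
    have k: "Suc k \<le> m" using step.hyps by simp
    show ?case
    proof (cases "is_row (Suc k)")
      case True
      then show ?thesis using seq_step_row(1)[OF s k True, of x] step.IH[of x] step.prems
          ab_step_row(2)[OF k True] by simp
    next
      case False
      then obtain y where y: "x = Suc y" "b (Suc k) \<le> y"
        using ab_step_col(2)[OF k False] step.prems by (cases x) auto
      then show ?thesis using seq_step_col(2)[OF s k False, of y] step.IH[of y] by simp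
    qed
  qed
  show ?thesis using A[OF True] B[OF True] x by (cases "a k \<le> x") auto
next
  case False
  then show ?thesis using s unfolding interlacing_seqs_def by simp
qed

text \<open>The step goes from diagonal \<open>k + 1\<close> to diagonal \<open>k\<close> and uses
  one of the two inequalities of interlacing at the label \<open>k + 1\<close>; which one depends on
  the type of the label, as \<open>a\<close> shifts the index only at row labels. The step down uses
  the other inequality.\<close>

lemma to_rpp_step_right:
  assumes s: "s \<in> interlacing_seqs m is_row" and F: "(i, j) \<in> Fer lam" "(i, Suc j) \<in> Fer lam"
  shows "to_rpp s (i, j) \<le> to_rpp s (i, Suc j)"
proof -
  have j: "j < q" using F(2) Fer_iff by auto
  define k where "k = q + i - Suc j"
  have k: "q + i - j = Suc k" using j unfolding k_def by simp
  have km: "Suc k \<le> m" using Fer_ab(4)[OF F(1)] k by simp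
  have i: "i \<le> a k" "i \<le> a (Suc k)" using Fer_ab(1)[OF F(1)] Fer_ab(1)[OF F(2)] k unfolding k_def by auto
  have "s (Suc k) (a (Suc k) - i) \<le> s k (a k - i)"
  proof (cases "is_row (Suc k)")
    case True
    then show ?thesis using seq_step_row(2)[OF s km True, of "a k - i"] ab_step_row(1)[OF km True] i
      by (simp add: Suc_diff_le)
  next
    case False
    then show ?thesis using seq_step_col(1)[OF s km False] ab_step_col(1)[OF km False] by simp
  qed
  then show ?thesis using F k unfolding to_rpp_def k_def by simp
qed

lemma to_rpp_step_down:
  assumes s: "s \<in> interlacing_seqs m is_row" and F: "(i, j) \<in> Fer lam" "(Suc i, j) \<in> Fer lam"
  shows "to_rpp s (i, j) \<le> to_rpp s (Suc i, j)"
proof -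
  have j: "j \<le> q" using F(2) Fer_iff by auto
  define k where "k = q + i - j"
  have k: "q + Suc i - j = Suc k" using j unfolding k_def by simp
  have km: "Suc k \<le> m" using Fer_ab(4)[OF F(2)] k by simp
  have i: "i \<le> a k" "Suc i \<le> a (Suc k)" using Fer_ab(1)[OF F(1)] Fer_ab(1)[OF F(2)] k unfolding k_def by auto
  have "s k (a k - i) \<le> s (Suc k) (a (Suc k) - Suc i)"
  proof (cases "is_row (Suc k)")
    case True
    then show ?thesis using seq_step_row(1)[OF s km True] ab_step_row(1)[OF km True] by simp
  next
    case False
    then have "Suc (a (Suc k) - Suc i) = a k - i" using ab_step_col(1)[OF km False] i by simp
    then show ?thesis using seq_step_col(2)[OF s km False, of "a (Suc k) - Suc i"] by simp
  qed
  then show ?thesis using F k unfolding to_rpp_def k_def by simp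
qed

lemma Fer_down_closed:
  assumes "(i', j') \<in> Fer lam" "1 \<le> i" "i \<le> i'" "1 \<le> j" "j \<le> j'"
  shows "(i, j) \<in> Fer lam"
  using assms part_antimono[of i i'] unfolding Fer_def p_def[symmetric] by auto

lemma to_rpp_RPP:
  assumes s: "s \<in> interlacing_seqs m is_row"
  shows "to_rpp s \<in> RPP lam"
proof -
  have right: "(i, j') \<in> Fer lam \<Longrightarrow> to_rpp s (i, j) \<le> to_rpp s (i, j')" if "j \<le> j'" "1 \<le> i" "1 \<le> j" for i j j'
    using that
  proof (induction j' rule: dec_induct)
    case (step j')
    have "(i, j') \<in> Fer lam" using Fer_down_closed[OF step.prems(1)] step by simp
    then show ?case using step to_rpp_step_right[OF s _ step.prems(1)] by fastforce
  qed simp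
  have down: "(i', j) \<in> Fer lam \<Longrightarrow> to_rpp s (i, j) \<le> to_rpp s (i', j)" if "i \<le> i'" "1 \<le> i" "1 \<le> j" for i i' j
    using that
  proof (induction i' rule: dec_induct)
    case (step i')
    have "(i', j) \<in> Fer lam" using Fer_down_closed[OF step.prems(1)] step by simp
    then show ?case using step to_rpp_step_down[OF s _ step.prems(1)] by fastforce
  qed simp
  have "to_rpp s (i, j) \<le> to_rpp s (i', j')"
    if F: "(i, j) \<in> Fer lam" "(i', j') \<in> Fer lam" and le: "i \<le> i'" "j \<le> j'" for i j i' j'
  proof -
    have 1: "1 \<le> i" "1 \<le> j" using F(1) Fer_iff by auto
    have "(i, j') \<in> Fer lam" using Fer_down_closed[OF F(2)] 1 le by simp
    then show ?thesis using right[of j j' i] down[of i i' j'] F 1 le by fastforce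
  qed
  moreover have "to_rpp s \<in> fillings lam" unfolding to_rpp_def fillings_def by simp
  ultimately show ?thesis unfolding RPP_def by blast
qed

lemma from_rpp_le:
  assumes "f \<in> RPP lam" "a k - x \<le> a l - y" "b k - x \<le> b l - y"
    and y: "x < min (a k) (b k) \<Longrightarrow> y < min (a l) (b l)"
  shows "from_rpp f k x \<le> from_rpp f l y"
proof (cases "x < min (a k) (b k)")
  case True
  then have "(a k - x, b k - x) \<in> Fer lam" by (intro Fer_I[of _ k]) auto
  moreover have "(a l - y, b l - y) \<in> Fer lam" using y[OF True] by (intro Fer_I[of _ l]) auto
  ultimately have "f (a k - x, b k - x) \<le> f (a l - y, b l - y)"
    using assms(1-3) unfolding RPP_def by blast
  then show ?thesis using True y[OF True] by (simp add: from_rpp_def)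
next
  case False
  then show ?thesis unfolding from_rpp_def by (simp only: if_False zero_le)
qed

lemma from_rpp_seqs:
  assumes f: "f \<in> RPP lam"
  shows "from_rpp f \<in> interlacing_seqs m is_row"
proof -
  have "if is_row k then interlace (from_rpp f (k - 1)) (from_rpp f k)
      else interlace (from_rpp f k) (from_rpp f (k - 1))" if km: "k \<in> {1..m}" for k
  proof -
    obtain l where k: "k = Suc l" "Suc l \<le> m" using km by (cases k) auto
    show ?thesis
    proof (cases "is_row (Suc l)")
      case True
      note st = ab_step_row[OF k(2) True]
      have "from_rpp f l x \<le> from_rpp f (Suc l) x" for x
        by (rule from_rpp_le[OF f]) (auto simp: st)
      moreover have "from_rpp f (Suc l) (Suc x) \<le> from_rpp f l x" for x
        by (rule from_rpp_le[OF f]) (auto simp: st)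
      ultimately show ?thesis using True k unfolding interlace_def by simp
    next
      case False
      note st = ab_step_col[OF k(2) False]
      have "from_rpp f (Suc l) x \<le> from_rpp f l x" for x
        by (rule from_rpp_le[OF f]) (auto simp: st)
      moreover have "from_rpp f l (Suc x) \<le> from_rpp f (Suc l) x" for x
        by (rule from_rpp_le[OF f]) (auto simp: st)
      ultimately show ?thesis using False k unfolding interlace_def by simp
    qed
  qed
  moreover have "from_rpp f 0 x = 0" "m \<le> k \<Longrightarrow> from_rpp f k x = 0" for k x
    using a_0 b_m unfolding from_rpp_def by auto
  ultimately show ?thesis unfolding interlacing_seqs_def by blast
qed

lemma bij_to_rpp: "bij_betw to_rpp (interlacing_seqs m is_row) (RPP lam)"
proof (rule bij_betw_byWitness[where f' = from_rpp])
  show "\<forall>s\<in>interlacing_seqs m is_row. from_rpp (to_rpp s) = s"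
  proof (intro ballI ext)
    fix s k x assume s: "s \<in> interlacing_seqs m is_row"
    show "from_rpp (to_rpp s) k x = s k x"
    proof (cases "x < min (a k) (b k)")
      case True
      then have F: "(a k - x, b k - x) \<in> Fer lam" by (intro Fer_I[of _ k]) auto
      have "k \<le> m" using True b_m[of k] by (cases "k \<le> m") auto
      then have "q + (a k - x) - (b k - x) = k" using ab[of k] True by auto
      then show ?thesis using True F unfolding from_rpp_def to_rpp_def by simp
    next
      case False
      then have "s k x = 0" by (intro seq_vanish[OF s] leI)
      then show ?thesis using False unfolding from_rpp_def by (simp only: if_False)
    qed
  qed
  show "\<forall>f\<in>RPP lam. to_rpp (from_rpp f) = f"
  proof (intro ballI ext)
    fix f and z :: "nat \<times> nat" assume f: "f \<in> RPP lam"
    obtain i j where z: "z = (i, j)" by (cases z)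
    show "to_rpp (from_rpp f) z = f z"
    proof (cases "z \<in> Fer lam")
      case True
      then have F: "(i, j) \<in> Fer lam" using z by simp
      note * = Fer_ab[OF F]
      have ij: "1 \<le> i" "1 \<le> j" using F Fer_iff by auto
      have "a (q + i - j) - (a (q + i - j) - i) = i" "b (q + i - j) - (a (q + i - j) - i) = j"
        using *(1,2,5) by auto
      moreover have "a (q + i - j) - i < min (a (q + i - j)) (b (q + i - j))"
        unfolding min_less_iff_conj using *(1,2,5) ij by linarith
      ultimately show ?thesis using F unfolding z to_rpp_def from_rpp_def by simp
    next
      case False
      have "f \<in> Fer lam \<rightarrow>\<^sub>E UNIV" using f unfolding RPP_def fillings_def by simp
      then have "f z = undefined" using False by (rule PiE_arb)
      then show ?thesis using False unfolding to_rpp_def by simp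
    qed
  qed
qed (use to_rpp_RPP from_rpp_seqs in auto)

section \<open>Fillings of the diagram as fillings of the labelled boxes, and the final
  composition\<close>

lemma box_eq:
  assumes "1 \<le> i" "i \<le> p" "1 \<le> j" "j \<le> q"
  shows "box lam (row i) (col j) = (i, j)"
  unfolding box_def
proof (rule the_equality)
  fix z
  assume "case z of (i', j') \<Rightarrow> i' \<in> {1..length lam} \<and> j' \<in> {1..part1 lam} \<and> row i' = row i \<and> col j' = col j"
  then show "z = (i, j)"
    using inj_onD[OF row_inj, of "fst z" i] inj_onD[OF col_inj, of "snd z" j] assms
    unfolding p_def q_def by (cases z) auto
qed (use assms in \<open>auto simp: p_def q_def\<close>)

lemma boxes_iff: "(l, r) \<in> boxes m is_row \<longleftrightarrow> l \<in> row_labels lam \<and> r \<in> col_labels lam \<and> l < r"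
proof -
  have "x \<in> {1..m}" if "x \<in> row_labels lam \<or> x \<in> col_labels lam" for x
    using that labels_partition(2) by blast
  then show ?thesis using not_row[of r] labels_partition(1) unfolding boxes_def by fastforce
qed

lemma boxes_eq: "boxes m is_row = (\<lambda>(i, j). (row i, col j)) ` Fer lam"
proof (intro set_eqI iffI)
  fix z assume z: "z \<in> boxes m is_row"
  obtain l r where "z = (l, r)" by (cases z)
  moreover from this obtain i j where "l = row i" "r = col j" "i \<in> {1..p}" "j \<in> {1..q}" "l < r"
    using z unfolding \<open>z = (l, r)\<close> boxes_iff by (auto simp: row_labels_eq col_labels_eq)
  ultimately show "z \<in> (\<lambda>(i, j). (row i, col j)) ` Fer lam"
    by (intro image_eqI[of _ _ "(i, j)"]) (auto simp: Fer_iff)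
next
  fix z assume "z \<in> (\<lambda>(i, j). (row i, col j)) ` Fer lam"
  then obtain i j where ij: "(i, j) \<in> Fer lam" "z = (row i, col j)" by auto
  show "z \<in> boxes m is_row"
    unfolding ij(2) boxes_iff using ij(1) by (simp add: Fer_iff row_labels_eq col_labels_eq)
qed

lemma bij_rep: "bij_betw (rep lam) (fillings lam) (fill m is_row)"
proof -
  define h where "h F = restrict (\<lambda>(i, j). F (row i, col j)) (Fer lam)" for F :: "nat \<times> nat \<Rightarrow> nat"
  have rep_Fer: "rep lam f (row i, col j) = f (i, j)" if "(i, j) \<in> Fer lam" for f i j
    using that box_eq[of i j] unfolding Fer_iff rep_def row_labels_eq col_labels_eq by auto
  have rep_0: "rep lam f z = 0" if "z \<notin> boxes m is_row" for f z
    using that boxes_iff[of "fst z" "snd z"] unfolding rep_def by (auto split: prod.splits)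
  show ?thesis
  proof (rule bij_betw_byWitness[where f' = h])
    show "\<forall>f\<in>fillings lam. h (rep lam f) = f"
    proof (intro ballI ext)
      fix f z assume f: "f \<in> fillings lam"
      show "h (rep lam f) z = f z"
      proof (cases "z \<in> Fer lam")
        case False
        then show ?thesis using PiE_arb[OF f[unfolded fillings_def] False] unfolding h_def by simp
      qed (auto simp: h_def rep_Fer split: prod.splits)
    qed
    show "\<forall>F\<in>fill m is_row. rep lam (h F) = F"
    proof (intro ballI ext)
      fix F z assume F: "F \<in> fill m is_row"
      show "rep lam (h F) z = F z"
      proof (cases "z \<in> boxes m is_row")
        case True
        then obtain i j where z: "z = (row i, col j)" "(i, j) \<in> Fer lam" unfolding boxes_eq by auto
        then show ?thesis using rep_Fer[OF z(2)] unfolding h_def by simp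
      next
        case False
        then show ?thesis using rep_0 fill_zero[OF F] by simp
      qed
    qed
    show "rep lam ` fillings lam \<subseteq> fill m is_row" using rep_0 by (auto intro!: fillI)
    show "h ` fill m is_row \<subseteq> fillings lam" unfolding h_def fillings_def by auto
  qed
qed

lemma RSK_eq:
  assumes "cycle_like n c" "m = n + 1"
  shows "RSK lam c f = to_rpp (shape m (\<lambda>x. x < c x) (rep lam f))"
proof
  fix z :: "nat \<times> nat"
  obtain i j where z: "z = (i, j)" by (cases z)
  show "RSK lam c f z = to_rpp (shape m (\<lambda>x. x < c x) (rep lam f)) z"
  proof (cases "z \<in> Fer lam")
    case True
    then have F: "(i, j) \<in> Fer lam" using z by simp
    define k where "k = q + i - j"
    have k: "1 \<le> k" "k \<le> n" using Fer_ab(3,4)[OF F] assms(2) unfolding k_def by auto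
    have n: "part1 lam + length lam - 1 = n" using assms(2) unfolding m_def by simp
    have "RSK lam c f (i, j) = GK_part (AR_k_vertices n k) (AR_edge c) (rep lam f) (delta lam k - min i j + 1)"
      using F n unfolding RSK_def k_def q_def by (simp add: Let_def)
    also have "\<dots> = shape m (\<lambda>x. x < c x) (rep lam f) k (a k - i)"
      using GK_part_shape[OF assms(1) k] delta_eq[OF F] assms(2) unfolding k_def by simp
    finally show ?thesis using F unfolding z to_rpp_def k_def by simp
  qed (simp add: RSK_def to_rpp_def)
qed

end

theorem theorem6p1:
  fixes n :: nat and lam :: "nat list" and c :: "nat \<Rightarrow> nat"
  assumes "n \<ge> 1"
    and "is_partition lam"
    and "part1 lam + length lam - 1 = n"
    and "coxeter_element n c"
  shows "bij_betw (RSK lam c) (fillings lam) (RPP lam)"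
proof -
  have "lam \<noteq> []" using assms(1,3) unfolding part1_def by auto
  then interpret young lam "length lam" "part1 lam" "part1 lam + length lam"
    using assms(2) by unfold_locales auto
  have m: "part1 lam + length lam = n + 1" using assms(1,3) by simp
  have "RSK lam c = to_rpp \<circ> (shape (n + 1) (\<lambda>x. x < c x) \<circ> rep lam)"
    using RSK_eq[OF coxeter_cycle_like[OF assms(1,4)] m] m by (simp add: fun_eq_iff)
  moreover have "bij_betw (to_rpp \<circ> (shape (n + 1) (\<lambda>x. x < c x) \<circ> rep lam)) (fillings lam) (RPP lam)"
    using bij_betw_trans[OF bij_betw_trans[OF bij_rep shape_bij] bij_to_rpp] unfolding m .
  ultimately show ?thesis by simp
qed

end
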